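(* Let $P_{\lambda}:\mathbb{R}^n\to\mathbb{R}^m$, $\lambda\in\Lambda$, be orthogonal projections, where $\Lambda$ is a compact metric space, and suppose that the map $\lambda\mapsto P_{\lambda}x$ is continuous on $\Lambda$ for every $x\in\mathbb{R}^n$. Let $\omega$ be a finite non-zero Borel measure on $\Lambda$. Let $s>m$. Suppose that there exists a positive number $C$ such that, for every $\mu\in\mathcal{M}(B^n(0,1))$ satisfying $\mu(B(x,r))\leq r^s$ for all $x\in\mathbb{R}^n$ and $r>0$, we have $P_{\lambda\sharp}\mu\ll\mathcal{L}^m$ for $\omega$ almost all $\lambda\in\Lambda$ and $$\iint D(P_{\lambda\sharp}\mu,u)^2\,d\mathcal{L}^m u\,d\omega\lambda < C\,\mu(B^n(0,1)).$$ If $A\subset\mathbb{R}^n$ is $\mathcal{H}^s$ measurable with $0<\mathcal{H}^s(A)<\infty$, then for $\omega$ almost all $\lambda\in\Lambda$, $$\mathcal{L}^m(\{u\in\mathbb{R}^m:\dim (P_{\lambda}^{-1}\{u\}\cap A)=s-m\})>0.$$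
   Context: $\mathcal{L}^m$ is Lebesgue measure on $\mathbb{R}^m$, $\mathcal{H}^s$ is $s$-dimensional Hausdorff measure and $\dim$ is Hausdorff dimension. $B(x,r)$ denotes the ball with centre $x$ and radius $r$, and $B^n(0,1)$ is the closed unit ball of $\mathbb{R}^n$. For $E\subset\mathbb{R}^n$, $\mathcal{M}(E)$ is the set of Borel measures $\mu$ with $0<\mu(E)<\infty$ and with compact support $\operatorname{spt}\mu\subset E$. An orthogonal projection $P_\lambda:\mathbb{R}^n\to\mathbb{R}^m$ means the orthogonal projection onto an $m$-dimensional linear subspace of $\mathbb{R}^n$ identified isometrically with $\mathbb{R}^m$ (i.e. a linear map with $P_\lambda P_\lambda^{T}=\mathrm{Id}_{\mathbb{R}^m}$). $P_{\lambda\sharp}\mu$ is the push-forward of $\mu$ under $P_\lambda$, i.e. $P_{\lambda\sharp}\mu(F)=\mu(P_\lambda^{-1}(F))$. For a measure $\tau$ on $\mathbb{R}^m$, $D(\tau,\cdot)$ denotes its Radon-Nikodym derivative with respect to $\mathcal{L}^m$, $D(\tau,u)=\lim_{\delta\to0}\tau(\{v\in\mathbb{R}^m:|v-u|\le\delta\})/(\mathcal{L}^m(B(0,1))\delta^m)$. *)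

theory Defs
  imports "HOL-Analysis.Analysis"
begin

section \<open>Hausdorff measure and dimension\<close>

text \<open>
  The gauge \<open>d(U)\<^sup>s\<close>, with the usual conventions \<open>d({})\<^sup>s = 0\<close> and \<open>d({x})\<^sup>0 = 1\<close>
  (whereas \<open>0 powr 0 = 0\<close>). It is only used for bounded sets: \<open>diameter\<close> is not
  meaningful for unbounded ones. No normalising constant is included.
\<close>
definition diam_powr :: "real \<Rightarrow> 'a::metric_space set \<Rightarrow> ennreal" where
  "diam_powr s U =
    (if U = {} then 0 else if s = 0 then 1 else ennreal (diameter U powr s))"

definition hausdorff_pre_measure :: "real \<Rightarrow> real \<Rightarrow> 'a::metric_space set \<Rightarrow> ennreal" where
  "hausdorff_pre_measure s \<delta> A =
    (INF U\<in>{U :: nat \<Rightarrow> 'a set. A \<subseteq> (\<Union>i. U i) \<and> (\<forall>i. bounded (U i) \<and> diameter (U i) \<le> \<delta>)}.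
      \<Sum>i. diam_powr s (U i))"

text \<open>An outer measure, defined on all subsets.\<close>
definition hausdorff_measure :: "real \<Rightarrow> 'a::metric_space set \<Rightarrow> ennreal" where
  "hausdorff_measure s A = (SUP \<delta>\<in>{0<..}. hausdorff_pre_measure s \<delta> A)"

text \<open>Measurability in the sense of Caratheodory: the splitting condition is tested on all sets.\<close>
definition hausdorff_measurable :: "real \<Rightarrow> 'a::metric_space set \<Rightarrow> bool" where
  "hausdorff_measurable s A \<longleftrightarrow> A \<in> lambda_system UNIV UNIV (hausdorff_measure s)"

definition hausdorff_dim :: "'a::metric_space set \<Rightarrow> ereal" where
  "hausdorff_dim A = (INF s\<in>{s. 0 \<le> s \<and> hausdorff_measure s A = 0}. ereal s)"

section \<open>Measures, projections and derivatives\<close>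

definition measure_support :: "'a::metric_space measure \<Rightarrow> 'a set" where
  "measure_support \<mu> = {x. \<forall>r>0. emeasure \<mu> (cball x r) > 0}"

definition compactly_supported_measures :: "'a::metric_space set \<Rightarrow> 'a measure set" where
  "compactly_supported_measures E =
    {\<mu>. sets \<mu> = sets borel \<and> 0 < emeasure \<mu> E \<and> emeasure \<mu> E < \<infinity> \<and>
        compact (measure_support \<mu>) \<and> measure_support \<mu> \<subseteq> E}"

definition orthogonal_projection :: "('a::euclidean_space \<Rightarrow> 'b::euclidean_space) \<Rightarrow> bool" where
  "orthogonal_projection P \<longleftrightarrow> linear P \<and> P \<circ> adjoint P = id"

definition lebesgue_density :: "(real ^ 'm) measure \<Rightarrow> real ^ 'm \<Rightarrow> ennreal" where
  "lebesgue_density \<tau> u =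
    Lim (at_right 0) (\<lambda>\<delta>::real. emeasure \<tau> {v. norm (v - u) \<le> \<delta>} /
      (emeasure lborel (cball (0 :: real ^ 'm) 1) * ennreal (\<delta> ^ CARD('m))))"

end

(*
The restriction of H^s to a suitable compact subset of A is a measure nu with nu(B(x,r)) <= c r^s.
The hypothesis, applied to nu restricted to a ball and rescaled to the unit ball, bounds the
omega-average of the number of nu-pairs (x,y) in the ball with |P(x-y)| <= d; averaging over the
centres of the balls bounds by const * rho^(s-m) d^m the measure of all triples (lambda,x,y) with
|x-y| <= rho and |P(x-y)| <= d. Summing over dyadic rho, the normalised t-energies of nu on thin
tubes P^{-1}B(u,delta) have bounded integral for every t < s-m, so by Fatou's lemma their lower
limit is finite for almost all lambda and u. If H^t of the fibre over u vanished, Cauchy-Schwarz on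
a cheap cover would then force the density of the projected measure at u to be zero. In the other
direction H^(s-m) of almost every fibre is finite by integrating pre-measures of covers of A.
*)
theory Submission
  imports Defs
begin


section \<open>Hausdorff measure as a metric outer measure\<close>

text \<open>No measures on the fibres are constructed, neither by disintegration nor as weak limits:
  everything happens on tubes of positive radius, and compactness of the carrier of
  \<open>\<nu>\<close> turns a cover of one fibre into a cover of all thin tubes around it. The gain
  in \<open>\<rho>\<close> is a matter of homogeneity: the number of pairs is quadratic in the
  measure, while the assumed bound is linear in its mass. Summed over dyadic radii against a kernel
  of order t, this gain produces a geometric series, which converges only for t strictly below s -
  m. The fibres are therefore shown to have nonzero t-measure for a sequence of t increasing to s -
  m, which is enough for the dimension, whereas their (s - m)-measure is bounded from above only.
  Functions of u such as the dimension of a fibre come without measurability, so the conclusion is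
  anchored at the Borel set where the density of the projected measure is nonzero.\<close>

lemma diam_powr_empty [simp]: "diam_powr s {} = 0"
  by (simp add: diam_powr_def)

lemma diam_powr_mono:
  assumes "0 \<le> s" "U \<subseteq> V" "bounded V"
  shows "diam_powr s U \<le> diam_powr s V"
proof -
  have "U \<noteq> {} \<Longrightarrow> diameter U powr s \<le> diameter V powr s"
    using assms diameter_subset[of U V] diameter_ge_0[of U] bounded_subset[of V U]
    by (intro powr_mono2) auto
  then show ?thesis
    using assms by (auto simp: diam_powr_def ennreal_leI)
qed

lemma hausdorff_pre_measure_le:
  assumes "A \<subseteq> (\<Union>i. U i)" "\<And>i. bounded (U i)" "\<And>i. diameter (U i) \<le> \<delta>"
  shows "hausdorff_pre_measure s \<delta> A \<le> (\<Sum>i::nat. diam_powr s (U i))"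
  unfolding hausdorff_pre_measure_def by (rule INF_lower) (use assms in auto)

lemma hausdorff_pre_measure_lessE:
  assumes "hausdorff_pre_measure s \<delta> A < c"
  obtains U :: "nat \<Rightarrow> 'a::metric_space set" where "A \<subseteq> (\<Union>i. U i)" "\<And>i. bounded (U i)"
    "\<And>i. diameter (U i) \<le> \<delta>" "(\<Sum>i. diam_powr s (U i)) < c"
  using assms that unfolding hausdorff_pre_measure_def INF_less_iff by blast

lemma hausdorff_pre_measure_mono:
  assumes "A \<subseteq> B" "\<delta>' \<le> \<delta>"
  shows "hausdorff_pre_measure s \<delta> A \<le> hausdorff_pre_measure s \<delta>' B"
  unfolding hausdorff_pre_measure_def
  by (rule INF_superset_mono) (use assms in \<open>auto intro: order_trans\<close>)

lemma hausdorff_pre_measure_le_measure: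
  "0 < \<delta> \<Longrightarrow> hausdorff_pre_measure s \<delta> A \<le> hausdorff_measure s A"
  unfolding hausdorff_measure_def by (rule SUP_upper) auto

lemma hausdorff_measure_leI:
  assumes "\<And>\<delta>. 0 < \<delta> \<Longrightarrow> hausdorff_pre_measure s \<delta> A \<le> c"
  shows "hausdorff_measure s A \<le> c"
  unfolding hausdorff_measure_def by (rule SUP_least) (use assms in auto)

lemma hausdorff_measure_mono: "A \<subseteq> B \<Longrightarrow> hausdorff_measure s A \<le> hausdorff_measure s B"
  unfolding hausdorff_measure_def by (intro SUP_mono' hausdorff_pre_measure_mono) auto

lemma hausdorff_measure_empty [simp]: "hausdorff_measure s {} = 0"
proof -
  have "hausdorff_measure s ({}::'a set) \<le> 0"
  proof (rule hausdorff_measure_leI)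
    fix \<delta> :: real assume "0 < \<delta>"
    then have "hausdorff_pre_measure s \<delta> ({}::'a set) \<le> (\<Sum>i::nat. diam_powr s ({}::'a set))"
      by (intro hausdorff_pre_measure_le) auto
    then show "hausdorff_pre_measure s \<delta> ({}::'a set) \<le> 0" by simp
  qed
  then show ?thesis by simp
qed

lemma hausdorff_pre_measure_UN_le:
  fixes A :: "nat \<Rightarrow> 'a::metric_space set"
  shows "hausdorff_pre_measure s \<delta> (\<Union>n. A n) \<le> (\<Sum>n. hausdorff_pre_measure s \<delta> (A n))"
proof (rule ennreal_le_epsilon)
  fix e :: real
  assume e: "0 < e" and fin: "(\<Sum>n. hausdorff_pre_measure s \<delta> (A n)) < top"
  have "hausdorff_pre_measure s \<delta> (A n) < hausdorff_pre_measure s \<delta> (A n) + e * (1/2)^Suc n" for n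
    using e fin by (auto simp add: less_top dest!: ennreal_suminf_lessD)
  then have "\<exists>U::nat \<Rightarrow> 'a set. A n \<subseteq> (\<Union>i. U i) \<and> (\<forall>i. bounded (U i) \<and> diameter (U i) \<le> \<delta>) \<and>
     (\<Sum>i. diam_powr s (U i)) \<le> hausdorff_pre_measure s \<delta> (A n) + e * (1/2)^Suc n" for n
    by (metis hausdorff_pre_measure_lessE less_imp_le)
  then obtain U :: "nat \<Rightarrow> nat \<Rightarrow> 'a set" where U: "\<And>n. A n \<subseteq> (\<Union>i. U n i)"
     "\<And>n i. bounded (U n i)" "\<And>n i. diameter (U n i) \<le> \<delta>"
     "\<And>n. (\<Sum>i. diam_powr s (U n i)) \<le> hausdorff_pre_measure s \<delta> (A n) + e * (1/2)^Suc n"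
    by metis
  define C where "C = case_prod U o prod_decode"
  have "(\<Union>n. A n) \<subseteq> (\<Union>i. C i)"
    using U(1) by (auto simp add: C_def subset_eq) (metis prod.case prod_encode_inverse)
  then have "hausdorff_pre_measure s \<delta> (\<Union>n. A n) \<le> (\<Sum>i. diam_powr s (C i))"
    by (rule hausdorff_pre_measure_le) (auto simp: C_def U split: prod.split)
  also have "\<dots> = (\<Sum>n. \<Sum>i. diam_powr s (U n i))"
    unfolding C_def comp_def by (intro suminf_ennreal_2dimen) auto
  also have "\<dots> \<le> (\<Sum>n. hausdorff_pre_measure s \<delta> (A n) + e * (1/2) ^ Suc n)"
    by (intro suminf_le suminf_nonneg allI U) auto
  also have "... = (\<Sum>n. hausdorff_pre_measure s \<delta> (A n)) + (\<Sum>n. ennreal e * ennreal ((1/2) ^ Suc n))"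
    using \<open>0 < e\<close> by (subst suminf_add[symmetric])
                     (auto simp del: ennreal_suminf_cmult simp add: ennreal_mult[symmetric])
  also have "\<dots> = (\<Sum>n. hausdorff_pre_measure s \<delta> (A n)) + e"
    unfolding ennreal_suminf_cmult
    by (subst suminf_ennreal_eq[OF zero_le_power power_half_series]) auto
  finally show "hausdorff_pre_measure s \<delta> (\<Union>n. A n) \<le> (\<Sum>n. hausdorff_pre_measure s \<delta> (A n)) + e" .
qed

lemma hausdorff_measure_UN_le:
  fixes A :: "nat \<Rightarrow> 'a::metric_space set"
  shows "hausdorff_measure s (\<Union>n. A n) \<le> (\<Sum>n. hausdorff_measure s (A n))"
proof (rule hausdorff_measure_leI)
  fix \<delta> :: real assume "0 < \<delta>"
  have "hausdorff_pre_measure s \<delta> (\<Union>n. A n) \<le> (\<Sum>n. hausdorff_pre_measure s \<delta> (A n))"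
    by (rule hausdorff_pre_measure_UN_le)
  also have "\<dots> \<le> (\<Sum>n. hausdorff_measure s (A n))"
    by (intro suminf_le hausdorff_pre_measure_le_measure \<open>0 < \<delta>\<close>) auto
  finally show "hausdorff_pre_measure s \<delta> (\<Union>n. A n) \<le> (\<Sum>n. hausdorff_measure s (A n))" .
qed

lemma hausdorff_outer_measure_space: "outer_measure_space UNIV (hausdorff_measure s)"
  by (auto simp: outer_measure_space_def positive_def increasing_def countably_subadditive_def
      hausdorff_measure_mono hausdorff_measure_UN_le)

lemma hausdorff_measure_Un_le:
  "hausdorff_measure s (A \<union> B) \<le> hausdorff_measure s A + hausdorff_measure s B"
proof -
  have "hausdorff_measure s (A \<union> B) = hausdorff_measure s (\<Union>i. binaryset A B i)"
    by (simp add: UN_binaryset_eq)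
  also have "\<dots> \<le> (\<Sum>i. hausdorff_measure s (binaryset A B i))"
    by (rule hausdorff_measure_UN_le)
  also have "\<dots> = hausdorff_measure s A + hausdorff_measure s B"
    by (simp add: suminf_binaryset_eq)
  finally show ?thesis .
qed

text \<open>A set of diameter below the gap \<open>e\<close> meets at most one of the two sets, so
  any fine cover of the union splits into a cover of each.\<close>

lemma hausdorff_measure_separated_Un:
  assumes "0 \<le> s" and e: "0 < e" "\<And>x y. x \<in> A \<Longrightarrow> y \<in> B \<Longrightarrow> e \<le> dist x y"
  shows "hausdorff_measure s A + hausdorff_measure s B \<le> hausdorff_measure s (A \<union> B)"
proof -
  have main: "hausdorff_pre_measure s \<delta> A + hausdorff_pre_measure s \<delta> B \<le> hausdorff_pre_measure s \<delta> (A \<union> B)"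
    if "0 < \<delta>" "\<delta> < e" for \<delta>
  proof (rule ccontr)
    assume "\<not> ?thesis"
    then obtain U where U: "A \<union> B \<subseteq> (\<Union>i. U i)" "\<And>i. bounded (U i)" "\<And>i. diameter (U i) \<le> \<delta>"
      "(\<Sum>i::nat. diam_powr s (U i)) < hausdorff_pre_measure s \<delta> A + hausdorff_pre_measure s \<delta> B"
      by (auto simp: not_le elim: hausdorff_pre_measure_lessE)
    have le: "hausdorff_pre_measure s \<delta> X \<le> (\<Sum>i. diam_powr s (U i \<inter> X))" if "X \<subseteq> (\<Union>i. U i)" for X
      using that U(2,3)
      by (intro hausdorff_pre_measure_le)
        (auto intro: bounded_subset order_trans[OF diameter_subset])
    have "U i \<inter> A = {} \<or> U i \<inter> B = {}" for i
    proof (rule ccontr)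
      assume "\<not> ?thesis"
      then obtain x y where xy: "x \<in> U i" "y \<in> U i" "x \<in> A" "y \<in> B" by auto
      with e U(3)[of i] that diameter_bounded_bound[OF U(2)[of i] xy(1,2)] show False
        by fastforce
    qed
    then have "diam_powr s (U i \<inter> A) + diam_powr s (U i \<inter> B) \<le> diam_powr s (U i)" for i
      using diam_powr_mono[OF \<open>0 \<le> s\<close> _ U(2)[of i]]
      by (metis Int_lower1 add.left_neutral add.right_neutral diam_powr_empty)
    then have "(\<Sum>i. diam_powr s (U i \<inter> A) + diam_powr s (U i \<inter> B)) \<le> (\<Sum>i. diam_powr s (U i))"
      by (intro suminf_le) auto
    moreover have "(\<Sum>i. diam_powr s (U i \<inter> A) + diam_powr s (U i \<inter> B))
        = (\<Sum>i. diam_powr s (U i \<inter> A)) + (\<Sum>i. diam_powr s (U i \<inter> B))"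
      by (rule suminf_add[symmetric]) auto
    ultimately have "hausdorff_pre_measure s \<delta> A + hausdorff_pre_measure s \<delta> B \<le> (\<Sum>i. diam_powr s (U i))"
      using add_mono[OF le[of A] le[of B]] U(1) by simp
    with U(4) show False by simp
  qed
  \<comment> \<open>The suprema over the scales of \<open>A\<close> and of \<open>B\<close> are
    taken one after the other, so the inequality is needed for two independent scales; a common
    finer one serves both.\<close>
  have pre: "hausdorff_pre_measure s \<delta> A + hausdorff_pre_measure s \<delta>' B \<le> hausdorff_measure s (A \<union> B)"
    if "0 < \<delta>" "0 < \<delta>'" for \<delta> \<delta>'
  proof -
    let ?d = "min (min \<delta> \<delta>') (e/2)"
    have "hausdorff_pre_measure s \<delta> A + hausdorff_pre_measure s \<delta>' B
        \<le> hausdorff_pre_measure s ?d A + hausdorff_pre_measure s ?d B"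
      by (intro add_mono hausdorff_pre_measure_mono) auto
    also have "\<dots> \<le> hausdorff_pre_measure s ?d (A \<union> B)"
      using that e by (intro main) auto
    also have "\<dots> \<le> hausdorff_measure s (A \<union> B)"
      using that e by (intro hausdorff_pre_measure_le_measure) auto
    finally show ?thesis .
  qed
  have "hausdorff_measure s A + hausdorff_pre_measure s \<delta>' B \<le> hausdorff_measure s (A \<union> B)"
    if "0 < \<delta>'" for \<delta>'
    unfolding hausdorff_measure_def[of s A]
    by (subst ennreal_SUP_add_left[symmetric]) (use pre that in \<open>auto intro!: SUP_least\<close>)
  then show ?thesis
    unfolding hausdorff_measure_def[of s B]
    by (subst ennreal_SUP_add_right) (auto intro!: SUP_least)
qed

text \<open>The gap may depend on n: the shells around a closed set, to which this is applied, have
  gaps that shrink to zero.\<close>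

lemma hausdorff_measure_sum_separated:
  fixes R :: "nat \<Rightarrow> 'a::metric_space set"
  assumes "0 \<le> s"
    and "\<And>n. \<exists>e>0. \<forall>x\<in>(\<Union>i<n. R i). \<forall>y\<in>R n. e \<le> dist x y"
  shows "(\<Sum>i<n. hausdorff_measure s (R i)) \<le> hausdorff_measure s (\<Union>i<n. R i)"
proof (induction n)
  case (Suc n)
  obtain e where e: "e > 0" "\<And>x y. x \<in> (\<Union>i<n. R i) \<Longrightarrow> y \<in> R n \<Longrightarrow> e \<le> dist x y"
    using assms(2)[of n] by blast
  have "(\<Sum>i<Suc n. hausdorff_measure s (R i)) \<le> hausdorff_measure s (\<Union>i<n. R i) + hausdorff_measure s (R n)"
    using Suc by (simp add: add_right_mono)
  also have "\<dots> \<le> hausdorff_measure s ((\<Union>i<n. R i) \<union> R n)"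
    by (rule hausdorff_measure_separated_Un[OF assms(1) e])
  also have "(\<Union>i<n. R i) \<union> R n = (\<Union>i<Suc n. R i)"
    by (auto simp: less_Suc_eq)
  finally show ?case .
qed simp

text \<open>Caratheodory's criterion: the shells around a closed set of even index, and those of odd
  index, are pairwise separated, so the tails of their measures vanish.\<close>

lemma closed_in_lambda_system:
  fixes C :: "'a::metric_space set"
  assumes "0 \<le> s" "closed C"
  shows "C \<in> lambda_system UNIV UNIV (hausdorff_measure s)"
proof -
  let ?H = "hausdorff_measure s :: 'a set \<Rightarrow> ennreal"
  have "?H (T \<inter> C) + ?H (T - C) \<le> ?H T" if fin: "?H T < \<infinity>" and "C \<noteq> {}" for T
  proof -
    \<comment> \<open>\<open>D n\<close> keeps away from \<open>C\<close>, so its measure and that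
      of \<open>T \<inter> C\<close> add up; the half-open shells \<open>R k\<close> with k at least
      n fill the rest of \<open>T - C\<close>.\<close>
    define D where "D n = {x\<in>T. 1 / (real n + 1) \<le> infdist x C}" for n
    define R where "R k = {x\<in>T. 1 / (real k + 2) \<le> infdist x C \<and> infdist x C < 1 / (real k + 1)}" for k
    have pos: "0 < infdist x C" if "x \<notin> C" for x
      using in_closed_iff_infdist_zero[OF assms(2) \<open>C \<noteq> {}\<close>, of x] that infdist_nonneg[of x C]
      by linarith
    have sep: "\<exists>e>0. \<forall>x\<in>(\<Union>i<n. R (2*i + b)). \<forall>y\<in>R (2*n+b). e \<le> dist x y" for n b
    proof (cases "n = 0")
      case False
      show ?thesis
      proof (intro exI conjI ballI)
        \<comment> \<open>Skipping every other shell leaves this gap: the earlier shells have index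
          at most 2n + b - 2, hence distance at least 1 / (2n + b) from \<open>C\<close>.\<close>
        show "0 < 1 / (2*real n + real b) - 1 / (2*real n + real b+1)"
          using False by (simp add: frac_less2)
        fix x y assume xy: "x \<in> (\<Union>i<n. R (2*i + b))" "y \<in> R (2*n+b)"
        then obtain i where i: "i < n" "x \<in> R (2*i+b)" by auto
        have "1 / (2*real n + real b) \<le> 1 / (real (2*i+b) + 2)"
          using i by (intro divide_left_mono) auto
        also have "\<dots> \<le> infdist x C" using i by (simp add: R_def)
        finally have "1 / (2*real n + real b) \<le> infdist x C" .
        moreover have "infdist y C < 1 / (2*real n + real b+1)"
          using xy(2) by (simp add: R_def)
        moreover have "infdist x C \<le> infdist y C + dist x y" by (rule infdist_triangle)
        ultimately show "1 / (2*real n + real b) - 1 / (2*real n + real b+1) \<le> dist x y" by linarith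
      qed
    qed (auto intro: exI[of _ 1])
    have half: "(\<Sum>i<n. ?H (R (2*i+b))) \<le> ?H T" for n b
    proof -
      have "(\<Sum>i<n. ?H (R (2*i+b))) \<le> ?H (\<Union>i<n. R (2*i+b))"
        by (rule hausdorff_measure_sum_separated[OF assms(1) sep])
      also have "\<dots> \<le> ?H T" by (rule hausdorff_measure_mono) (auto simp: R_def)
      finally show ?thesis .
    qed
    have split: "(\<Sum>i<2*n. ?H (R i)) = (\<Sum>i<n. ?H (R (2*i+0))) + (\<Sum>i<n. ?H (R (2*i+1)))" for n
      by (induction n) (auto simp: algebra_simps)
    have "(\<Sum>i<n. ?H (R i)) \<le> ?H T + ?H T" for n
    proof -
      have "(\<Sum>i<n. ?H (R i)) \<le> (\<Sum>i<2*n. ?H (R i))" by (rule sum_mono2) auto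
      also have "\<dots> \<le> ?H T + ?H T" unfolding split by (intro add_mono half)
      finally show ?thesis .
    qed
    then have "(\<Sum>i. ?H (R i)) \<le> ?H T + ?H T" by (intro suminf_le_const) auto
    also have "\<dots> < \<infinity>" using fin by simp
    finally have tot: "(\<Sum>i. ?H (R i)) < \<infinity>" .
    have shells: "T - C \<subseteq> D n \<union> (\<Union>i. R (i + n))" for n
    proof
      fix x assume x: "x \<in> T - C"
      show "x \<in> D n \<union> (\<Union>i. R (i + n))"
      proof (cases "x \<in> D n")
        case False
        then have small: "infdist x C < 1 / (real n + 1)" using x by (auto simp: D_def)
        obtain N where "inverse (real (Suc N)) < infdist x C"
          using reals_Archimedean[OF pos[of x]] x by blast
        then have "1 / (real N + 1) < infdist x C" by (simp add: inverse_eq_divide add.commute)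
        moreover have "1 / (real N + 2) \<le> 1 / (real N + 1)" by (intro divide_left_mono) auto
        ultimately have ex: "\<exists>k. 1 / (real k + 2) \<le> infdist x C"
          by (intro exI[of _ N]) linarith
        define k where "k = (LEAST k. 1 / (real k + 2) \<le> infdist x C)"
        have k: "1 / (real k + 2) \<le> infdist x C"
          unfolding k_def by (rule LeastI_ex[OF ex])
        have least: "infdist x C < 1 / (real j + 2)" if "j < k" for j
          using not_less_Least[of j "\<lambda>k. 1 / (real k + 2) \<le> infdist x C"] that
          by (auto simp: k_def)
        have "n \<le> k"
        proof (rule ccontr)
          assume "\<not> n \<le> k"
          then have "1 / (real n + 1) \<le> 1 / (real k + 2)" by (intro divide_left_mono) auto
          with k small show False by simp
        qed
        moreover have "infdist x C < 1 / (real k + 1)"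
        proof (cases k)
          case 0 with small \<open>n \<le> k\<close> show ?thesis by simp
        next
          case (Suc j) with least[of j] show ?thesis by (simp add: add.commute)
        qed
        ultimately have "x \<in> R ((k - n) + n)" using k x by (simp add: R_def)
        then show ?thesis by blast
      qed simp
    qed
    \<comment> \<open>A partial sum is added on the left, instead of a tail being subtracted on the
      right, because subtraction in \<open>ennreal\<close> truncates. The finite total is cancelled
      only after n has tended to infinity.\<close>
    have "?H (T \<inter> C) + ?H (T - C) + (\<Sum>i<n. ?H (R i)) \<le> ?H T + (\<Sum>i. ?H (R i))" for n
    proof -
      have "?H (T - C) \<le> ?H (D n) + ?H (\<Union>i. R (i+n))"
        using hausdorff_measure_mono[OF shells] hausdorff_measure_Un_le order_trans by blast
      also have "\<dots> \<le> ?H (D n) + (\<Sum>i. ?H (R (i+n)))"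
        by (intro add_left_mono hausdorff_measure_UN_le)
      finally have 1: "?H (T - C) \<le> ?H (D n) + (\<Sum>i. ?H (R (i+n)))" .
      have "?H (T \<inter> C) + ?H (D n) \<le> ?H ((T \<inter> C) \<union> D n)"
      proof (rule hausdorff_measure_separated_Un[OF assms(1)])
        fix x y assume xy: "x \<in> T \<inter> C" "y \<in> D n"
        have "1 / (real n + 1) \<le> infdist y C" using xy by (simp add: D_def)
        also have "\<dots> \<le> dist y x" using xy by (intro infdist_le) auto
        finally show "1 / (real n + 1) \<le> dist x y" by (simp add: dist_commute)
      qed simp
      also have "\<dots> \<le> ?H T" by (rule hausdorff_measure_mono) (auto simp: D_def)
      finally have 2: "?H (T \<inter> C) + ?H (D n) \<le> ?H T" .
      have "?H (T \<inter> C) + ?H (T - C) + (\<Sum>i<n. ?H (R i))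
          \<le> ?H (T \<inter> C) + (?H (D n) + (\<Sum>i. ?H (R (i+n)))) + (\<Sum>i<n. ?H (R i))"
        by (intro add_mono 1 order_refl)
      also have "\<dots> = (?H (T \<inter> C) + ?H (D n)) + ((\<Sum>i. ?H (R (i+n))) + (\<Sum>i<n. ?H (R i)))"
        by (simp add: algebra_simps)
      also have "(\<Sum>i. ?H (R (i+n))) + (\<Sum>i<n. ?H (R i)) = (\<Sum>i. ?H (R i))"
        using suminf_offset[of "\<lambda>i. ?H (R i)" n] by (simp add: add.commute)
      finally show ?thesis using 2 by (meson add_right_mono order_trans)
    qed
    moreover have "(\<lambda>n. ?H (T \<inter> C) + ?H (T - C) + (\<Sum>i<n. ?H (R i)))
        \<longlonglongrightarrow> ?H (T \<inter> C) + ?H (T - C) + (\<Sum>i. ?H (R i))"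
      by (intro tendsto_add tendsto_const summable_LIMSEQ) auto
    ultimately have "?H (T \<inter> C) + ?H (T - C) + (\<Sum>i. ?H (R i)) \<le> ?H T + (\<Sum>i. ?H (R i))"
      by (intro LIMSEQ_le_const2) auto
    then show ?thesis using tot ennreal_add_left_cancel_le[of "\<Sum>i. ?H (R i)"]
      by (metis add.commute infinity_ennreal_def less_irrefl)
  qed
  then have le: "?H (T \<inter> C) + ?H (T - C) \<le> ?H T" for T
    by (cases "?H T < \<infinity>"; cases "C = {}") (auto simp: less_top[symmetric])
  have "?H (C \<inter> T) + ?H ((UNIV - C) \<inter> T) = ?H T" for T
  proof (rule antisym)
    show "?H (C \<inter> T) + ?H ((UNIV - C) \<inter> T) \<le> ?H T"
      using le[of T] by (simp add: Int_commute Diff_eq)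
    have "T = (C \<inter> T) \<union> ((UNIV - C) \<inter> T)" by auto
    then show "?H T \<le> ?H (C \<inter> T) + ?H ((UNIV - C) \<inter> T)"
      using hausdorff_measure_Un_le by metis
  qed
  then show ?thesis by (simp add: lambda_system_def)
qed

section \<open>Borel regularity of Hausdorff measure\<close>

definition hausdorff_borel :: "real \<Rightarrow> 'a::metric_space measure" where
  "hausdorff_borel s = measure_of UNIV (sets borel) (hausdorff_measure s)"

lemma sets_hausdorff_borel [simp, measurable_cong]: "sets (hausdorff_borel s) = sets borel"
  unfolding hausdorff_borel_def
  by (metis sets.sets_measure_of_eq space_borel)

lemma space_hausdorff_borel [simp]: "space (hausdorff_borel s) = UNIV"
  using sets_eq_imp_space_eq[OF sets_hausdorff_borel] by simp

text \<open>\<open>measure_of\<close> falls back to the zero measure unless the given function is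
  countably additive. It is so on the Caratheodory sets, which form a sigma-algebra containing the
  closed sets and hence all Borel sets.\<close>

lemma emeasure_hausdorff_borel:
  assumes "0 \<le> s" "A \<in> sets borel"
  shows "emeasure (hausdorff_borel s) A = hausdorff_measure s A"
proof -
  interpret sigma_algebra "UNIV::'a set" "UNIV::'a set set"
    using sigma_algebra_Pow[of "UNIV::'a set"] by simp
  let ?L = "lambda_system UNIV UNIV (hausdorff_measure s) :: 'a set set"
  have ms: "measure_space UNIV ?L (hausdorff_measure s)"
    by (rule caratheodory_lemma[OF hausdorff_outer_measure_space])
  then have "sigma_algebra UNIV ?L" by (simp add: measure_space_def)
  then have "sets (borel::'a measure) \<subseteq> ?L"
    unfolding borel_eq_closed
    using sigma_algebra.sigma_sets_subset[of UNIV ?L "Collect closed"] closed_in_lambda_system[OF assms(1)]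
    by auto
  then have "measure_space UNIV (sets (borel::'a measure)) (hausdorff_measure s)"
    using measure_down[OF ms] sets.sigma_algebra_axioms[of borel] by simp
  then have "countably_additive (sets (borel::'a measure)) (hausdorff_measure s)"
    "positive (sets (borel::'a measure)) (hausdorff_measure s)"
    by (auto simp: measure_space_def)
  then show ?thesis
    using assms(2) unfolding hausdorff_borel_def
    by (intro emeasure_measure_of_sigma) (use sets.sigma_algebra_axioms[of borel] in auto)
qed

text \<open>Closing the sets of a cover changes neither their diameters nor their gauges, so the
  intersection over j of closed covers at scale 1 / (j + 1) is Borel and no more expensive than
  \<open>A\<close>.\<close>

lemma hausdorff_borel_hull:
  fixes A :: "'a::metric_space set"
  assumes fin: "hausdorff_measure s A < \<infinity>"
  obtains B where "B \<in> sets borel" "A \<subseteq> B" "hausdorff_measure s B = hausdorff_measure s A"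
proof -
  let ?d = "\<lambda>j::nat. 1 / (real j + 1)"
  have "\<exists>U::nat \<Rightarrow> 'a set. A \<subseteq> (\<Union>i. U i) \<and> (\<forall>i. bounded (U i)) \<and> (\<forall>i. diameter (U i) \<le> ?d j) \<and>
    (\<Sum>i. diam_powr s (U i)) < hausdorff_measure s A + ?d j" for j
  proof -
    have "hausdorff_pre_measure s (?d j) A \<le> hausdorff_measure s A"
      by (rule hausdorff_pre_measure_le_measure) simp
    also have "\<dots> < hausdorff_measure s A + ?d j"
      using fin by (auto simp: less_top)
    finally show ?thesis by (rule hausdorff_pre_measure_lessE) blast
  qed
  then obtain U :: "nat \<Rightarrow> nat \<Rightarrow> 'a set" where U: "\<And>j. A \<subseteq> (\<Union>i. U j i)" "\<And>j i. bounded (U j i)"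
    "\<And>j i. diameter (U j i) \<le> ?d j" "\<And>j. (\<Sum>i. diam_powr s (U j i)) < hausdorff_measure s A + ?d j"
    by metis
  define B where "B = (\<Inter>j. \<Union>i. closure (U j i))"
  have cl: "diam_powr s (closure (U j i)) = diam_powr s (U j i)" for j i
    using U(2) by (simp add: diam_powr_def diameter_closure)
  have AB: "A \<subseteq> B"
    unfolding B_def
  proof (intro INT_greatest)
    fix j
    have "(\<Union>i. U j i) \<subseteq> (\<Union>i. closure (U j i))" by (intro UN_mono closure_subset) auto
    with U(1)[of j] show "A \<subseteq> (\<Union>i. closure (U j i))" by (rule order_trans)
  qed
  have "hausdorff_measure s B \<le> hausdorff_measure s A"
  proof (rule hausdorff_measure_leI, rule ennreal_le_epsilon)
    fix \<delta> e :: real assume "0 < \<delta>" "0 < e"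
    then obtain j where "inverse (real (Suc j)) < min \<delta> e"
      using reals_Archimedean[of "min \<delta> e"] by auto
    then have j: "?d j < \<delta>" "?d j < e" by (auto simp: field_simps)
    have "hausdorff_pre_measure s \<delta> B \<le> (\<Sum>i. diam_powr s (closure (U j i)))"
      using U(2) order_trans[OF U(3) less_imp_le[OF j(1)]]
      by (intro hausdorff_pre_measure_le) (auto simp: B_def diameter_closure)
    also have "\<dots> \<le> hausdorff_measure s A + ?d j"
      unfolding cl by (rule less_imp_le[OF U(4)])
    also have "\<dots> \<le> hausdorff_measure s A + e"
      using j by (intro add_left_mono ennreal_leI) auto
    finally show "hausdorff_pre_measure s \<delta> B \<le> hausdorff_measure s A + e" .
  qed
  then have "hausdorff_measure s B = hausdorff_measure s A"
    using hausdorff_measure_mono[OF AB] by (intro antisym)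
  moreover have "B \<in> sets borel" unfolding B_def by auto
  ultimately show ?thesis using that AB by blast
qed

text \<open>Caratheodory's condition, tested on a hull \<open>B\<close>, shows that \<open>B\<close>
  exceeds \<open>A\<close> by a null set. Removing a Borel hull \<open>N\<close> of that null set
  leaves a Borel subset of \<open>A\<close> of positive measure.\<close>

lemma hausdorff_measurable_compact_subset:
  fixes A :: "'a::euclidean_space set"
  assumes "0 \<le> s" "hausdorff_measurable s A" "0 < hausdorff_measure s A" "hausdorff_measure s A < \<infinity>"
  obtains K where "compact K" "K \<subseteq> A" "0 < hausdorff_measure s K"
proof -
  let ?H = "hausdorff_measure s :: 'a set \<Rightarrow> ennreal"
  obtain B where B: "B \<in> sets borel" "A \<subseteq> B" "?H B = ?H A"
    using hausdorff_borel_hull[OF assms(4)] .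
  have "?H (A \<inter> B) + ?H ((UNIV - A) \<inter> B) = ?H B"
    using assms(2) by (simp add: hausdorff_measurable_def lambda_system_def)
  moreover have "A \<inter> B = A" using B by auto
  ultimately have "?H A + ?H ((UNIV - A) \<inter> B) = ?H A + 0" using B by simp
  then have z: "?H ((UNIV - A) \<inter> B) = 0"
    using assms(4) by (simp only: ennreal_add_left_cancel) auto
  then obtain N where N: "N \<in> sets borel" "(UNIV - A) \<inter> B \<subseteq> N" "?H N = 0"
    using hausdorff_borel_hull[of s "(UNIV - A) \<inter> B"] by auto
  have sub: "B - N \<subseteq> A" using N by auto
  have "?H B \<le> ?H (B - N) + ?H N"
    by (rule order_trans[OF hausdorff_measure_mono hausdorff_measure_Un_le]) auto
  then have pos: "0 < ?H (B - N)" using N B assms(3) by auto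
  have fin: "?H (B - N) < \<infinity>"
    using hausdorff_measure_mono[OF sub, of s] assms(4) by (rule le_less_trans)
  \<comment> \<open>Hausdorff measure on the whole space need not be sigma-finite; its restriction
    to \<open>B - N\<close> is finite, as inner regularity by compact sets requires.\<close>
  define M where "M = density (hausdorff_borel s) (indicator (B - N))"
  have M: "emeasure M X = ?H ((B - N) \<inter> X)" if "X \<in> sets borel" for X
    unfolding M_def using that B N
    by (subst emeasure_restricted) (auto simp: emeasure_hausdorff_borel[OF assms(1)])
  have sM: "sets M = sets borel" by (simp add: M_def)
  have "emeasure M (B - N) = (SUP K \<in> {K. K \<subseteq> B - N \<and> compact K}. emeasure M K)"
    using fin M[of UNIV] B N by (intro inner_regular sM) (auto simp: M_def)
  moreover have "0 < emeasure M (B - N)" using M[of "B - N"] pos B N by simp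
  ultimately obtain K where K: "K \<subseteq> B - N" "compact K" "0 < emeasure M K"
    by (auto simp: less_SUP_iff)
  then have "0 < ?H K" using M[of K] by (simp add: borel_compact Int_absorb1)
  with K sub that show ?thesis by blast
qed

section \<open>Comparison of exponents and Hausdorff dimension\<close>

lemma hausdorff_measure_eq_0_mono:
  assumes "0 \<le> t" "t < t'" "hausdorff_measure t A < \<infinity>"
  shows "hausdorff_measure t' A = 0"
proof -
  have "hausdorff_measure t' A \<le> ennreal e * (hausdorff_measure t A + 1)" if "0 < e" for e :: real
  proof (rule hausdorff_measure_leI)
    fix \<delta> :: real assume "0 < \<delta>"
    \<comment> \<open>On sets of diameter at most this \<open>\<eta>\<close>, raising the exponent
      from \<open>t\<close> to \<open>t'\<close> multiplies the gauge by at most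
      \<open>e\<close>.\<close>
    define \<eta> where "\<eta> = min \<delta> (e powr (1 / (t' - t)))"
    have \<eta>: "0 < \<eta>" "\<eta> \<le> \<delta>" "\<eta> powr (t' - t) \<le> e"
    proof -
      show "0 < \<eta>" "\<eta> \<le> \<delta>" using \<open>0 < \<delta>\<close> that by (auto simp: \<eta>_def)
      have "\<eta> powr (t' - t) \<le> (e powr (1 / (t' - t))) powr (t' - t)"
        using \<open>0 < \<delta>\<close> that assms by (intro powr_mono2) (auto simp: \<eta>_def)
      also have "\<dots> = e" using that assms by (simp add: powr_powr)
      finally show "\<eta> powr (t' - t) \<le> e" .
    qed
    have "hausdorff_pre_measure t \<eta> A < hausdorff_measure t A + 1"
      using hausdorff_pre_measure_le_measure[OF \<eta>(1), of t A] assms(3)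
      by (simp add: le_less_trans less_top ennreal_add_left_cancel_less)
    then obtain U where U: "A \<subseteq> (\<Union>i. U i)" "\<And>i. bounded (U i)"
      "\<And>i. diameter (U i) \<le> \<eta>" "(\<Sum>i. diam_powr t (U i)) < hausdorff_measure t A + 1"
      by (rule hausdorff_pre_measure_lessE) blast
    have "hausdorff_pre_measure t' \<delta> A \<le> (\<Sum>i. diam_powr t' (U i))"
      using U \<eta>(2) by (intro hausdorff_pre_measure_le) (auto intro: order_trans)
    also have "\<dots> \<le> (\<Sum>i. ennreal e * diam_powr t (U i))"
    proof (intro suminf_le allI)
      fix i
      have d: "0 \<le> diameter (U i)" using U(2) by (rule diameter_ge_0)
      \<comment> \<open>The case distinction mirrors the gauge at exponent 0, where a nonempty set
        costs 1 although \<open>0 powr 0 = 0\<close>.\<close>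
      have "diameter (U i) powr t' \<le> e * (if t = 0 then 1 else diameter (U i) powr t)"
      proof -
        have "diameter (U i) powr (t' - t) \<le> e"
          using \<eta>(3) powr_mono2[OF _ d U(3)[of i], of "t' - t"] assms by linarith
        then have "diameter (U i) powr (t' - t) * (if t = 0 then 1 else diameter (U i) powr t) \<le>
           e * (if t = 0 then 1 else diameter (U i) powr t)"
          by (intro mult_right_mono) auto
        also have "diameter (U i) powr (t' - t) * (if t = 0 then 1 else diameter (U i) powr t)
            = diameter (U i) powr t'"
          by (auto simp: powr_add[symmetric])
        finally show ?thesis .
      qed
      then show "diam_powr t' (U i) \<le> ennreal e * diam_powr t (U i)"
        using assms that by (auto simp: diam_powr_def ennreal_mult[symmetric] intro!: ennreal_leI)
    qed auto
    also have "\<dots> = ennreal e * (\<Sum>i. diam_powr t (U i))" by (rule ennreal_suminf_cmult)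
    also have "\<dots> \<le> ennreal e * (hausdorff_measure t A + 1)"
      using U(4) by (intro mult_left_mono) auto
    finally show "hausdorff_pre_measure t' \<delta> A \<le> ennreal e * (hausdorff_measure t A + 1)" .
  qed note bound = this
  obtain c where c: "hausdorff_measure t A + 1 = ennreal c" "0 \<le> c"
    using assms(3) by (cases "hausdorff_measure t A + 1") auto
  have "hausdorff_measure t' A \<le> 0 + ennreal e" if "0 < e" for e :: real
  proof -
    have "hausdorff_measure t' A \<le> ennreal (e / (c + 1)) * ennreal c"
      using bound[of "e / (c+1)"] that c by simp
    also have "\<dots> = ennreal (e / (c+1) * c)" using that c by (intro ennreal_mult[symmetric]) auto
    also have "\<dots> \<le> ennreal e" using that c by (intro ennreal_leI) (simp add: field_simps)
    finally show ?thesis by simp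
  qed
  then have "hausdorff_measure t' A \<le> 0" by (rule ennreal_le_epsilon)
  then show ?thesis by simp
qed

text \<open>Exponents just below d suffice for the lower bound because vanishing is inherited by all
  larger exponents.\<close>

lemma hausdorff_dim_eqI:
  assumes "0 < d" "hausdorff_measure d A < \<infinity>"
    and "\<And>e. 0 < e \<Longrightarrow> \<exists>t. 0 \<le> t \<and> d - e \<le> t \<and> t < d \<and> hausdorff_measure t A \<noteq> 0"
  shows "hausdorff_dim A = ereal d"
  unfolding hausdorff_dim_def
proof (rule antisym)
  show "(INF s\<in>{s. 0 \<le> s \<and> hausdorff_measure s A = 0}. ereal s) \<le> ereal d"
  proof (rule ereal_le_epsilon2)
    fix e :: real assume "0 < e"
    then have "hausdorff_measure (d + e) A = 0"
      using assms by (intro hausdorff_measure_eq_0_mono[of d]) auto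
    then have "(INF s\<in>{s. 0 \<le> s \<and> hausdorff_measure s A = 0}. ereal s) \<le> ereal (d + e)"
      using assms \<open>0 < e\<close> by (intro INF_lower) auto
    then show "(INF s\<in>{s. 0 \<le> s \<and> hausdorff_measure s A = 0}. ereal s) \<le> ereal d + ereal e" by simp
  qed
  show "ereal d \<le> (INF s\<in>{s. 0 \<le> s \<and> hausdorff_measure s A = 0}. ereal s)"
  proof (rule INF_greatest)
    fix r assume "r \<in> {s. 0 \<le> s \<and> hausdorff_measure s A = 0}"
    then have r: "0 \<le> r" "hausdorff_measure r A = 0" by auto
    have "\<not> r < d"
    proof
      assume "r < d"
      then obtain t where t: "(r + d) / 2 \<le> t" "t < d" "hausdorff_measure t A \<noteq> 0"
        using assms(3)[of "(d - r) / 2"] by (auto simp: field_simps)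
      then have "hausdorff_measure t A = 0"
        using r \<open>r < d\<close> by (intro hausdorff_measure_eq_0_mono[of r]) auto
      with t show False by simp
    qed
    then show "ereal d \<le> ereal r" by simp
  qed
qed


section \<open>Densities and the Vitali covering lemma\<close>

text \<open>Used twice: for Hausdorff measure on a compact set with exponent s, and for a finite
  Borel measure with the dimension of the space as exponent. The disjoint balls selected by Vitali
  together carry at most the mass of \<open>W\<close>, and their fivefold enlargements cover; hence
  \<open>5 powr p\<close>.\<close>

lemma vitali_cover_of_growth:
  fixes E :: "'a::euclidean_space set" and \<sigma> :: "'a measure"
  assumes sets: "sets \<sigma> = sets borel" and W: "W \<in> sets borel" and "0 \<le> c" "0 < \<delta>" "0 \<le> p"
    and E: "\<And>x. x \<in> E \<Longrightarrow> \<exists>r. 0 < r \<and> r \<le> \<delta> \<and> cball x r \<subseteq> W \<and> ennreal (c * r powr p) \<le> emeasure \<sigma> (cball x r)"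
  obtains a :: "nat \<Rightarrow> 'a" and \<rho> :: "nat \<Rightarrow> real"
  where "E \<subseteq> (\<Union>i. cball (a i) (\<rho> i))" "\<And>i. 0 \<le> \<rho> i" "\<And>i. \<rho> i \<le> 5 * \<delta>"
    "(\<Sum>i. ennreal (c * \<rho> i powr p)) \<le> ennreal (5 powr p) * emeasure \<sigma> W"
proof -
  obtain r where r: "\<And>x. x \<in> E \<Longrightarrow> 0 < r x" "\<And>x. x \<in> E \<Longrightarrow> r x \<le> \<delta>" "\<And>x. x \<in> E \<Longrightarrow> cball x (r x) \<subseteq> W"
    "\<And>x. x \<in> E \<Longrightarrow> ennreal (c * r x powr p) \<le> emeasure \<sigma> (cball x (r x))"
    using E by metis
  obtain C where C: "countable C" "C \<subseteq> E"
    "pairwise (\<lambda>i j. disjnt (cball i (r i)) (cball j (r j))) C"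
    "E \<subseteq> (\<Union>i\<in>C. cball i (5 * r i))"
  proof (rule Vitali_covering_lemma_cballs[of E "\<lambda>x. x" r E \<delta>])
    show "E \<subseteq> (\<Union>i\<in>E. cball i (r i))" using r(1) by (force intro: less_imp_le)
  qed (use r in auto)
  define I where "I = to_nat_on C ` C"
  define f where "f = from_nat_into C"
  have f: "f i \<in> C" if "i \<in> I" for i
    using that C(1) by (auto simp: I_def f_def)
  have inj: "i = j" if "i \<in> I" "j \<in> I" "f i = f j" for i j
    using that C(1) by (auto simp: I_def f_def)
  have onto: "\<exists>i\<in>I. f i = x" if "x \<in> C" for x
    using that C(1) by (auto simp: I_def f_def)
  \<comment> \<open>The selected family may be finite. The remaining indices get radius 0, which
    costs nothing because \<open>0 powr p = 0\<close> for every p.\<close>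
  define \<rho> where "\<rho> i = (if i \<in> I then 5 * r (f i) else 0)" for i
  define X where "X i = (if i \<in> I then cball (f i) (r (f i)) else {})" for i
  have "disjoint_family X"
    unfolding disjoint_family_on_def
  proof (intro ballI impI)
    fix i j :: nat assume "i \<noteq> j"
    then show "X i \<inter> X j = {}"
      using pairwiseD[OF C(3), of "f i" "f j"] f inj by (auto simp: X_def disjnt_def)
  qed
  then have dX: "disjoint_family X" .
  then have "(\<Sum>i. emeasure \<sigma> (X i)) = emeasure \<sigma> (\<Union>i. X i)"
    by (intro suminf_emeasure dX) (auto simp: sets X_def[abs_def])
  also have "\<dots> \<le> emeasure \<sigma> W"
    using r(3) f C(2) W by (intro emeasure_mono) (auto simp: X_def sets split: if_splits)
  finally have sum: "(\<Sum>i. emeasure \<sigma> (X i)) \<le> emeasure \<sigma> W" .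
  show thesis
  proof (rule that[of f \<rho>])
    show "E \<subseteq> (\<Union>i. cball (f i) (\<rho> i))"
    proof
      fix x assume "x \<in> E"
      then obtain y where "y \<in> C" "x \<in> cball y (5 * r y)" using C(4) by auto
      with onto show "x \<in> (\<Union>i. cball (f i) (\<rho> i))" by (force simp: \<rho>_def)
    qed
    show "0 \<le> \<rho> i" "\<rho> i \<le> 5 * \<delta>" for i
      using r(1,2)[of "f i"] f[of i] C(2) \<open>0 < \<delta>\<close> by (auto simp: \<rho>_def intro: less_imp_le)
    have "(\<Sum>i. ennreal (c * \<rho> i powr p)) \<le> (\<Sum>i. ennreal (5 powr p) * emeasure \<sigma> (X i))"
    proof (intro suminf_le allI)
      fix i show "ennreal (c * \<rho> i powr p) \<le> ennreal (5 powr p) * emeasure \<sigma> (X i)"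
      proof (cases "i \<in> I")
        case True
        then have fE: "f i \<in> E" using f C(2) by auto
        have "ennreal (c * \<rho> i powr p) = ennreal (5 powr p) * ennreal (c * r (f i) powr p)"
          using True r(1)[OF fE] \<open>0 \<le> c\<close>
          by (simp add: \<rho>_def powr_mult ennreal_mult[symmetric] mult_ac)
        also have "\<dots> \<le> ennreal (5 powr p) * emeasure \<sigma> (X i)"
          using r(4)[OF fE] True by (intro mult_left_mono) (auto simp: X_def)
        finally show ?thesis .
      qed (simp add: \<rho>_def)
    qed auto
    also have "\<dots> \<le> ennreal (5 powr p) * emeasure \<sigma> W"
      by (simp add: ennreal_suminf_cmult mult_left_mono sum)
    finally show "(\<Sum>i. ennreal (c * \<rho> i powr p)) \<le> ennreal (5 powr p) * emeasure \<sigma> W" .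
  qed
qed

text \<open>The mass of an open ball is lower semicontinuous in the centre: slightly smaller balls
  around a limit point lie in the balls around nearby centres, and they exhaust the open
  ball.\<close>

lemma closed_emeasure_ball_le:
  fixes M :: "'a::metric_space measure"
  assumes sets: "sets M = sets borel"
  shows "closed {x. emeasure M (ball x r) \<le> a}"
proof (unfold closed_sequential_limits, intro allI impI)
  fix X x assume "(\<forall>n. X n \<in> {x. emeasure M (ball x r) \<le> a}) \<and> X \<longlonglongrightarrow> x"
  then have X: "\<And>n. emeasure M (ball (X n) r) \<le> a" "X \<longlonglongrightarrow> x" by auto
  have "(\<Union>n. ball x (r - 1 / real (Suc n))) = ball x r"
  proof (intro equalityI subsetI)
    fix y assume "y \<in> ball x r"
    then obtain n where "inverse (real (Suc n)) < r - dist x y"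
      using reals_Archimedean[of "r - dist x y"] by auto
    then show "y \<in> (\<Union>n. ball x (r - 1 / real (Suc n)))"
      by (intro UN_I[of n]) (auto simp: inverse_eq_divide)
  next
    fix y assume "y \<in> (\<Union>n. ball x (r - 1 / real (Suc n)))"
    then obtain n where "dist x y < r - 1 / real (Suc n)" by auto
    moreover have "0 < 1 / real (Suc n)" by simp
    ultimately have "dist x y < r" by linarith
    then show "y \<in> ball x r" by simp
  qed
  moreover have "incseq (\<lambda>n. ball x (r - 1 / real (Suc n)))"
    by (intro incseq_SucI subset_ball diff_left_mono divide_left_mono) auto
  ultimately have "emeasure M (ball x r) = (SUP n. emeasure M (ball x (r - 1 / real (Suc n))))"
    using SUP_emeasure_incseq[of "\<lambda>n. ball x (r - 1 / real (Suc n))" M]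
    by (metis (no_types, lifting) image_subsetI sets borel_open open_ball)
  also have "\<dots> \<le> a"
  proof (rule SUP_least)
    fix n
    obtain k where k: "dist (X k) x < 1 / real (Suc n)"
      using X(2) unfolding LIMSEQ_def by (meson le_refl zero_less_divide_1_iff of_nat_0_less_iff zero_less_Suc)
    have "ball x (r - 1 / real (Suc n)) \<subseteq> ball (X k) r"
    proof
      fix y assume "y \<in> ball x (r - 1 / real (Suc n))"
      then show "y \<in> ball (X k) r" using k dist_triangle[of "X k" y x] by auto
    qed
    then have "emeasure M (ball x (r - 1 / real (Suc n))) \<le> emeasure M (ball (X k) r)"
      by (intro emeasure_mono) (auto simp: sets)
    with X(1) show "emeasure M (ball x (r - 1 / real (Suc n))) \<le> a" by (meson order_trans)
  qed
  finally show "x \<in> {x. emeasure M (ball x r) \<le> a}" by simp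
qed

text \<open>Outside a set of at most half the measure of K, the upper s-density of K is bounded,
  because K would otherwise have a Vitali cover that is too cheap.\<close>

lemma hausdorff_compact_upper_density:
  fixes K :: "'a::euclidean_space set"
  assumes "0 < s" "compact K" "0 < hausdorff_measure s K" "hausdorff_measure s K < \<infinity>"
  obtains F c where "compact F" "F \<subseteq> K" "0 < hausdorff_measure s F" "0 < c"
    "\<And>x r. 0 < r \<Longrightarrow> hausdorff_measure s (F \<inter> cball x r) \<le> ennreal (c * r powr s)"
proof -
  let ?H = "hausdorff_measure s :: 'a set \<Rightarrow> ennreal"
  define \<sigma> where "\<sigma> = density (hausdorff_borel s) (indicator K)"
  have Kb: "K \<in> sets borel" using assms(2) by (simp add: borel_compact)
  have \<sigma>: "emeasure \<sigma> X = ?H (K \<inter> X)" if "X \<in> sets borel" for X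
    unfolding \<sigma>_def using that Kb assms(1)
    by (subst emeasure_restricted) (auto simp: emeasure_hausdorff_borel)
  have sets: "sets \<sigma> = sets borel" by (simp add: \<sigma>_def)
  \<comment> \<open>Three losses are absorbed: \<open>2 powr s\<close> for passing from radius to
    diameter, \<open>5 powr s\<close> from Vitali, and a 2 that leaves only half of the measure of
    \<open>K\<close>.\<close>
  define c0 where "c0 = 2 * 10 powr s"
  have c0: "0 < c0" by (simp add: c0_def)
  \<comment> \<open>Open balls make each \<open>F k\<close> closed. The remaining set
    \<open>E\<close> consists of the points where the bound fails at arbitrarily small
    radii.\<close>
  define F where "F k = K \<inter> (\<Inter>r\<in>{0<..<1 / (real k + 1)}. {x. emeasure \<sigma> (ball x r) \<le> ennreal (c0 * r powr s)})" for k
  define E where "E = K - (\<Union>k. F k)"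
  obtain h where h: "?H K = ennreal h" "0 < h"
    using assms(3,4) by (cases "?H K") auto
  have "?H E \<le> ennreal (h / 2)"
  proof (rule hausdorff_measure_leI)
    fix \<delta> :: real assume "0 < \<delta>"
    \<comment> \<open>With radii at most \<open>\<delta> / 10\<close> the fivefold balls have
      diameter at most \<open>\<delta>\<close>.\<close>
    have grow: "\<exists>r. 0 < r \<and> r \<le> \<delta> / 10 \<and> cball x r \<subseteq> UNIV \<and> ennreal (c0 * r powr s) \<le> emeasure \<sigma> (cball x r)"
      if "x \<in> E" for x
    proof -
      obtain k where k: "inverse (real (Suc k)) < \<delta> / 10"
        using reals_Archimedean[of "\<delta>/10"] \<open>0 < \<delta>\<close> by auto
      have "x \<notin> F k" "x \<in> K" using that by (auto simp: E_def)
      then obtain r where r: "0 < r" "r < 1 / (real k + 1)" "ennreal (c0 * r powr s) < emeasure \<sigma> (ball x r)"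
        by (auto simp: F_def not_le)
      note r(3)
      also have "emeasure \<sigma> (ball x r) \<le> emeasure \<sigma> (cball x r)"
        by (intro emeasure_mono) (auto simp: sets)
      finally show ?thesis using r k by (intro exI[of _ r]) (auto simp: inverse_eq_divide add.commute)
    qed
    obtain a \<rho> where a: "E \<subseteq> (\<Union>i. cball (a i) (\<rho> i))" "\<And>i::nat. 0 \<le> \<rho> i" "\<And>i. \<rho> i \<le> 5 * (\<delta> / 10)"
      "(\<Sum>i. ennreal (c0 * \<rho> i powr s)) \<le> ennreal (5 powr s) * emeasure \<sigma> UNIV"
    proof (rule vitali_cover_of_growth[where E=E and W=UNIV and c=c0 and p=s and \<delta>="\<delta> / 10", OF sets _ _ _ _ grow])
    qed (use c0 \<open>0 < \<delta>\<close> assms(1) in auto)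
    have "hausdorff_pre_measure s \<delta> E \<le> (\<Sum>i. diam_powr s (cball (a i) (\<rho> i)))"
    proof (rule hausdorff_pre_measure_le[OF a(1)])
      show "diameter (cball (a i) (\<rho> i)) \<le> \<delta>" for i
        using a(2,3)[of i] by auto
    qed auto
    also have "\<dots> = (\<Sum>i. ennreal (1 / (2 * 5 powr s)) * ennreal (c0 * \<rho> i powr s))"
    proof (rule suminf_cong)
      fix i
      have "(10::real) powr s = 2 powr s * 5 powr s" by (simp add: powr_mult[symmetric])
      then show "diam_powr s (cball (a i) (\<rho> i)) = ennreal (1 / (2 * 5 powr s)) * ennreal (c0 * \<rho> i powr s)"
        using a(2)[of i] assms(1) c0
        by (simp add: diam_powr_def powr_mult ennreal_mult[symmetric] c0_def)
    qed
    also have "\<dots> = ennreal (1 / (2 * 5 powr s)) * (\<Sum>i. ennreal (c0 * \<rho> i powr s))"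
      by (rule ennreal_suminf_cmult)
    also have "\<dots> \<le> ennreal (1 / (2 * 5 powr s)) * (ennreal (5 powr s) * emeasure \<sigma> UNIV)"
      by (intro mult_left_mono a(4)) auto
    also have "\<dots> = ennreal (h / 2)"
      using h by (simp add: \<sigma> ennreal_mult[symmetric])
    finally show "hausdorff_pre_measure s \<delta> E \<le> ennreal (h / 2)" .
  qed
  have "\<exists>k. 0 < ?H (F k)"
  proof (rule ccontr)
    assume "\<not> ?thesis"
    then have "\<And>k. ?H (F k) = 0" by (simp add: not_less)
    then have 0: "?H (\<Union>k. F k) \<le> 0" using hausdorff_measure_UN_le[of s F] by simp
    have "?H K \<le> ?H (E \<union> (\<Union>k. F k))" by (rule hausdorff_measure_mono) (auto simp: E_def)
    also have "\<dots> \<le> ?H E + ?H (\<Union>k. F k)" by (rule hausdorff_measure_Un_le)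
    also have "\<dots> \<le> ennreal (h / 2)" using 0 \<open>?H E \<le> _\<close> by simp
    finally show False using h by (simp add: ennreal_le_iff)
  qed
  then obtain k where k: "0 < ?H (F k)" by auto
  define e where "e = 1 / (real k + 1)"
  have e: "0 < e" by (simp add: e_def)
  have FK: "F k \<subseteq> K" by (auto simp: F_def)
  have "compact (F k)"
    unfolding F_def by (intro compact_Int_closed assms(2) closed_INT ballI closed_emeasure_ball_le sets)
  \<comment> \<open>The first entry serves radii below \<open>e / 3\<close>; the second brings the
    bound up to the total mass \<open>h\<close> for all larger radii.\<close>
  define c where "c = max (c0 * 3 powr s) (h * (3 / e) powr s)"
  have "?H (F k \<inter> cball x r) \<le> ennreal (c * r powr s)" if "0 < r" for x r
  proof (cases "r < e / 3")
    case True
    show ?thesis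
    proof (cases "F k \<inter> cball x r = {}")
      case False
      then obtain y where y: "y \<in> F k" "y \<in> cball x r" by auto
      \<comment> \<open>The density bound is available at points of \<open>F k\<close>, so the ball
        is recentred at one of them; the radius is 3r and not 2r because the new ball is
        open.\<close>
      have "cball x r \<subseteq> ball y (3 * r)"
      proof
        fix z assume "z \<in> cball x r"
        then show "z \<in> ball y (3 * r)" using y(2) dist_triangle[of y z x] that by (auto simp: dist_commute)
      qed
      then have "?H (F k \<inter> cball x r) \<le> ?H (K \<inter> ball y (3 * r))"
        using FK by (intro hausdorff_measure_mono) auto
      also have "\<dots> = emeasure \<sigma> (ball y (3 * r))" by (simp add: \<sigma>)
      also have "\<dots> \<le> ennreal (c0 * (3 * r) powr s)"
      proof -
        have "3 * r \<in> {0<..<1 / (real k + 1)}" using True that by (simp add: e_def[symmetric])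
        with y(1) show ?thesis by (auto simp: F_def)
      qed
      also have "\<dots> \<le> ennreal (c * r powr s)"
        using that by (intro ennreal_leI) (auto simp: powr_mult c_def mult.assoc[symmetric] intro!: mult_right_mono)
      finally show ?thesis .
    qed simp
  next
    case False
    have "?H (F k \<inter> cball x r) \<le> ennreal h"
      using hausdorff_measure_mono[of "F k \<inter> cball x r" K s] FK h by auto
    also have "h \<le> c * r powr s"
    proof -
      have "1 = (3 / e) powr s * (e / 3) powr s" using e by (simp add: powr_mult[symmetric])
      also have "\<dots> \<le> (3 / e) powr s * r powr s"
        using False e assms(1) by (intro mult_left_mono powr_mono2) auto
      finally have "h * 1 \<le> h * ((3 / e) powr s * r powr s)" using h by (intro mult_left_mono) auto
      also have "\<dots> \<le> c * r powr s" by (auto simp: c_def mult.assoc[symmetric] intro!: mult_right_mono)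
      finally show ?thesis by simp
    qed
    finally show ?thesis by (simp add: ennreal_leI)
  qed
  moreover have "0 < c" using c0 by (simp add: c_def less_max_iff_disj)
  ultimately show ?thesis using that \<open>compact (F k)\<close> FK k by blast
qed


section \<open>Lebesgue differentiation of measures\<close>

lemma ennreal_le_add_diff: "(a::ennreal) \<le> b + (a - b)"
  by (auto simp: add_diff_self_ennreal)

lemma sets_borel_ball [measurable]:
  fixes x :: "'a::metric_space"
  shows "ball x r \<in> sets borel" "cball x r \<in> sets borel"
  by auto

lemma emeasure_lborel_cball_scale:
  fixes x y :: "'a::euclidean_space"
  assumes "0 \<le> r"
  shows "emeasure lborel (cball x r) = emeasure lborel (cball y 1) * ennreal (r ^ DIM('a))"
  using assms by (simp add: emeasure_cball ennreal_mult[symmetric])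

lemma emeasure_lborel_cball_pos:
  "0 < r \<Longrightarrow> 0 < emeasure lborel (cball (x::'a::euclidean_space) r)"
  by (simp add: emeasure_cball)

text \<open>The exceptional sets below are defined through \<open>eventually\<close> and carry no
  proof of measurability; Borel supersets of arbitrarily small measure take its place.\<close>

lemma AE_lborel_not_inI:
  assumes "\<And>e::real. 0 < e \<Longrightarrow> \<exists>N\<in>sets borel. E \<subseteq> N \<and> emeasure lborel N \<le> ennreal e"
  shows "AE x in lborel. x \<notin> (E::'a::euclidean_space set)"
proof -
  have "\<exists>N\<in>sets borel. E \<subseteq> N \<and> emeasure lborel N \<le> ennreal (1 / (real n + 1))" for n
    by (rule assms) simp
  then obtain N where N: "\<And>n::nat. N n \<in> sets borel" "\<And>n. E \<subseteq> N n"
    "\<And>n. emeasure lborel (N n) \<le> ennreal (1 / (real n + 1))"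
    by metis
  have "emeasure lborel (\<Inter>n. N n) \<le> 0 + ennreal e" if "0 < e" for e :: real
  proof -
    obtain n where "inverse (real (Suc n)) < e" using reals_Archimedean[OF \<open>0 < e\<close>] by blast
    then have n: "1 / (real n + 1) < e" by (simp add: inverse_eq_divide add.commute)
    have "emeasure lborel (\<Inter>n. N n) \<le> emeasure lborel (N n)"
      using N(1) by (intro emeasure_mono) auto
    also have "\<dots> \<le> ennreal e"
      using N(3)[of n] ennreal_leI[OF less_imp_le[OF n]] by (rule order_trans)
    finally show ?thesis by simp
  qed
  then have "emeasure lborel (\<Inter>n. N n) \<le> 0" by (rule ennreal_le_epsilon)
  then have "(\<Inter>n. N n) \<in> null_sets lborel"
    using N(1) by (intro null_setsI) auto
  then show ?thesis by (rule AE_I') (use N(2) in auto)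
qed

text \<open>A measure that vanishes on \<open>S\<close> has little mass in some open
  \<open>W\<close> around \<open>S\<close>. Vitali, applied to bad balls inside \<open>W\<close>,
  covers the bad points of \<open>S\<close> by a set of Lebesgue measure at most a constant over
  \<open>\<epsilon>\<close> times that mass.\<close>

lemma AE_ratio_le_on_null_set:
  fixes \<sigma> :: "'a::euclidean_space measure"
  assumes sets: "sets \<sigma> = sets borel" and fin: "emeasure \<sigma> UNIV \<noteq> \<infinity>"
    and S: "S \<in> sets borel" "emeasure \<sigma> S = 0" and e: "0 < \<epsilon>"
  shows "AE x in lborel. x \<in> S \<longrightarrow>
    (\<forall>\<^sub>F r in at_right 0. emeasure \<sigma> (cball x r) \<le> ennreal \<epsilon> * emeasure lborel (cball x r))"
proof -
  define b where "b = unit_ball_vol (real DIM('a))"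
  have b: "0 < b" by (simp add: b_def)
  have vol: "emeasure lborel (cball x r) = ennreal (b * r powr DIM('a))" if "0 \<le> r" for x :: 'a and r
    using that by (cases "r = 0") (simp_all add: emeasure_cball b_def powr_realpow)
  define E where "E = {x\<in>S. \<not> (\<forall>\<^sub>F r in at_right 0. emeasure \<sigma> (cball x r) \<le> ennreal \<epsilon> * emeasure lborel (cball x r))}"
  have "AE x in lborel. x \<notin> E"
  proof (rule AE_lborel_not_inI)
    fix \<eta> :: real assume "0 < \<eta>"
    \<comment> \<open>Chosen so that the Vitali factor and the division by \<open>\<epsilon>\<close>
      turn it back into \<open>\<eta>\<close>.\<close>
    define \<kappa> where "\<kappa> = \<eta> * \<epsilon> / (5 powr DIM('a))"
    have \<kappa>: "0 < \<kappa>" using \<open>0 < \<eta>\<close> e by (simp add: \<kappa>_def)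
    have "emeasure \<sigma> S = (INF U \<in> {U. S \<subseteq> U \<and> open U}. emeasure \<sigma> U)"
      using fin sets_eq_imp_space_eq[OF sets] by (intro outer_regular sets S(1)) auto
    with S(2) \<kappa> have "(INF U \<in> {U. S \<subseteq> U \<and> open U}. emeasure \<sigma> U) < ennreal \<kappa>" by simp
    then obtain W where W: "S \<subseteq> W" "open W" "emeasure \<sigma> W < ennreal \<kappa>"
      by (auto simp: INF_less_iff)
    have grow: "\<exists>r. 0 < r \<and> r \<le> 1 \<and> cball x r \<subseteq> W \<and> ennreal (\<epsilon> * b * r powr DIM('a)) \<le> emeasure \<sigma> (cball x r)"
      if "x \<in> E" for x
    proof -
      have "x \<in> W" using that W by (auto simp: E_def)
      then obtain d where d: "0 < d" "cball x d \<subseteq> W" using W(2) open_contains_cball by blast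
      have "\<not> (\<forall>\<^sub>F r in at_right 0. emeasure \<sigma> (cball x r) \<le> ennreal \<epsilon> * emeasure lborel (cball x r))"
        using that by (auto simp: E_def)
      then obtain r where r: "0 < r" "r < min d 1" "ennreal \<epsilon> * emeasure lborel (cball x r) < emeasure \<sigma> (cball x r)"
        unfolding eventually_at_right_field using d by (metis not_le min_less_iff_conj zero_less_one)
      have "ennreal \<epsilon> * emeasure lborel (cball x r) = ennreal (\<epsilon> * b * r powr DIM('a))"
        using r(1) e b by (subst vol) (auto simp: ennreal_mult[symmetric] mult.assoc)
      with r d show ?thesis by (intro exI[of _ r]) (auto intro: less_imp_le)
    qed
    obtain a \<rho> where a: "E \<subseteq> (\<Union>i. cball (a i) (\<rho> i))" "\<And>i::nat. 0 \<le> \<rho> i" "\<And>i. \<rho> i \<le> 5 * 1"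
      "(\<Sum>i. ennreal (\<epsilon> * b * \<rho> i powr DIM('a))) \<le> ennreal (5 powr DIM('a)) * emeasure \<sigma> W"
    proof (rule vitali_cover_of_growth[where E=E and W=W and c="\<epsilon> * b" and p="real DIM('a)" and \<delta>=1, OF sets _ _ _ _ grow])
    qed (use e b W(2) in auto)
    have "emeasure lborel (\<Union>i. cball (a i) (\<rho> i)) \<le> (\<Sum>i. emeasure lborel (cball (a i) (\<rho> i)))"
      by (rule emeasure_subadditive_countably) auto
    also have "\<dots> = (\<Sum>i. ennreal (1 / \<epsilon>) * ennreal (\<epsilon> * b * \<rho> i powr DIM('a)))"
    proof (rule suminf_cong)
      fix i
      have "b * \<rho> i powr DIM('a) = 1 / \<epsilon> * (\<epsilon> * b * \<rho> i powr DIM('a))" using e by simp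
      then show "emeasure lborel (cball (a i) (\<rho> i)) = ennreal (1 / \<epsilon>) * ennreal (\<epsilon> * b * \<rho> i powr DIM('a))"
        unfolding vol[OF a(2)] using e b by (subst ennreal_mult[symmetric]) auto
    qed
    also have "\<dots> = ennreal (1 / \<epsilon>) * (\<Sum>i. ennreal (\<epsilon> * b * \<rho> i powr DIM('a)))"
      by (rule ennreal_suminf_cmult)
    also have "\<dots> \<le> ennreal (1 / \<epsilon>) * (ennreal (5 powr DIM('a)) * ennreal \<kappa>)"
      using W(3) by (intro mult_left_mono order_trans[OF a(4)]) auto
    also have "\<dots> = ennreal \<eta>"
      using e \<kappa> \<open>0 < \<eta>\<close> by (simp add: ennreal_mult[symmetric] \<kappa>_def)
    finally show "\<exists>N\<in>sets borel. E \<subseteq> N \<and> emeasure lborel N \<le> ennreal \<eta>"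
      using a(1) by (intro bexI[of _ "\<Union>i. cball (a i) (\<rho> i)"]) auto
  qed
  then show ?thesis by eventually_elim (auto simp: E_def)
qed

text \<open>The excess \<open>f - q\<close>, truncated at 0, has no mass where \<open>f\<close> is
  at most q, so there its averages are eventually below \<open>\<epsilon>\<close>; and
  \<open>f\<close> is at most q plus the excess.\<close>

lemma AE_ratio_upper:
  fixes f :: "'a::euclidean_space \<Rightarrow> ennreal"
  assumes f[measurable]: "f \<in> borel_measurable borel" and fin: "(\<integral>\<^sup>+x. f x \<partial>lborel) \<noteq> \<infinity>"
    and "0 < \<epsilon>" "q < \<infinity>"
  shows "AE x in lborel. f x \<le> q \<longrightarrow>
    (\<forall>\<^sub>F r in at_right 0. emeasure (density lborel f) (cball x r) \<le> (q + ennreal \<epsilon>) * emeasure lborel (cball x r))"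
proof -
  define g where "g x = f x - q" for x
  have g[measurable]: "g \<in> borel_measurable borel" unfolding g_def[abs_def] by measurable
  have "AE x in lborel. x \<in> {x. f x \<le> q} \<longrightarrow>
    (\<forall>\<^sub>F r in at_right 0. emeasure (density lborel g) (cball x r) \<le> ennreal \<epsilon> * emeasure lborel (cball x r))"
  proof (rule AE_ratio_le_on_null_set)
    have "(\<integral>\<^sup>+x. g x \<partial>lborel) \<le> (\<integral>\<^sup>+x. f x \<partial>lborel)"
      by (intro nn_integral_mono) (simp add: g_def diff_le_self_ennreal)
    then show "emeasure (density lborel g) UNIV \<noteq> \<infinity>"
      using fin by (auto simp: emeasure_density top_unique)
    show "emeasure (density lborel g) {x. f x \<le> q} = 0"
      by (subst emeasure_density)
        (auto simp: nn_integral_0_iff_AE g_def indicator_def diff_eq_0_iff_ennreal le_less_trans[OF _ \<open>q < \<infinity>\<close>, simplified] intro!: AE_I2)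
  qed (use assms in auto)
  then show ?thesis
  proof eventually_elim
    case (elim x)
    show ?case
    proof
      assume "f x \<le> q"
      with elim have "\<forall>\<^sub>F r in at_right 0. emeasure (density lborel g) (cball x r) \<le> ennreal \<epsilon> * emeasure lborel (cball x r)"
        by simp
      then show "\<forall>\<^sub>F r in at_right 0. emeasure (density lborel f) (cball x r) \<le> (q + ennreal \<epsilon>) * emeasure lborel (cball x r)"
      proof eventually_elim
        case (elim r)
        have "emeasure (density lborel f) (cball x r) = (\<integral>\<^sup>+y. f y * indicator (cball x r) y \<partial>lborel)"
          by (rule emeasure_density) auto
        also have "\<dots> \<le> (\<integral>\<^sup>+y. q * indicator (cball x r) y + g y * indicator (cball x r) y \<partial>lborel)"
          by (intro nn_integral_mono) (auto simp: g_def indicator_def ennreal_le_add_diff)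
        also have "\<dots> = q * emeasure lborel (cball x r) + emeasure (density lborel g) (cball x r)"
          by (subst nn_integral_add) (auto simp: nn_integral_cmult_indicator emeasure_density)
        also have "\<dots> \<le> (q + ennreal \<epsilon>) * emeasure lborel (cball x r)"
          using elim by (simp add: distrib_right)
        finally show ?case .
      qed
    qed
  qed
qed

lemma AE_ratio_lower:
  fixes f :: "'a::euclidean_space \<Rightarrow> ennreal"
  assumes f[measurable]: "f \<in> borel_measurable borel" and "0 < \<epsilon>" "q < \<infinity>"
  shows "AE x in lborel. q \<le> f x \<longrightarrow>
    (\<forall>\<^sub>F r in at_right 0. q * emeasure lborel (cball x r)
       \<le> emeasure (density lborel f) (cball x r) + ennreal \<epsilon> * emeasure lborel (cball x r))"
proof -
  \<comment> \<open>The deficit \<open>q - f\<close> need not be integrable over the whole space, so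
    it is cut off by balls; on small balls around a given point a large cut-off is
    invisible.\<close>
  define h where "h k x = (q - f x) * indicator (ball 0 (real k)) x" for k :: nat and x
  have h[measurable]: "h k \<in> borel_measurable borel" for k
    unfolding h_def[abs_def]
    by (intro borel_measurable_times_ennreal borel_measurable_minus_ennreal borel_measurable_indicator) auto
  have "AE x in lborel. x \<in> {x. h k x = 0} \<longrightarrow>
    (\<forall>\<^sub>F r in at_right 0. emeasure (density lborel (h k)) (cball x r) \<le> ennreal \<epsilon> * emeasure lborel (cball x r))" for k
  proof (rule AE_ratio_le_on_null_set)
    have "(\<integral>\<^sup>+x. h k x \<partial>lborel) \<le> (\<integral>\<^sup>+x. q * indicator (ball (0::'a) (real k)) x \<partial>lborel)"
      by (intro nn_integral_mono) (simp add: h_def diff_le_self_ennreal mult_right_mono)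
    also have "\<dots> = q * emeasure lborel (ball (0::'a) (real k))" by (simp add: nn_integral_cmult_indicator)
    also have "\<dots> < \<infinity>" using \<open>q < \<infinity>\<close> emeasure_lborel_ball_finite[of "0::'a" "real k"]
      by (simp add: ennreal_mult_less_top)
    finally show "emeasure (density lborel (h k)) UNIV \<noteq> \<infinity>"
      by (auto simp: emeasure_density)
    show "emeasure (density lborel (h k)) {x. h k x = 0} = 0"
      by (subst emeasure_density) (auto simp: nn_integral_0_iff_AE indicator_def intro!: AE_I2)
  qed (use assms in auto)
  then have "AE x in lborel. \<forall>k. x \<in> {x. h k x = 0} \<longrightarrow>
    (\<forall>\<^sub>F r in at_right 0. emeasure (density lborel (h k)) (cball x r) \<le> ennreal \<epsilon> * emeasure lborel (cball x r))"
    by (simp add: AE_all_countable)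
  then show ?thesis
  proof eventually_elim
    case (elim x)
    show ?case
    proof
      assume "q \<le> f x"
      obtain k :: nat where k: "norm x + 1 < real k" using reals_Archimedean2 by blast
      have "h k x = 0" using \<open>q \<le> f x\<close> using \<open>q < \<infinity>\<close> by (simp add: h_def diff_eq_0_iff_ennreal)
      with elim have "\<forall>\<^sub>F r in at_right 0. emeasure (density lborel (h k)) (cball x r) \<le> ennreal \<epsilon> * emeasure lborel (cball x r)"
        by blast
      moreover have "\<forall>\<^sub>F r in at_right (0::real). r < 1" unfolding eventually_at_right_field by (intro exI[of _ 1]) auto
      ultimately show "\<forall>\<^sub>F r in at_right 0. q * emeasure lborel (cball x r)
         \<le> emeasure (density lborel f) (cball x r) + ennreal \<epsilon> * emeasure lborel (cball x r)"
      proof eventually_elim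
        case (elim r)
        have sub: "y \<in> ball 0 (real k)" if "y \<in> cball x r" for y
          using that elim(2) k norm_triangle_ineq2[of y x] by (simp add: dist_norm norm_minus_commute)
        have "q * emeasure lborel (cball x r) = (\<integral>\<^sup>+y. q * indicator (cball x r) y \<partial>lborel)"
          by (simp add: nn_integral_cmult_indicator)
        also have "\<dots> \<le> (\<integral>\<^sup>+y. f y * indicator (cball x r) y + h k y * indicator (cball x r) y \<partial>lborel)"
        proof (intro nn_integral_mono)
          fix y
          have "q \<le> f y + (q - f y)" by (rule ennreal_le_add_diff)
          then show "q * indicator (cball x r) y \<le> f y * indicator (cball x r) y + h k y * indicator (cball x r) y"
            using sub[of y] by (auto simp: h_def indicator_def)
        qed
        also have "\<dots> = emeasure (density lborel f) (cball x r) + emeasure (density lborel (h k)) (cball x r)"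
          by (subst nn_integral_add) (auto simp: emeasure_density)
        also have "\<dots> \<le> emeasure (density lborel f) (cball x r) + ennreal \<epsilon> * emeasure lborel (cball x r)"
          using elim by (simp add: add_left_mono)
        finally show ?case .
      qed
    qed
  qed
qed

text \<open>Rational thresholds and tolerances \<open>1 / Suc n\<close> keep the family of
  exceptional null sets countable.\<close>

lemma lebesgue_differentiation:
  fixes f :: "'a::euclidean_space \<Rightarrow> ennreal"
  assumes f[measurable]: "f \<in> borel_measurable borel" and fin: "(\<integral>\<^sup>+x. f x \<partial>lborel) \<noteq> \<infinity>"
  shows "AE x in lborel.
    ((\<lambda>r. emeasure (density lborel f) (cball x r) / emeasure lborel (cball x r)) \<longlongrightarrow> f x) (at_right 0)"
proof -
  have "AE x in lborel. \<forall>(q::rat) (n::nat). f x \<le> ennreal (of_rat q) \<longrightarrow>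
    (\<forall>\<^sub>F r in at_right 0. emeasure (density lborel f) (cball x r) \<le>
       (ennreal (of_rat q) + ennreal (1 / real (Suc n))) * emeasure lborel (cball x r))"
    using assms by (simp only: AE_all_countable) (intro allI AE_ratio_upper, auto)
  moreover have "AE x in lborel. \<forall>(q::rat) (n::nat). ennreal (of_rat q) \<le> f x \<longrightarrow>
    (\<forall>\<^sub>F r in at_right 0. ennreal (of_rat q) * emeasure lborel (cball x r) \<le>
       emeasure (density lborel f) (cball x r) + ennreal (1 / real (Suc n)) * emeasure lborel (cball x r))"
    using assms by (simp only: AE_all_countable) (intro allI AE_ratio_lower, auto)
  ultimately show ?thesis
  proof eventually_elim
    case (elim x)
    let ?\<tau> = "\<lambda>r. emeasure (density lborel f) (cball x r)"
    let ?v = "\<lambda>r. emeasure lborel (cball x r)"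
    have pos: "\<forall>\<^sub>F r in at_right (0::real). 0 < r" by (rule eventually_at_right_less)
    have v: "?v r \<noteq> 0" "?v r \<noteq> top" if "0 < r" for r
      using emeasure_lborel_cball_pos[OF that, of x] emeasure_lborel_cball_finite[of x r] by auto
    show ?case
    proof (rule order_tendstoI)
      fix a assume "f x < a"
      obtain p :: rat where p: "f x < ennreal (of_rat p)" "ennreal (of_rat p) < a"
        using ennreal_rat_dense[OF \<open>f x < a\<close>] by auto
      \<comment> \<open>A second rational leaves room for the tolerance
        \<open>1 / Suc n\<close>.\<close>
      obtain p' :: rat where p': "ennreal (of_rat p) < ennreal (of_rat p')" "ennreal (of_rat p') < a"
        using ennreal_rat_dense[OF p(2)] by auto
      have "0 < ennreal (of_rat p)" using p(1) by (rule le_less_trans[OF zero_le])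
      then have p0: "0 \<le> real_of_rat p" by simp
      then have pp: "real_of_rat p < real_of_rat p'" "0 \<le> real_of_rat p"
        using p'(1) by (simp_all add: ennreal_less_iff)
      obtain n where n: "inverse (real (Suc n)) < real_of_rat p' - real_of_rat p"
        using reals_Archimedean[of "real_of_rat p' - real_of_rat p"] pp by auto
      have "\<forall>\<^sub>F r in at_right 0. ?\<tau> r \<le> (ennreal (of_rat p) + ennreal (1 / real (Suc n))) * ?v r"
        using elim(1) p(1) by (meson less_imp_le)
      with pos show "\<forall>\<^sub>F r in at_right 0. ?\<tau> r / ?v r < a"
      proof eventually_elim
        case (elim r)
        have "?\<tau> r / ?v r \<le> (ennreal (of_rat p) + ennreal (1 / real (Suc n))) * ?v r / ?v r"
          by (rule divide_right_mono_ennreal[OF elim(2)])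
        also have "\<dots> = ennreal (of_rat p) + ennreal (1 / real (Suc n))"
          using v[OF elim(1)] by (simp add: mult_divide_eq_ennreal)
        also have "\<dots> = ennreal (of_rat p + 1 / real (Suc n))"
          using pp by (intro ennreal_plus[symmetric]) auto
        also have "\<dots> \<le> ennreal (of_rat p')" using n by (intro ennreal_leI) (simp add: inverse_eq_divide)
        also have "\<dots> < a" by (rule p')
        finally show ?case .
      qed
    next
      fix a assume "a < f x"
      obtain p :: rat where p: "a < ennreal (of_rat p)" "ennreal (of_rat p) < f x"
        using ennreal_rat_dense[OF \<open>a < f x\<close>] by auto
      obtain p' :: rat where p': "ennreal (of_rat p) < ennreal (of_rat p')" "ennreal (of_rat p') < f x"
        using ennreal_rat_dense[OF p(2)] by auto
      have "0 < ennreal (of_rat p)" using p(1) by (rule le_less_trans[OF zero_le])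
      then have p0: "0 \<le> real_of_rat p" by simp
      then have pp: "real_of_rat p < real_of_rat p'" "0 \<le> real_of_rat p"
        using p'(1) by (simp_all add: ennreal_less_iff)
      obtain n where n: "inverse (real (Suc n)) < real_of_rat p' - real_of_rat p"
        using reals_Archimedean[of "real_of_rat p' - real_of_rat p"] pp by auto
      have "\<forall>\<^sub>F r in at_right 0. ennreal (of_rat p') * ?v r \<le> ?\<tau> r + ennreal (1 / real (Suc n)) * ?v r"
        using elim(2) p'(2) by (meson less_imp_le)
      with pos show "\<forall>\<^sub>F r in at_right 0. a < ?\<tau> r / ?v r"
      proof eventually_elim
        case (elim r)
        have "ennreal (of_rat p') = ennreal (of_rat p') * ?v r / ?v r"
          using v[OF elim(1)] by (simp add: mult_divide_eq_ennreal)
        also have "\<dots> \<le> (?\<tau> r + ennreal (1 / real (Suc n)) * ?v r) / ?v r"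
          by (rule divide_right_mono_ennreal[OF elim(2)])
        also have "\<dots> = ennreal (1 / real (Suc n)) + ?\<tau> r / ?v r"
          using v[OF elim(1)] by (simp add: add_divide_distrib_ennreal mult_divide_eq_ennreal add.commute)
        finally have 1: "ennreal (of_rat p') \<le> ennreal (1 / real (Suc n)) + ?\<tau> r / ?v r" .
        have "ennreal (1 / real (Suc n)) + ennreal (of_rat p) = ennreal (1 / real (Suc n) + of_rat p)"
          using pp by (intro ennreal_plus[symmetric]) auto
        also have "\<dots> \<le> ennreal (of_rat p')" using n by (intro ennreal_leI) (simp add: inverse_eq_divide)
        also note 1
        finally have "ennreal (of_rat p) \<le> ?\<tau> r / ?v r" by (simp add: ennreal_add_left_cancel_le)
        with p(1) show ?case by (rule less_le_trans)
      qed
    qed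
  qed
qed

text \<open>\<open>Lim\<close> is meaningful only where the limit exists; the differentiation
  theorem provides the limit almost everywhere and identifies it with \<open>f\<close>.\<close>

lemma lebesgue_density_AE_eq:
  fixes f :: "real ^ 'm \<Rightarrow> ennreal"
  assumes "f \<in> borel_measurable borel" "(\<integral>\<^sup>+x. f x \<partial>lborel) \<noteq> \<infinity>"
  shows "AE u in lborel. lebesgue_density (density lborel f) u = f u"
  using lebesgue_differentiation[OF assms]
proof eventually_elim
  case (elim u)
  have "((\<lambda>\<delta>::real. emeasure (density lborel f) {v. norm (v - u) \<le> \<delta>} /
      (emeasure lborel (cball (0 :: real ^ 'm) 1) * ennreal (\<delta> ^ CARD('m)))) \<longlongrightarrow> f u) (at_right 0)"
  proof (rule Lim_transform_eventually[OF elim])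
    have "\<forall>\<^sub>F r in at_right (0::real). 0 < r" by (rule eventually_at_right_less)
    then show "\<forall>\<^sub>F r in at_right 0. emeasure (density lborel f) (cball u r) / emeasure lborel (cball u r)
      = emeasure (density lborel f) {v. norm (v - u) \<le> r} /
        (emeasure lborel (cball (0 :: real ^ 'm) 1) * ennreal (r ^ CARD('m)))"
    proof eventually_elim
      case (elim r)
      have "cball u r = {v. norm (v - u) \<le> r}" by (auto simp: dist_norm norm_minus_commute)
      then show ?case
        using emeasure_lborel_cball_scale[of r u "0::real^'m"] elim by simp
    qed
  qed
  then show ?case unfolding lebesgue_density_def by (intro tendsto_Lim) auto
qed


section \<open>Pair correlations of projected measures\<close>

lemma borel_measurable_of_bool [measurable (raw)]:
  "Measurable.pred M Q \<Longrightarrow> (\<lambda>x. of_bool (Q x) :: ennreal) \<in> borel_measurable M"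
  unfolding of_bool_def by measurable

lemma nn_integral_of_bool:
  "{x\<in>space M. Q x} \<in> sets M \<Longrightarrow> (\<integral>\<^sup>+x. of_bool (Q x) \<partial>M) = emeasure M {x\<in>space M. Q x}"
proof -
  assume *: "{x\<in>space M. Q x} \<in> sets M"
  have "(\<integral>\<^sup>+x. of_bool (Q x) \<partial>M) = (\<integral>\<^sup>+x. indicator {x\<in>space M. Q x} x \<partial>M)"
    by (intro nn_integral_cong) auto
  then show ?thesis using * by simp
qed

text \<open>A crude arithmetic-geometric inequality; the lost factor 1/2 reappears as the 2 in the
  next lemma.\<close>

lemma ennreal_mult_le_sum_squares: "(a::ennreal) * b \<le> a\<^sup>2 + b\<^sup>2"
proof (cases "a \<le> b")
  case True
  then have "a * b \<le> b\<^sup>2" by (simp add: power2_eq_square mult_right_mono)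
  then show ?thesis by (simp add: add_increasing)
next
  case False
  then have "a * b \<le> a\<^sup>2" by (simp add: power2_eq_square mult_left_mono)
  then show ?thesis by (simp add: add_increasing2)
qed

text \<open>The pair integral is a quadratic form in the density whose kernel is the indicator of |u
  - v| at most d. After the product is bounded by the sum of squares, symmetry of the kernel leaves
  twice the squared density times the volume of a d-ball.\<close>

lemma pair_correlation_le_density_square:
  fixes \<tau> :: "(real ^ 'm) measure"
  assumes sets[measurable_cong]: "sets \<tau> = sets borel" and fin: "emeasure \<tau> UNIV \<noteq> \<infinity>"
    and ac: "absolutely_continuous lborel \<tau>" and "0 < d"
  shows "(\<integral>\<^sup>+u. \<integral>\<^sup>+v. of_bool (dist u v \<le> d) \<partial>\<tau> \<partial>\<tau>)
     \<le> 2 * emeasure lborel (cball (0::real ^ 'm) d) * (\<integral>\<^sup>+u. (lebesgue_density \<tau> u)\<^sup>2 \<partial>lborel)"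
proof -
  define f where "f = RN_deriv lborel \<tau>"
  have f[measurable]: "f \<in> borel_measurable borel" by (simp add: f_def)
  have \<tau>: "\<tau> = density lborel f"
    unfolding f_def using sigma_finite_measure.density_RN_deriv[OF lborel.sigma_finite_measure_axioms ac] sets by simp
  have finf: "(\<integral>\<^sup>+u. f u \<partial>lborel) \<noteq> \<infinity>"
    using fin by (simp add: \<tau> emeasure_density)
  have D: "(\<integral>\<^sup>+u. (lebesgue_density \<tau> u)\<^sup>2 \<partial>lborel) = (\<integral>\<^sup>+u. (f u)\<^sup>2 \<partial>lborel)"
    using lebesgue_density_AE_eq[OF f finf] unfolding \<tau>[symmetric]
    by (intro nn_integral_cong_AE) auto
  let ?b = "\<lambda>u v. of_bool (dist u v \<le> d) :: ennreal"
  have vol: "(\<integral>\<^sup>+v. ?b u v \<partial>lborel) = emeasure lborel (cball (0::real ^ 'm) d)" for u :: "real ^ 'm"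
  proof -
    have "(\<integral>\<^sup>+v. ?b u v \<partial>lborel) = emeasure lborel (cball u d)"
      by (subst nn_integral_of_bool) (auto simp: cball_def)
    then show ?thesis using \<open>0 < d\<close> by (simp add: emeasure_cball)
  qed
  have "(\<integral>\<^sup>+u. \<integral>\<^sup>+v. ?b u v \<partial>\<tau> \<partial>\<tau>) = (\<integral>\<^sup>+u. f u * (\<integral>\<^sup>+v. f v * ?b u v \<partial>lborel) \<partial>lborel)"
    unfolding \<tau> by (simp add: nn_integral_density)
  also have "\<dots> = (\<integral>\<^sup>+u. \<integral>\<^sup>+v. f u * f v * ?b u v \<partial>lborel \<partial>lborel)"
    by (simp add: nn_integral_cmult[symmetric] mult.assoc)
  also have "\<dots> \<le> (\<integral>\<^sup>+u. \<integral>\<^sup>+v. (f u)\<^sup>2 * ?b u v + (f v)\<^sup>2 * ?b v u \<partial>lborel \<partial>lborel)"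
    using ennreal_mult_le_sum_squares
    by (intro nn_integral_mono) (auto simp: dist_commute)
  also have "\<dots> = (\<integral>\<^sup>+u. \<integral>\<^sup>+v. (f u)\<^sup>2 * ?b u v \<partial>lborel \<partial>lborel) + (\<integral>\<^sup>+u. \<integral>\<^sup>+v. (f v)\<^sup>2 * ?b v u \<partial>lborel \<partial>lborel)"
    by (simp add: nn_integral_add)
  also have "(\<integral>\<^sup>+u. \<integral>\<^sup>+v. (f v)\<^sup>2 * ?b v u \<partial>lborel \<partial>lborel) = (\<integral>\<^sup>+v. \<integral>\<^sup>+u. (f v)\<^sup>2 * ?b v u \<partial>lborel \<partial>lborel)"
    by (rule lborel_pair.Fubini') measurable
  also have "(\<integral>\<^sup>+u. \<integral>\<^sup>+v. (f u)\<^sup>2 * ?b u v \<partial>lborel \<partial>lborel) = (\<integral>\<^sup>+u. (f u)\<^sup>2 * emeasure lborel (cball (0::real ^ 'm) d) \<partial>lborel)"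
    by (simp add: nn_integral_cmult vol)
  also have "\<dots> = (\<integral>\<^sup>+u. (f u)\<^sup>2 \<partial>lborel) * emeasure lborel (cball (0::real ^ 'm) d)"
    by (rule nn_integral_multc) measurable
  finally show ?thesis unfolding D by (simp add: mult_2 distrib_right mult.commute[of "integral\<^sup>N _ _"])
qed

text \<open>Joint measurability in the parameter and the point is what the repeated exchanges of
  integrals over \<open>\<omega>\<close>, \<open>\<nu>\<close> and Lebesgue measure rest on.\<close>

locale projection_family =
  fixes \<omega> :: "'l measure" and P :: "'l \<Rightarrow> real ^ 'n \<Rightarrow> real ^ 'm"
  assumes finite_\<omega>: "finite_measure \<omega>"
    and measurable_P_pair: "(\<lambda>z. P (fst z) (snd z)) \<in> borel_measurable (\<omega> \<Otimes>\<^sub>M borel)"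
    and linear_P: "l \<in> space \<omega> \<Longrightarrow> linear (P l)"
begin

sublocale \<omega>: finite_measure \<omega> by (rule finite_\<omega>)

lemma measurable_P [measurable (raw)]:
  assumes "f \<in> measurable M \<omega>" "g \<in> borel_measurable M"
  shows "(\<lambda>z. P (f z) (g z)) \<in> borel_measurable M"
  using measurable_compose[OF measurable_Pair[OF assms] measurable_P_pair] by simp

lemma measurable_P_slice: "l \<in> space \<omega> \<Longrightarrow> P l \<in> borel_measurable borel"
  using measurable_P[of "\<lambda>_. l" borel "\<lambda>x. x"] by simp

definition correlation :: "(real ^ 'n) measure \<Rightarrow> real \<Rightarrow> 'l \<Rightarrow> ennreal" where
  "correlation \<mu> d l = (\<integral>\<^sup>+x. \<integral>\<^sup>+y. of_bool (dist (P l x) (P l y) \<le> d) \<partial>\<mu> \<partial>\<mu>)"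

end

locale square_integrable_projections = projection_family \<omega> P
  for \<omega> :: "'l measure" and P :: "'l \<Rightarrow> real ^ 'n \<Rightarrow> real ^ 'm" +
  fixes s C :: real
  assumes s: "real CARD('m) < s" and C: "0 < C"
    and bounded_energy: "\<And>\<mu>. \<mu> \<in> compactly_supported_measures (cball (0 :: real ^ 'n) 1) \<Longrightarrow>
        (\<forall>x. \<forall>r>0. emeasure \<mu> (cball x r) \<le> ennreal (r powr s)) \<Longrightarrow>
          (AE l in \<omega>. absolutely_continuous lborel (distr \<mu> borel (P l))) \<and>
          (\<integral>\<^sup>+ l. (\<integral>\<^sup>+ u. (lebesgue_density (distr \<mu> borel (P l)) u)\<^sup>2 \<partial>lborel) \<partial>\<omega>)
            < ennreal C * emeasure \<mu> (cball 0 1)"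
begin

text \<open>\<open>bounded_energy\<close> speaks of nonzero measures with compact support in the
  unit ball. Here it is brought into the form that rescaled restrictions to balls satisfy: no mass
  outside the unit ball, and possibly no mass at all.\<close>

lemma unit_ball_correlation:
  assumes sets[measurable_cong]: "sets \<mu> = sets borel"
    and outside: "emeasure \<mu> (- cball 0 1) = 0"
    and growth: "\<And>x r. 0 < r \<Longrightarrow> emeasure \<mu> (cball x r) \<le> ennreal (r powr s)"
    and d: "0 < d"
  shows "AE l in \<omega>. absolutely_continuous lborel (distr \<mu> borel (P l))"
    and "(\<integral>\<^sup>+l. correlation \<mu> d l \<partial>\<omega>) \<le> 2 * emeasure lborel (cball (0::real ^ 'm) d) * ennreal C * emeasure \<mu> UNIV"
proof -
  have sp[simp]: "space \<mu> = UNIV" using sets_eq_imp_space_eq[OF sets] by simp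
  have "emeasure \<mu> (cball 0 1 \<union> - cball 0 1) = emeasure \<mu> (cball 0 1)"
    using outside by (intro emeasure_Un_null_set) (auto simp: null_sets_def sets)
  then have tot: "emeasure \<mu> UNIV = emeasure \<mu> (cball 0 1)" by (simp add: Un_commute)
  have "emeasure \<mu> (cball 0 1) \<le> ennreal 1" using growth[of 1 0] by simp
  then have fin: "emeasure \<mu> UNIV < \<infinity>" unfolding tot using ennreal_less_top le_less_trans by fastforce
  then interpret \<mu>: finite_measure \<mu> by (intro finite_measureI) simp
  have "(AE l in \<omega>. absolutely_continuous lborel (distr \<mu> borel (P l))) \<and>
     (\<integral>\<^sup>+l. correlation \<mu> d l \<partial>\<omega>) \<le> 2 * emeasure lborel (cball (0::real ^ 'm) d) * ennreal C * emeasure \<mu> UNIV"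
  proof (cases "emeasure \<mu> UNIV = 0")
    case True
    have "AE x in \<mu>. False" by (rule AE_I[of _ _ UNIV]) (use True in \<open>auto simp: sets\<close>)
    then have "correlation \<mu> d l = 0" for l
      unfolding correlation_def by (subst nn_integral_cong_AE[of _ "\<lambda>_. 0"]) auto
    moreover have "absolutely_continuous lborel (distr \<mu> borel (P l))" if "l \<in> space \<omega>" for l
    proof -
      have [measurable]: "P l \<in> borel_measurable borel" using that by (rule measurable_P_slice)
      have "emeasure \<mu> X = 0" if "X \<in> sets borel" for X
        using emeasure_mono[of X UNIV \<mu>] True by (simp add: sets)
      then show ?thesis
        unfolding absolutely_continuous_def
        using measurable_sets_borel[of "P l" borel] \<open>P l \<in> borel_measurable borel\<close>
        by (auto simp: null_sets_def emeasure_distr)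
    qed
    ultimately show ?thesis by (auto intro!: AE_I2)
  next
    case False
    have sub: "measure_support \<mu> \<subseteq> cball 0 1"
    proof
      fix x assume x: "x \<in> measure_support \<mu>"
      show "x \<in> cball 0 1"
      proof (rule ccontr)
        assume "x \<notin> cball 0 1"
        then obtain r where r: "0 < r" "cball x r \<subseteq> - cball 0 1"
          using open_contains_cball[of "- cball (0::real^'n) 1"] by (metis ComplI closed_cball open_Compl)
        then have "emeasure \<mu> (cball x r) \<le> emeasure \<mu> (- cball 0 1)"
          by (intro emeasure_mono) (auto simp: sets)
        with outside have "emeasure \<mu> (cball x r) = 0" by simp
        with x r(1) show False by (auto simp: measure_support_def)
      qed
    qed
    have "closed (measure_support \<mu>)"
    proof -
      have "open (- measure_support \<mu>)"
        unfolding open_contains_ball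
      proof
        fix x assume "x \<in> - measure_support \<mu>"
        then obtain r where r: "0 < r" "emeasure \<mu> (cball x r) = 0" by (auto simp: measure_support_def)
        have "ball x (r/2) \<subseteq> - measure_support \<mu>"
        proof
          fix y assume y: "y \<in> ball x (r/2)"
          have "cball y (r/2) \<subseteq> cball x r"
          proof
            fix z assume "z \<in> cball y (r/2)"
            then show "z \<in> cball x r" using y dist_triangle[of x z y] by auto
          qed
          then have "emeasure \<mu> (cball y (r/2)) \<le> emeasure \<mu> (cball x r)"
            by (intro emeasure_mono) (auto simp: sets)
          then show "y \<in> - measure_support \<mu>"
            using r by (auto simp: measure_support_def intro!: exI[of _ "r/2"])
        qed
        then show "\<exists>e>0. ball x e \<subseteq> - measure_support \<mu>" using r(1) by (intro exI[of _ "r/2"]) auto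
      qed
      then show ?thesis by (simp add: closed_def)
    qed
    then have "compact (measure_support \<mu>)"
      using sub bounded_subset[OF bounded_cball] by (auto simp: compact_eq_bounded_closed)
    then have "\<mu> \<in> compactly_supported_measures (cball 0 1)"
      using sub fin False tot by (auto simp: compactly_supported_measures_def sets zero_less_iff_neq_zero)
    then have *: "AE l in \<omega>. absolutely_continuous lborel (distr \<mu> borel (P l))"
       "(\<integral>\<^sup>+ l. (\<integral>\<^sup>+ u. (lebesgue_density (distr \<mu> borel (P l)) u)\<^sup>2 \<partial>lborel) \<partial>\<omega>)
            < ennreal C * emeasure \<mu> (cball 0 1)"
      using bounded_energy[of \<mu>] growth by blast+
    let ?v = "2 * emeasure lborel (cball (0::real ^ 'm) d)"
    have v: "?v \<noteq> 0" "?v \<noteq> \<infinity>"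
      using d emeasure_lborel_cball_pos[OF d, of "0::real^'m"] emeasure_lborel_cball_finite[of "0::real^'m" d]
      by (auto simp: ennreal_mult_eq_top_iff)
    have [measurable]: "correlation \<mu> d \<in> borel_measurable \<omega>"
      unfolding correlation_def[abs_def] by measurable
    \<comment> \<open>Dividing before integrating keeps the constant away from the integral of the
      squared density, whose measurability in l is not established.\<close>
    have "(\<integral>\<^sup>+l. correlation \<mu> d l \<partial>\<omega>) / ?v = (\<integral>\<^sup>+l. correlation \<mu> d l / ?v \<partial>\<omega>)"
      by (rule nn_integral_divide[symmetric]) measurable
    also have "\<dots> \<le> (\<integral>\<^sup>+ l. (\<integral>\<^sup>+ u. (lebesgue_density (distr \<mu> borel (P l)) u)\<^sup>2 \<partial>lborel) \<partial>\<omega>)"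
    proof (rule nn_integral_mono_AE)
      show "AE l in \<omega>. correlation \<mu> d l / ?v \<le> (\<integral>\<^sup>+ u. (lebesgue_density (distr \<mu> borel (P l)) u)\<^sup>2 \<partial>lborel)"
        using *(1) AE_space
      proof eventually_elim
        case (elim l)
        have [measurable]: "P l \<in> borel_measurable borel" using elim(2) by (rule measurable_P_slice)
        let ?\<tau> = "distr \<mu> borel (P l)"
        have "correlation \<mu> d l = (\<integral>\<^sup>+u. \<integral>\<^sup>+v. of_bool (dist u v \<le> d) \<partial>?\<tau> \<partial>?\<tau>)"
          by (simp add: correlation_def nn_integral_distr)
        also have "\<dots> \<le> ?v * (\<integral>\<^sup>+u. (lebesgue_density ?\<tau> u)\<^sup>2 \<partial>lborel)"
          using fin elim(1) d
          by (intro pair_correlation_le_density_square) (auto simp: emeasure_distr)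
        finally have "correlation \<mu> d l / ?v \<le> ?v * (\<integral>\<^sup>+u. (lebesgue_density ?\<tau> u)\<^sup>2 \<partial>lborel) / ?v"
          by (rule divide_right_mono_ennreal)
        also have "\<dots> = (\<integral>\<^sup>+u. (lebesgue_density ?\<tau> u)\<^sup>2 \<partial>lborel)"
          using v by (subst mult.commute) (simp add: mult_divide_eq_ennreal)
        finally show ?case .
      qed
    qed
    also have "\<dots> \<le> ennreal C * emeasure \<mu> UNIV" using *(2) tot by simp
    finally have "?v * ((\<integral>\<^sup>+l. correlation \<mu> d l \<partial>\<omega>) / ?v) \<le> ?v * (ennreal C * emeasure \<mu> UNIV)"
      by (rule mult_left_mono) simp
    then have "(\<integral>\<^sup>+l. correlation \<mu> d l \<partial>\<omega>) \<le> ?v * (ennreal C * emeasure \<mu> UNIV)"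
      using v by (simp add: ennreal_times_divide mult_divide_eq_ennreal mult.commute[of ?v])
    then show ?thesis using *(1) by (simp add: mult.assoc)
  qed
  then show "AE l in \<omega>. absolutely_continuous lborel (distr \<mu> borel (P l))"
    "(\<integral>\<^sup>+l. correlation \<mu> d l \<partial>\<omega>) \<le> 2 * emeasure lborel (cball (0::real ^ 'm) d) * ennreal C * emeasure \<mu> UNIV"
    by blast+
qed

end


section \<open>Rescaling to balls of any radius and averaging over their centres\<close>

context square_integrable_projections
begin

text \<open>The constant in \<open>unit_ball_correlation\<close> once the volume of
  \<open>cball 0 d\<close> is written as \<open>unit_ball_vol\<close> times a power of d.\<close>

definition corr_const :: real where
  "corr_const = 2 * C * unit_ball_vol (real CARD('m))"

lemma corr_const_nonneg: "0 \<le> corr_const"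
  using C by (simp add: corr_const_def)

text \<open>The blow-up \<open>T\<close> turns the growth bound into
  \<open>c * \<rho> powr s\<close> times \<open>r powr s\<close>, and \<open>k\<close> divides the
  first factor out. Two factors \<open>k\<close> appear in the correlation because it integrates
  \<open>\<mu>\<close> twice.\<close>

lemma rescaled_measure:
  fixes \<nu> :: "(real ^ 'n) measure" and a :: "real ^ 'n"
  assumes sets[measurable_cong]: "sets \<nu> = sets borel" and fin: "finite_measure \<nu>"
    and c: "0 < c" and growth: "\<And>x r. 0 < r \<Longrightarrow> emeasure \<nu> (cball x r) \<le> ennreal (c * r powr s)"
    and \<rho>: "0 < \<rho>"
  defines "k \<equiv> 1 / (c * \<rho> powr s)" and "T \<equiv> \<lambda>x. (1 / \<rho>) *\<^sub>R (x - a)"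
  defines "\<mu> \<equiv> density (distr (density \<nu> (indicator (cball a \<rho>))) borel T) (\<lambda>_. ennreal k)"
  shows "sets \<mu> = sets borel"
    and "\<And>X. X \<in> sets borel \<Longrightarrow> emeasure \<mu> X = ennreal k * emeasure \<nu> (cball a \<rho> \<inter> T -` X)"
    and "emeasure \<mu> (- cball 0 1) = 0"
    and "\<And>x r. 0 < r \<Longrightarrow> emeasure \<mu> (cball x r) \<le> ennreal (r powr s)"
    and "\<And>l \<delta>. l \<in> space \<omega> \<Longrightarrow> correlation \<mu> (d / \<rho>) l = ennreal k * ennreal k *
      (\<integral>\<^sup>+x. \<integral>\<^sup>+y. of_bool (x \<in> cball a \<rho> \<and> y \<in> cball a \<rho> \<and> dist (P l x) (P l y) \<le> d) \<partial>\<nu> \<partial>\<nu>)"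
proof -
  interpret \<nu>: finite_measure \<nu> by (rule fin)
  have sp[simp]: "space \<nu> = UNIV" using sets_eq_imp_space_eq[OF sets] by simp
  have T[measurable]: "T \<in> borel_measurable borel" unfolding T_def by measurable
  have k: "0 < k" using c \<rho> by (simp add: k_def)
  show "sets \<mu> = sets borel" by (simp add: \<mu>_def)
  have em: "emeasure \<mu> X = ennreal k * emeasure \<nu> (cball a \<rho> \<inter> T -` X)" if [measurable]: "X \<in> sets borel" for X
  proof -
    have "T -` X \<in> sets borel" using measurable_sets_borel[OF T that] .
    then have "emeasure (distr (density \<nu> (indicator (cball a \<rho>))) borel T) X = emeasure \<nu> (cball a \<rho> \<inter> T -` X)"
      by (subst emeasure_distr) (auto simp: emeasure_restricted sets)
    then show ?thesis
      unfolding \<mu>_def by (subst emeasure_density) (auto simp: nn_integral_cmult_indicator)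
  qed
  then show "emeasure \<mu> X = ennreal k * emeasure \<nu> (cball a \<rho> \<inter> T -` X)" if "X \<in> sets borel" for X
    using that .
  have nT: "norm (T x) = dist a x / \<rho>" for x
    using \<rho> by (simp add: T_def dist_norm norm_minus_commute)
  then have "cball a \<rho> \<inter> T -` (- cball 0 1) = {}" using \<rho> by auto
  then show "emeasure \<mu> (- cball 0 1) = 0" by (simp add: em)
  show "emeasure \<mu> (cball x r) \<le> ennreal (r powr s)" if "0 < r" for x r
  proof -
    have "cball a \<rho> \<inter> T -` cball x r \<subseteq> cball (a + \<rho> *\<^sub>R x) (\<rho> * r)"
    proof
      fix y assume "y \<in> cball a \<rho> \<inter> T -` cball x r"
      then have y: "norm (x - T y) \<le> r" by (simp add: dist_norm)
      have "a + \<rho> *\<^sub>R x - y = \<rho> *\<^sub>R (x - T y)"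
        using \<rho> by (simp add: T_def scaleR_diff_right)
      then show "y \<in> cball (a + \<rho> *\<^sub>R x) (\<rho> * r)" using y \<rho> by (simp add: dist_norm)
    qed
    then have "emeasure \<mu> (cball x r) \<le> ennreal k * emeasure \<nu> (cball (a + \<rho> *\<^sub>R x) (\<rho> * r))"
      by (simp add: em mult_left_mono emeasure_mono sets)
    also have "\<dots> \<le> ennreal k * ennreal (c * (\<rho> * r) powr s)"
      using \<rho> that by (intro mult_left_mono growth) auto
    also have "\<dots> = ennreal (r powr s)"
      using k c \<rho> that by (simp add: ennreal_mult[symmetric] k_def powr_mult)
    finally show ?thesis .
  qed
  show "correlation \<mu> (d / \<rho>) l = ennreal k * ennreal k *
      (\<integral>\<^sup>+x. \<integral>\<^sup>+y. of_bool (x \<in> cball a \<rho> \<and> y \<in> cball a \<rho> \<and> dist (P l x) (P l y) \<le> d) \<partial>\<nu> \<partial>\<nu>)"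
    if l: "l \<in> space \<omega>" for l
  proof -
    have [measurable]: "P l \<in> borel_measurable borel" using l by (rule measurable_P_slice)
    have PT: "dist (P l (T x)) (P l (T y)) \<le> d / \<rho> \<longleftrightarrow> dist (P l x) (P l y) \<le> d" for x y
    proof -
      have "P l (T x) - P l (T y) = P l ((1 / \<rho>) *\<^sub>R (x - y))"
        using linear_diff[OF linear_P[OF l], of "T x" "T y"] by (simp add: T_def scaleR_diff_right[symmetric])
      also have "\<dots> = (1 / \<rho>) *\<^sub>R (P l x - P l y)"
        by (simp add: linear_cmul[OF linear_P[OF l]] linear_diff[OF linear_P[OF l]])
      finally show ?thesis using \<rho> by (simp add: dist_norm divide_le_cancel)
    qed
    have ob: "of_bool (x \<in> cball a \<rho> \<and> y \<in> cball a \<rho> \<and> Q) = indicator (cball a \<rho>) x * (indicator (cball a \<rho>) y * (of_bool Q :: ennreal))"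
      for x y Q by (simp add: indicator_def)
    have "correlation \<mu> (d / \<rho>) l =
       (\<integral>\<^sup>+x. indicator (cball a \<rho>) x * (ennreal k * (\<integral>\<^sup>+y. indicator (cball a \<rho>) y * (ennreal k * of_bool (dist (P l x) (P l y) \<le> d)) \<partial>\<nu>)) \<partial>\<nu>)"
      unfolding correlation_def \<mu>_def
      by (simp add: nn_integral_density nn_integral_distr PT)
    also have "\<dots> = (\<integral>\<^sup>+x. ennreal k * (\<integral>\<^sup>+y. ennreal k * of_bool (x \<in> cball a \<rho> \<and> y \<in> cball a \<rho> \<and> dist (P l x) (P l y) \<le> d) \<partial>\<nu>) \<partial>\<nu>)"
      unfolding ob by (intro nn_integral_cong) (simp add: nn_integral_cmult[symmetric] mult_ac)
    also have "\<dots> = ennreal k * ennreal k *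
      (\<integral>\<^sup>+x. \<integral>\<^sup>+y. of_bool (x \<in> cball a \<rho> \<and> y \<in> cball a \<rho> \<and> dist (P l x) (P l y) \<le> d) \<partial>\<nu> \<partial>\<nu>)"
      by (simp add: nn_integral_cmult mult.assoc)
    finally show ?thesis .
  qed
qed

text \<open>The bound for the rescaled measure carries \<open>k\<close> squared on the left and
  \<open>k\<close> once on the right. What remains is 1 / k, that is
  \<open>c * \<rho> powr s\<close>, and the m-th power of \<open>d / \<rho>\<close> lowers the
  exponent of \<open>\<rho>\<close> to s - m.\<close>

lemma local_correlation:
  fixes \<nu> :: "(real ^ 'n) measure" and a :: "real ^ 'n"
  assumes sets[measurable_cong]: "sets \<nu> = sets borel" and fin: "finite_measure \<nu>"
    and c: "0 < c" and growth: "\<And>x r. 0 < r \<Longrightarrow> emeasure \<nu> (cball x r) \<le> ennreal (c * r powr s)"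
    and \<rho>: "0 < \<rho>" and d: "0 < d"
  shows "(\<integral>\<^sup>+l. \<integral>\<^sup>+x. \<integral>\<^sup>+y. of_bool (x \<in> cball a \<rho> \<and> y \<in> cball a \<rho> \<and> dist (P l x) (P l y) \<le> d) \<partial>\<nu> \<partial>\<nu> \<partial>\<omega>)
    \<le> ennreal (corr_const * c * \<rho> powr (s - CARD('m)) * d ^ CARD('m)) * emeasure \<nu> (cball a \<rho>)"
proof -
  interpret \<nu>: finite_measure \<nu> by (rule fin)
  define k where "k = 1 / (c * \<rho> powr s)"
  have k: "0 < k" using c \<rho> by (simp add: k_def)
  define T where "T x = (1 / \<rho>) *\<^sub>R (x - a)" for x
  define \<mu> where "\<mu> = density (distr (density \<nu> (indicator (cball a \<rho>))) borel T) (\<lambda>_. ennreal k)"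
  note resc = rescaled_measure[where a=a, OF sets fin c growth \<rho>, folded T_def[abs_def] k_def, folded \<mu>_def]
  let ?J = "\<lambda>l. \<integral>\<^sup>+x. \<integral>\<^sup>+y. of_bool (x \<in> cball a \<rho> \<and> y \<in> cball a \<rho> \<and> dist (P l x) (P l y) \<le> d) \<partial>\<nu> \<partial>\<nu>"
  have kk: "ennreal (1 / k) * ennreal (1 / k) * (ennreal k * ennreal k * x) = x" for x
  proof -
    have "ennreal (1 / k) * ennreal (1 / k) * (ennreal k * ennreal k * x) = (ennreal (1 / k) * ennreal k) * (ennreal (1 / k) * ennreal k) * x"
      by (simp only: mult_ac)
    also have "ennreal (1 / k) * ennreal k = 1" using k by (simp add: ennreal_mult[symmetric])
    finally show ?thesis by simp
  qed
  have "ennreal k * ennreal k * (\<integral>\<^sup>+l. ?J l \<partial>\<omega>) = (\<integral>\<^sup>+l. ennreal k * ennreal k * ?J l \<partial>\<omega>)"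
    by (subst nn_integral_cmult) auto
  also have "\<dots> = (\<integral>\<^sup>+l. correlation \<mu> (d / \<rho>) l \<partial>\<omega>)"
    by (intro nn_integral_cong resc(5)[symmetric])
  also have "\<dots> \<le> 2 * emeasure lborel (cball (0::real ^ 'm) (d / \<rho>)) * ennreal C * emeasure \<mu> UNIV"
    using d \<rho> by (intro unit_ball_correlation(2) resc) auto
  also have "\<dots> = ennreal (corr_const * (d / \<rho>) ^ CARD('m) * k) * emeasure \<nu> (cball a \<rho>)"
  proof -
    have "2 * emeasure lborel (cball (0::real ^ 'm) (d / \<rho>)) * ennreal C = ennreal (corr_const * (d / \<rho>) ^ CARD('m))"
      using d \<rho> C
      by (simp add: emeasure_cball corr_const_def ennreal_mult[symmetric] ennreal_numeral[symmetric] mult_ac del: ennreal_numeral)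
    moreover have "ennreal (corr_const * (d / \<rho>) ^ CARD('m)) * ennreal k = ennreal (corr_const * (d / \<rho>) ^ CARD('m) * k)"
      using d \<rho> k corr_const_nonneg by (intro ennreal_mult[symmetric]) auto
    ultimately show ?thesis by (simp add: resc(2) mult.assoc[symmetric])
  qed
  finally have "ennreal (1 / k) * ennreal (1 / k) * (ennreal k * ennreal k * (\<integral>\<^sup>+l. ?J l \<partial>\<omega>))
      \<le> ennreal (1 / k) * ennreal (1 / k) * (ennreal (corr_const * (d / \<rho>) ^ CARD('m) * k) * emeasure \<nu> (cball a \<rho>))"
    by (intro mult_left_mono) auto
  then have "(\<integral>\<^sup>+l. ?J l \<partial>\<omega>) \<le> ennreal (1 / k * (1 / k) * (corr_const * (d / \<rho>) ^ CARD('m) * k)) * emeasure \<nu> (cball a \<rho>)"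
    unfolding kk using k d \<rho> corr_const_nonneg by (simp add: ennreal_mult[symmetric] mult.assoc[symmetric])
  also have "1 / k * (1 / k) * (corr_const * (d / \<rho>) ^ CARD('m) * k) = corr_const * c * \<rho> powr (s - CARD('m)) * d ^ CARD('m)"
  proof -
    have "1 / k * (1 / k) * (corr_const * (d / \<rho>) ^ CARD('m) * k) = corr_const * (d / \<rho>) ^ CARD('m) * (1 / k)"
      using k by simp
    also have "\<dots> = corr_const * (d / \<rho>) ^ CARD('m) * (c * \<rho> powr s)" by (simp add: k_def)
    also have "\<rho> powr s = \<rho> powr (s - CARD('m)) * \<rho> ^ CARD('m)"
      using \<rho> by (simp add: powr_add[symmetric] powr_realpow[symmetric])
    finally show ?thesis using \<rho> by (simp add: power_divide)
  qed
  finally show ?thesis .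
qed

text \<open>Absolute continuity passes back from the rescaled measure because dilations preserve
  Lebesgue null sets and commute with the linear maps \<open>P l\<close>.\<close>

lemma projections_absolutely_continuous:
  fixes \<nu> :: "(real ^ 'n) measure"
  assumes sets[measurable_cong]: "sets \<nu> = sets borel" and fin: "finite_measure \<nu>"
    and c: "0 < c" and growth: "\<And>x r. 0 < r \<Longrightarrow> emeasure \<nu> (cball x r) \<le> ennreal (c * r powr s)"
    and \<rho>: "0 < \<rho>" and outside: "emeasure \<nu> (- cball 0 \<rho>) = 0"
  shows "AE l in \<omega>. absolutely_continuous lborel (distr \<nu> borel (P l))"
proof -
  have sp[simp]: "space \<nu> = UNIV" using sets_eq_imp_space_eq[OF sets] by simp
  define k where "k = 1 / (c * \<rho> powr s)"
  have k: "0 < k" using c \<rho> by (simp add: k_def)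
  define T :: "real ^ 'n \<Rightarrow> real ^ 'n" where "T x = (1 / \<rho>) *\<^sub>R (x - 0)" for x
  define \<mu> where "\<mu> = density (distr (density \<nu> (indicator (cball 0 \<rho>))) borel T) (\<lambda>_. ennreal k)"
  note resc = rescaled_measure[where a=0, OF sets fin c growth \<rho>, folded T_def[abs_def] k_def, folded \<mu>_def]
  have "AE l in \<omega>. absolutely_continuous lborel (distr \<mu> borel (P l))"
    by (rule unit_ball_correlation(1)[of _ 1]) (use resc in auto)
  then show ?thesis
    using AE_space
  proof eventually_elim
    case (elim l)
    have P[measurable]: "P l \<in> borel_measurable borel" using elim(2) by (rule measurable_P_slice)
    show ?case
      unfolding absolutely_continuous_def
    proof
      fix N assume "N \<in> null_sets (lborel :: (real ^ 'm) measure)"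
      then have N[measurable]: "N \<in> sets borel" and N0: "emeasure lborel N = 0" by (auto simp: null_sets_def)
      \<comment> \<open>\<open>T\<close> shrinks by the ratio \<open>1 / \<rho>\<close> before
        \<open>P l\<close> is applied, so the test set is shrunk by the same ratio.\<close>
      define N' where "N' = (\<lambda>u. \<rho> *\<^sub>R u) -` N"
      have N'[measurable]: "N' \<in> sets borel"
        unfolding N'_def by (rule measurable_sets_borel[OF _ N]) measurable
      have "emeasure lborel N = emeasure (density (distr lborel borel (\<lambda>x. 0 + \<rho> *\<^sub>R x)) (\<lambda>_. ennreal (\<bar>\<rho>\<bar> ^ DIM(real ^ 'm)))) N"
        using \<rho> by (subst lborel_affine[of \<rho> 0]) auto
      also have "\<dots> = ennreal (\<bar>\<rho>\<bar> ^ DIM(real ^ 'm)) * emeasure lborel N'"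
        by (subst emeasure_density) (auto simp: nn_integral_cmult_indicator emeasure_distr N'_def)
      finally have "emeasure lborel N' = 0" using N0 \<rho> by simp
      then have "N' \<in> null_sets lborel" by (intro null_setsI) auto
      then have "N' \<in> null_sets (distr \<mu> borel (P l))"
        using elim(1) unfolding absolutely_continuous_def by blast
      then have "emeasure \<mu> (P l -` N') = 0"
        using resc(1) P sets_eq_imp_space_eq[OF resc(1)]
        by (auto simp: null_sets_def emeasure_distr measurable_cong_sets[OF resc(1) refl])
      then have "ennreal k * emeasure \<nu> (cball 0 \<rho> \<inter> T -` (P l -` N')) = 0"
        using resc(2) measurable_sets_borel[OF P N'] by simp
      moreover have "T -` (P l -` N') = P l -` N"
        using \<rho> by (auto simp: N'_def T_def linear_cmul[OF linear_P[OF elim(2)]])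
      ultimately have z: "emeasure \<nu> (cball 0 \<rho> \<inter> P l -` N) = 0" using k by auto
      have PN: "P l -` N \<in> sets borel" using measurable_sets_borel[OF P N] .
      have "emeasure \<nu> (P l -` N) \<le> emeasure \<nu> ((cball 0 \<rho> \<inter> P l -` N) \<union> - cball 0 \<rho>)"
        using PN by (intro emeasure_mono) (auto simp: sets)
      also have "\<dots> \<le> emeasure \<nu> (cball 0 \<rho> \<inter> P l -` N) + emeasure \<nu> (- cball 0 \<rho>)"
        using PN by (intro emeasure_subadditive) (auto simp: sets)
      finally have "emeasure \<nu> (P l -` N) = 0" using z outside by simp
      then show "N \<in> null_sets (distr \<nu> borel (P l))"
        using N by (auto simp: null_sets_def emeasure_distr)
    qed
  qed
qed

text \<open>Two points at distance at most \<open>\<rho>\<close> both lie in \<open>cball a (2 * \<rho>)\<close> for all a in a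
  ball of radius \<open>\<rho>\<close>, so averaging the local estimate over the centre a bounds all such pairs.\<close>

lemma near_pairs_correlation:
  fixes \<nu> :: "(real ^ 'n) measure"
  assumes sets[measurable_cong]: "sets \<nu> = sets borel" and fin: "finite_measure \<nu>"
    and c: "0 < c" and growth: "\<And>x r. 0 < r \<Longrightarrow> emeasure \<nu> (cball x r) \<le> ennreal (c * r powr s)"
    and \<rho>: "0 < \<rho>" and d: "0 < d"
  shows "(\<integral>\<^sup>+l. \<integral>\<^sup>+x. \<integral>\<^sup>+y. of_bool (dist x y \<le> \<rho> \<and> dist (P l x) (P l y) \<le> d) \<partial>\<nu> \<partial>\<nu> \<partial>\<omega>)
    \<le> ennreal (corr_const * c * 2 powr (s - CARD('m)) * 2 ^ CARD('n) * \<rho> powr (s - CARD('m)) * d ^ CARD('m)) * emeasure \<nu> UNIV"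
proof -
  interpret \<nu>: finite_measure \<nu> by (rule fin)
  interpret L: sigma_finite_measure "lborel :: (real ^ 'n) measure" by (rule lborel.sigma_finite_measure_axioms)
  interpret a\<nu>: pair_sigma_finite "lborel :: (real ^ 'n) measure" \<nu> ..
  interpret a\<omega>: pair_sigma_finite "lborel :: (real ^ 'n) measure" \<omega> ..
  have sp[simp]: "space \<nu> = UNIV" using sets_eq_imp_space_eq[OF sets] by simp
  define \<Phi> :: "real ^ 'n \<Rightarrow> 'l \<Rightarrow> real ^ 'n \<Rightarrow> real ^ 'n \<Rightarrow> ennreal"
    where "\<Phi> a l x y = of_bool (dist a x \<le> 2 * \<rho> \<and> dist a y \<le> 2 * \<rho> \<and> dist (P l x) (P l y) \<le> d)" for a l x y
  let ?q = "\<lambda>l x y. of_bool (dist x y \<le> \<rho> \<and> dist (P l x) (P l y) \<le> d) :: ennreal"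
  \<comment> \<open>The volume of a ball of radius \<open>\<rho>\<close>: for a pair at distance at
    most \<open>\<rho>\<close>, all centres within \<open>\<rho>\<close> of x are within
    \<open>2 * \<rho>\<close> of both points.\<close>
  define v where "v = unit_ball_vol (real CARD('n)) * \<rho> ^ CARD('n)"
  have v: "0 < v" using \<rho> by (simp add: v_def)
  have "ennreal v * (\<integral>\<^sup>+l. \<integral>\<^sup>+x. \<integral>\<^sup>+y. ?q l x y \<partial>\<nu> \<partial>\<nu> \<partial>\<omega>) = (\<integral>\<^sup>+l. \<integral>\<^sup>+x. \<integral>\<^sup>+y. ennreal v * ?q l x y \<partial>\<nu> \<partial>\<nu> \<partial>\<omega>)"
  proof -
    have "(\<integral>\<^sup>+l. \<integral>\<^sup>+x. \<integral>\<^sup>+y. ennreal v * ?q l x y \<partial>\<nu> \<partial>\<nu> \<partial>\<omega>) = (\<integral>\<^sup>+l. ennreal v * (\<integral>\<^sup>+x. \<integral>\<^sup>+y. ?q l x y \<partial>\<nu> \<partial>\<nu>) \<partial>\<omega>)"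
    proof (rule nn_integral_cong)
      fix l assume [simp]: "l \<in> space \<omega>"
      show "(\<integral>\<^sup>+x. \<integral>\<^sup>+y. ennreal v * ?q l x y \<partial>\<nu> \<partial>\<nu>) = ennreal v * (\<integral>\<^sup>+x. \<integral>\<^sup>+y. ?q l x y \<partial>\<nu> \<partial>\<nu>)"
        by (simp add: nn_integral_cmult)
    qed
    also have "\<dots> = ennreal v * (\<integral>\<^sup>+l. \<integral>\<^sup>+x. \<integral>\<^sup>+y. ?q l x y \<partial>\<nu> \<partial>\<nu> \<partial>\<omega>)"
      by (rule nn_integral_cmult) measurable
    finally show ?thesis ..
  qed
  also have "\<dots> \<le> (\<integral>\<^sup>+l. \<integral>\<^sup>+x. \<integral>\<^sup>+y. \<integral>\<^sup>+a. \<Phi> a l x y \<partial>lborel \<partial>\<nu> \<partial>\<nu> \<partial>\<omega>)"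
  proof (intro nn_integral_mono)
    fix l and x y :: "real ^ 'n"
    show "ennreal v * ?q l x y \<le> (\<integral>\<^sup>+a. \<Phi> a l x y \<partial>lborel)"
    proof (cases "dist x y \<le> \<rho> \<and> dist (P l x) (P l y) \<le> d")
      case True
      have "indicator (cball x \<rho>) a \<le> \<Phi> a l x y" for a
      proof (cases "a \<in> cball x \<rho>")
        case a: True
        then have "dist a x \<le> 2 * \<rho>" "dist a y \<le> 2 * \<rho>"
          using True dist_triangle[of a y x] \<rho> by (auto simp: dist_commute)
        then show ?thesis using True a by (simp add: \<Phi>_def)
      qed simp
      then have "emeasure lborel (cball x \<rho>) \<le> (\<integral>\<^sup>+a. \<Phi> a l x y \<partial>lborel)"
        using nn_integral_mono[of lborel "indicator (cball x \<rho>)" "\<lambda>a. \<Phi> a l x y"] by simp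
      then show ?thesis using True \<rho> by (simp add: emeasure_cball v_def)
    qed auto
  qed
  also have "\<dots> = (\<integral>\<^sup>+l. \<integral>\<^sup>+a. \<integral>\<^sup>+x. \<integral>\<^sup>+y. \<Phi> a l x y \<partial>\<nu> \<partial>\<nu> \<partial>lborel \<partial>\<omega>)"
  proof (rule nn_integral_cong)
    fix l assume [simp]: "l \<in> space \<omega>"
    have "(\<integral>\<^sup>+x. \<integral>\<^sup>+y. \<integral>\<^sup>+a. \<Phi> a l x y \<partial>lborel \<partial>\<nu> \<partial>\<nu>) = (\<integral>\<^sup>+x. \<integral>\<^sup>+a. \<integral>\<^sup>+y. \<Phi> a l x y \<partial>\<nu> \<partial>lborel \<partial>\<nu>)"
      by (intro nn_integral_cong a\<nu>.Fubini') (simp add: \<Phi>_def)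
    also have "\<dots> = (\<integral>\<^sup>+a. \<integral>\<^sup>+x. \<integral>\<^sup>+y. \<Phi> a l x y \<partial>\<nu> \<partial>\<nu> \<partial>lborel)"
      by (intro a\<nu>.Fubini') (simp add: \<Phi>_def)
    finally show "(\<integral>\<^sup>+x. \<integral>\<^sup>+y. \<integral>\<^sup>+a. \<Phi> a l x y \<partial>lborel \<partial>\<nu> \<partial>\<nu>) = (\<integral>\<^sup>+a. \<integral>\<^sup>+x. \<integral>\<^sup>+y. \<Phi> a l x y \<partial>\<nu> \<partial>\<nu> \<partial>lborel)" .
  qed
  also have "\<dots> = (\<integral>\<^sup>+a. \<integral>\<^sup>+l. \<integral>\<^sup>+x. \<integral>\<^sup>+y. \<Phi> a l x y \<partial>\<nu> \<partial>\<nu> \<partial>\<omega> \<partial>lborel)"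
    by (intro a\<omega>.Fubini') (simp add: \<Phi>_def)
  also have "\<dots> \<le> (\<integral>\<^sup>+a. ennreal (corr_const * c * (2 * \<rho>) powr (s - CARD('m)) * d ^ CARD('m)) * emeasure \<nu> (cball a (2 * \<rho>)) \<partial>lborel)"
    using local_correlation[OF sets fin c growth _ d, of "2 * \<rho>"] \<rho>
    by (intro nn_integral_mono) (simp add: \<Phi>_def)
  also have "\<dots> = ennreal (corr_const * c * (2 * \<rho>) powr (s - CARD('m)) * d ^ CARD('m)) * (\<integral>\<^sup>+a. \<integral>\<^sup>+x. of_bool (dist a x \<le> 2 * \<rho>) \<partial>\<nu> \<partial>lborel)"
  proof -
    have "emeasure \<nu> (cball a (2 * \<rho>)) = (\<integral>\<^sup>+x. of_bool (dist a x \<le> 2 * \<rho>) \<partial>\<nu>)" for a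
      by (subst nn_integral_of_bool) (auto simp: cball_def)
    then show ?thesis by (simp add: nn_integral_cmult)
  qed
  also have "(\<integral>\<^sup>+a. \<integral>\<^sup>+x. of_bool (dist a x \<le> 2 * \<rho>) \<partial>\<nu> \<partial>lborel) = (\<integral>\<^sup>+x. \<integral>\<^sup>+a. of_bool (dist a x \<le> 2 * \<rho>) \<partial>lborel \<partial>\<nu>)"
    by (rule a\<nu>.Fubini'[symmetric]) simp
  \<comment> \<open>The centres whose balls of radius \<open>2 * \<rho>\<close> contain x fill a
    ball of that radius. Relative to v this is the overlap factor \<open>2 ^ CARD('n)\<close> of the
    averaging.\<close>
  also have "\<dots> = (\<integral>\<^sup>+x. ennreal (2 ^ CARD('n) * v) \<partial>\<nu>)"
  proof (rule nn_integral_cong)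
    fix x :: "real ^ 'n"
    have "(\<integral>\<^sup>+a. of_bool (dist a x \<le> 2 * \<rho>) \<partial>lborel) = emeasure lborel (cball x (2 * \<rho>))"
      by (subst nn_integral_of_bool) (auto simp: cball_def dist_commute)
    then show "(\<integral>\<^sup>+a. of_bool (dist a x \<le> 2 * \<rho>) \<partial>lborel) = ennreal (2 ^ CARD('n) * v)"
      using \<rho> by (simp add: emeasure_cball v_def power_mult_distrib mult_ac)
  qed
  also have "\<dots> = ennreal (2 ^ CARD('n) * v) * emeasure \<nu> UNIV" by simp
  finally have "ennreal (1 / v) * (ennreal v * (\<integral>\<^sup>+l. \<integral>\<^sup>+x. \<integral>\<^sup>+y. ?q l x y \<partial>\<nu> \<partial>\<nu> \<partial>\<omega>))
    \<le> ennreal (1 / v) * (ennreal (corr_const * c * (2 * \<rho>) powr (s - CARD('m)) * d ^ CARD('m)) * (ennreal (2 ^ CARD('n) * v) * emeasure \<nu> UNIV))"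
    by (rule mult_left_mono) simp
  also have "ennreal (1 / v) * (ennreal v * (\<integral>\<^sup>+l. \<integral>\<^sup>+x. \<integral>\<^sup>+y. ?q l x y \<partial>\<nu> \<partial>\<nu> \<partial>\<omega>)) = (\<integral>\<^sup>+l. \<integral>\<^sup>+x. \<integral>\<^sup>+y. ?q l x y \<partial>\<nu> \<partial>\<nu> \<partial>\<omega>)"
    using v by (simp add: mult.assoc[symmetric] ennreal_mult[symmetric])
  also have "ennreal (1 / v) * (ennreal (corr_const * c * (2 * \<rho>) powr (s - CARD('m)) * d ^ CARD('m)) * (ennreal (2 ^ CARD('n) * v) * emeasure \<nu> UNIV))
    = ennreal (1 / v * (corr_const * c * (2 * \<rho>) powr (s - CARD('m)) * d ^ CARD('m)) * (2 ^ CARD('n) * v)) * emeasure \<nu> UNIV"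
    using v \<rho> c d corr_const_nonneg by (simp add: mult.assoc[symmetric] ennreal_mult[symmetric])
  also have "1 / v * (corr_const * c * (2 * \<rho>) powr (s - CARD('m)) * d ^ CARD('m)) * (2 ^ CARD('n) * v)
    = corr_const * c * 2 powr (s - CARD('m)) * 2 ^ CARD('n) * \<rho> powr (s - CARD('m)) * d ^ CARD('m)"
    using v \<rho> by (simp add: powr_mult)
  finally show ?thesis .
qed

end


section \<open>Energies of slices\<close>

text \<open>A dyadic substitute for the Riesz kernel \<open>z powr - t\<close>.\<close>

definition dyadic_kernel :: "real \<Rightarrow> real \<Rightarrow> ennreal" where
  "dyadic_kernel t z = (\<Sum>k. ennreal (2 powr (real k * t)) * of_bool (z \<le> 2 powr - real k))"

lemma borel_measurable_dyadic_kernel [measurable]: "dyadic_kernel t \<in> borel_measurable borel"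
  unfolding dyadic_kernel_def[abs_def] by measurable

text \<open>Let k be the largest index with 2r at most the k-th dyadic radius. That radius is below
  4r, so the k-th term of the kernel alone is at least \<open>(4 * r) powr - t\<close>.\<close>

lemma dyadic_kernel_ge:
  assumes "0 < r" "r \<le> 1 / 2" "z \<le> 2 * r" "0 \<le> t"
  shows "ennreal (r powr - t) \<le> ennreal (4 powr t) * dyadic_kernel t z"
proof -
  obtain K where K: "(1 / 2 :: real) ^ K < 2 * r"
    using real_arch_pow_inv[of "2 * r" "1 / 2"] assms by auto
  define K' where "K' = (LEAST K. (1 / 2 :: real) ^ K < 2 * r)"
  have K': "(1 / 2 :: real) ^ K' < 2 * r" unfolding K'_def by (rule LeastI[of _ K]) (rule K)
  \<comment> \<open>This is where \<open>r \<le> 1 / 2\<close> enters: \<open>2 * r\<close> does not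
    exceed the dyadic radius of index 0.\<close>
  have "K' \<noteq> 0" using K' assms(2) by (intro notI) simp
  then obtain k where k: "K' = Suc k" by (cases K') auto
  have "\<not> (1 / 2 :: real) ^ k < 2 * r"
    using not_less_Least[of k "\<lambda>K. (1 / 2 :: real) ^ K < 2 * r"] k by (simp add: K'_def)
  then have lower: "2 * r \<le> (1 / 2) ^ k" by simp
  have pw: "2 powr - real k = (1 / 2) ^ k"
    by (simp add: powr_minus powr_realpow power_one_over inverse_eq_divide)
  have "1 / (4 * r) \<le> 2 ^ k"
    using K' k assms(1) by (simp add: field_simps power_one_over)
  then have "(1 / (4 * r)) powr t \<le> (2 ^ k) powr t"
    using assms by (intro powr_mono2) auto
  then have "4 powr t * (1 / (4 * r)) powr t \<le> 4 powr t * 2 powr (real k * t)"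
    by (intro mult_left_mono) (simp_all add: powr_realpow[symmetric] powr_powr)
  moreover have "4 powr t * (1 / (4 * r)) powr t = r powr - t"
  proof -
    have "4 powr t * (1 / (4 * r)) powr t = (1 / r) powr t"
      using assms(1) by (subst powr_mult[symmetric]) auto
    then show ?thesis using assms(1) by (simp add: powr_divide powr_minus_divide)
  qed
  ultimately have "ennreal (r powr - t) \<le> ennreal (4 powr t * 2 powr (real k * t))"
    by (intro ennreal_leI) simp
  also have "\<dots> = ennreal (4 powr t) * (ennreal (2 powr (real k * t)) * of_bool (z \<le> 2 powr - real k))"
    using lower assms(3) pw by (simp add: ennreal_mult)
  also have "ennreal (2 powr (real k * t)) * of_bool (z \<le> 2 powr - real k) \<le> dyadic_kernel t z"
  proof -
    define f where "f k = ennreal (2 powr (real k * t)) * (of_bool (z \<le> 2 powr - real k) :: ennreal)" for k :: nat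
    have "f k \<le> suminf f" using sum_le_suminf[of f "{k}"] by simp
    then show ?thesis unfolding dyadic_kernel_def f_def .
  qed
  finally show ?thesis by (simp add: mult_left_mono)
qed

text \<open>The compactness argument calls for open balls of positive radius and
  \<open>dyadic_kernel_ge\<close> for radii at most 1 / 2; a cheap cover by arbitrary small sets is
  fattened accordingly.\<close>

lemma hausdorff_null_ball_cover:
  fixes X :: "'a::metric_space set"
  assumes null: "hausdorff_measure t X = 0" and t: "0 < t" and \<epsilon>: "0 < \<epsilon>"
  obtains x :: "nat \<Rightarrow> 'a" and r :: "nat \<Rightarrow> real"
  where "X \<subseteq> (\<Union>i. ball (x i) (r i))" "\<And>i. 0 < r i" "\<And>i. r i \<le> 1 / 2"
    "(\<Sum>i. ennreal (r i powr t)) \<le> ennreal \<epsilon>"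
proof -
  \<comment> \<open>Doubling the radii costs \<open>2 powr t\<close>, and the diameters and the
    padding contribute \<open>e\<close> each.\<close>
  define e where "e = \<epsilon> / (2 * 2 powr t)"
  have e: "0 < e" using \<epsilon> by (simp add: e_def)
  have "hausdorff_pre_measure t (1/4) X \<le> 0"
    using hausdorff_pre_measure_le_measure[of "1/4" t X] null by simp
  also have "0 < ennreal e" using e by simp
  finally obtain U :: "nat \<Rightarrow> 'a set" where U: "X \<subseteq> (\<Union>i. U i)" "\<And>i. bounded (U i)"
    "\<And>i. diameter (U i) \<le> 1/4" "(\<Sum>i. diam_powr t (U i)) < ennreal e"
    by (rule hausdorff_pre_measure_lessE) blast
  \<comment> \<open>Padding for sets of diameter 0: its t-th powers sum to at most \<open>e\<close>,
    and the bound 1/4 keeps the doubled radii at most 1/2.\<close>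
  define \<eta> where "\<eta> i = min (1/4) ((e * (1/2) ^ Suc i) powr (1 / t))" for i
  define r where "r i = 2 * max (diameter (U i)) (\<eta> i)" for i
  \<comment> \<open>For empty \<open>U i\<close> this is an unspecified point; the ball around it is
    harmless and paid for by the padding.\<close>
  define x where "x i = (SOME y. y \<in> U i)" for i
  have \<eta>: "0 < \<eta> i" for i using e by (simp add: \<eta>_def)
  have d: "0 \<le> diameter (U i)" for i by (rule diameter_ge_0[OF U(2)])
  have "X \<subseteq> (\<Union>i. ball (x i) (r i))"
  proof
    fix y assume "y \<in> X"
    then obtain i where i: "y \<in> U i" using U(1) by auto
    then have "x i \<in> U i" unfolding x_def by (rule someI)
    then have "dist (x i) y \<le> diameter (U i)" using i U(2) by (intro diameter_bounded_bound)
    also have "\<dots> < r i" using \<eta>[of i] d[of i] by (simp add: r_def max_def)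
    finally show "y \<in> (\<Union>i. ball (x i) (r i))" by auto
  qed
  moreover have "0 < r i" for i using \<eta>[of i] by (simp add: r_def less_max_iff_disj)
  moreover have "r i \<le> 1/2" for i using U(3)[of i] by (simp add: r_def \<eta>_def)
  moreover have "(\<Sum>i. ennreal (r i powr t)) \<le> ennreal \<epsilon>"
  proof -
    have "ennreal (r i powr t) \<le> ennreal (2 powr t) * (diam_powr t (U i) + ennreal e * ennreal ((1/2) ^ Suc i))" for i
    proof -
      have "\<eta> i powr t \<le> ((e * (1/2) ^ Suc i) powr (1 / t)) powr t"
        using \<eta>[of i] t by (intro powr_mono2) (auto simp: \<eta>_def)
      also have "\<dots> = e * (1/2) ^ Suc i" using e t by (simp add: powr_powr)
      finally have "max (diameter (U i)) (\<eta> i) powr t \<le> diameter (U i) powr t + e * (1/2) ^ Suc i"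
        using powr_ge_zero[of "diameter (U i)" t] e unfolding max_def
        by (auto simp: add_increasing add_increasing2)
      then have "r i powr t \<le> 2 powr t * (diameter (U i) powr t + e * (1/2) ^ Suc i)"
        using d[of i] by (simp add: r_def powr_mult)
      moreover have "diam_powr t (U i) = ennreal (diameter (U i) powr t)"
        using t by (simp add: diam_powr_def)
      ultimately show ?thesis
        using e by (simp add: ennreal_mult[symmetric] ennreal_plus[symmetric] ennreal_leI del: ennreal_plus)
    qed
    then have "(\<Sum>i. ennreal (r i powr t)) \<le> (\<Sum>i. ennreal (2 powr t) * (diam_powr t (U i) + ennreal e * ennreal ((1/2) ^ Suc i)))"
      by (intro suminf_le) auto
    also have "\<dots> = ennreal (2 powr t) * ((\<Sum>i. diam_powr t (U i)) + ennreal e * (\<Sum>i. ennreal ((1/2) ^ Suc i)))"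
      by (simp only: ennreal_suminf_cmult suminf_add[symmetric] summableI)
    also have "(\<Sum>i. ennreal ((1/2) ^ Suc i)) = 1"
      by (subst suminf_ennreal_eq[OF zero_le_power power_half_series]) auto
    also have "ennreal (2 powr t) * ((\<Sum>i. diam_powr t (U i)) + ennreal e * 1) \<le> ennreal (2 powr t) * (ennreal e + ennreal e)"
      using U(4) by (intro mult_left_mono add_mono) auto
    also have "\<dots> = ennreal \<epsilon>"
      using e \<epsilon> by (simp add: ennreal_mult[symmetric] ennreal_plus[symmetric] e_def del: ennreal_plus)
    finally show ?thesis .
  qed
  ultimately show ?thesis by (rule that)
qed

text \<open>Only the part of \<open>\<nu>\<close> in the tube of radius \<open>\<delta>\<close> around the fibre of p over u counts; the
  factor makes its mass comparable to the density of the projected measure at u.\<close>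

definition slice_energy ::
  "('a::euclidean_space) measure \<Rightarrow> real \<Rightarrow> real \<Rightarrow> ('a \<Rightarrow> 'b::euclidean_space) \<Rightarrow> 'b \<Rightarrow> ennreal" where
  "slice_energy \<nu> t \<delta> p u = ennreal (1 / (\<delta> ^ DIM('b) * \<delta> ^ DIM('b))) *
    (\<integral>\<^sup>+x. \<integral>\<^sup>+y. dyadic_kernel t (dist x y) * of_bool (dist (p x) u \<le> \<delta> \<and> dist (p y) u \<le> \<delta>) \<partial>\<nu> \<partial>\<nu>)"

text \<open>By Cauchy-Schwarz, in the form of the weighted AM-GM inequality with weight \<open>\<tau>\<close>, mass on a
  cheaply covered set has large energy.\<close>

lemma tube_mass_le_energy:
  fixes \<nu> :: "'a::euclidean_space measure" and p :: "'a \<Rightarrow> 'b::euclidean_space"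
  assumes sets[measurable_cong]: "sets \<nu> = sets borel" and fin: "finite_measure \<nu>"
    and p[measurable]: "p \<in> borel_measurable borel"
    and r: "\<And>i. 0 < r i" "\<And>i. r i \<le> 1 / 2" and sum: "(\<Sum>i. ennreal (r i powr t)) \<le> ennreal \<epsilon>"
    and cover: "emeasure \<nu> (p -` cball u \<delta> - (\<Union>i::nat. ball (x i) (r i))) = 0"
    and "0 \<le> t" "0 < \<delta>" "0 < \<tau>" "0 \<le> \<epsilon>"
  shows "2 * emeasure \<nu> (p -` cball u \<delta>) \<le> ennreal (\<delta> ^ DIM('b)) *
    (ennreal (\<tau> * \<epsilon>) + ennreal (4 powr t / \<tau>) * slice_energy \<nu> t \<delta> p u)"
proof -
  interpret \<nu>: finite_measure \<nu> by (rule fin)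
  have sp[simp]: "space \<nu> = UNIV" using sets_eq_imp_space_eq[OF sets] by simp
  define S where "S = p -` cball u \<delta>"
  have S[measurable]: "S \<in> sets borel" unfolding S_def by (rule measurable_sets_borel[OF p]) simp
  \<comment> \<open>Disjoint pieces, so that each pair of points is charged to at most one
    ball.\<close>
  define D where "D i = disjointed (\<lambda>i. ball (x i) (r i)) i \<inter> S" for i
  have D[measurable]: "D i \<in> sets borel" for i
    unfolding D_def by (intro sets.Int S sets.range_disjointed_sets'[THEN range_subsetD]) auto
  have disj: "disjoint_family D"
    using disjoint_family_disjointed[of "\<lambda>i. ball (x i) (r i)"] unfolding D_def disjoint_family_on_def by blast
  have Dsub: "D i \<subseteq> ball (x i) (r i)" "D i \<subseteq> S" for i
    using disjointed_subset[of "\<lambda>i. ball (x i) (r i)" i] by (auto simp: D_def)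
  have UD: "(\<Union>i. D i) = S \<inter> (\<Union>i. ball (x i) (r i))"
    using UN_disjointed_eq[of "\<lambda>i. ball (x i) (r i)"] by (auto simp: D_def)
  define v where "v = \<delta> ^ DIM('b)"
  have v: "0 < v" using \<open>0 < \<delta>\<close> by (simp add: v_def)
  define a where "a i = measure \<nu> (D i)" for i
  have a: "0 \<le> a i" "emeasure \<nu> (D i) = ennreal (a i)" for i
    by (simp_all add: a_def \<nu>.emeasure_eq_measure)
  have "emeasure \<nu> S \<le> emeasure \<nu> (\<Union>i. D i) + emeasure \<nu> (S - (\<Union>i. ball (x i) (r i)))"
    by (rule order_trans[OF _ emeasure_subadditive]) (auto simp: sets UD intro!: emeasure_mono)
  also have "\<dots> = (\<Sum>i. emeasure \<nu> (D i))"
    using cover by (subst suminf_emeasure) (auto simp: S_def sets disj D)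
  finally have S_le: "emeasure \<nu> S \<le> (\<Sum>i. ennreal (a i))" by (simp add: a)
  \<comment> \<open>This is the square of \<open>w - a i\<close> divided by w, with
    \<open>v * \<tau> * r i powr t\<close> as w: the first term then sums to the cost of the cover
    and the second to the energy.\<close>
  have amgm: "2 * a i \<le> v * \<tau> * r i powr t + (1 / (v * \<tau>)) * (r i powr - t * (a i * a i))" for i
  proof -
    define w where "w = v * \<tau> * r i powr t"
    have w: "0 < w" using v \<open>0 < \<tau>\<close> r(1)[of i] by (simp add: w_def)
    have "0 \<le> (w - a i)\<^sup>2 / w" using w by simp
    also have "(w - a i)\<^sup>2 / w = w + a i * a i / w - 2 * a i"
      using w by (simp add: power2_eq_square field_simps)
    finally have "2 * a i \<le> w + a i * a i / w" by simp
    also have "a i * a i / w = (1 / (v * \<tau>)) * (r i powr - t * (a i * a i))"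
      by (simp add: w_def powr_minus_divide)
    finally show ?thesis by (simp add: w_def)
  qed
  have "2 * emeasure \<nu> S \<le> (\<Sum>i. 2 * ennreal (a i))"
    using S_le by (simp add: mult_left_mono)
  also have "\<dots> \<le> (\<Sum>i. ennreal (v * \<tau>) * ennreal (r i powr t) + ennreal (1 / (v * \<tau>)) * ennreal (r i powr - t * (a i * a i)))"
  proof (intro suminf_le allI)
    fix i
    have "2 * ennreal (a i) = ennreal (2 * a i)" using a(1) by (simp add: ennreal_mult)
    also have "\<dots> \<le> ennreal (v * \<tau> * r i powr t + (1 / (v * \<tau>)) * (r i powr - t * (a i * a i)))"
      by (rule ennreal_leI[OF amgm])
    also have "\<dots> = ennreal (v * \<tau>) * ennreal (r i powr t) + ennreal (1 / (v * \<tau>)) * ennreal (r i powr - t * (a i * a i))"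
      using v \<open>0 < \<tau>\<close> a(1)[of i] by (subst ennreal_plus) (auto simp: ennreal_mult[symmetric] mult_nonneg_nonneg)
    finally show "2 * ennreal (a i) \<le> \<dots>" .
  qed auto
  also have "\<dots> = ennreal (v * \<tau>) * (\<Sum>i. ennreal (r i powr t)) + ennreal (1 / (v * \<tau>)) * (\<Sum>i. ennreal (r i powr - t * (a i * a i)))"
    by (simp only: ennreal_suminf_cmult suminf_add[symmetric] summableI)
  also have "\<dots> \<le> ennreal (v * \<tau>) * ennreal \<epsilon> + ennreal (1 / (v * \<tau>)) *
      (ennreal (4 powr t) * (ennreal (v * v) * slice_energy \<nu> t \<delta> p u))"
  proof (intro add_mono mult_left_mono sum)
    let ?k = "\<lambda>x y. dyadic_kernel t (dist x y) * of_bool (dist (p x) u \<le> \<delta> \<and> dist (p y) u \<le> \<delta>)"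
    have "(\<Sum>i. ennreal (r i powr - t * (a i * a i)))
        = (\<Sum>i. \<integral>\<^sup>+x. \<integral>\<^sup>+y. ennreal (r i powr - t) * (indicator (D i) x * indicator (D i) y) \<partial>\<nu> \<partial>\<nu>)"
    proof (rule suminf_cong)
      fix i
      have "(\<integral>\<^sup>+x. \<integral>\<^sup>+y. ennreal (r i powr - t) * (indicator (D i) x * indicator (D i) y) \<partial>\<nu> \<partial>\<nu>)
         = (\<integral>\<^sup>+x. \<integral>\<^sup>+y. (ennreal (r i powr - t) * indicator (D i) x) * indicator (D i) y \<partial>\<nu> \<partial>\<nu>)"
        by (simp only: mult.assoc)
      also have "\<dots> = (\<integral>\<^sup>+x. (ennreal (r i powr - t) * ennreal (a i)) * indicator (D i) x \<partial>\<nu>)"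
        by (intro nn_integral_cong, subst nn_integral_cmult_indicator) (auto simp: sets a mult_ac)
      also have "\<dots> = ennreal (r i powr - t) * ennreal (a i) * ennreal (a i)"
        by (simp add: nn_integral_cmult_indicator sets a)
      also have "\<dots> = ennreal (r i powr - t * (a i * a i))"
        using a(1)[of i] by (simp add: ennreal_mult mult.assoc)
      finally show "ennreal (r i powr - t * (a i * a i))
        = (\<integral>\<^sup>+x. \<integral>\<^sup>+y. ennreal (r i powr - t) * (indicator (D i) x * indicator (D i) y) \<partial>\<nu> \<partial>\<nu>)" ..
    qed
    also have "\<dots> = (\<integral>\<^sup>+x. \<integral>\<^sup>+y. (\<Sum>i. ennreal (r i powr - t) * (indicator (D i) x * indicator (D i) y)) \<partial>\<nu> \<partial>\<nu>)"
      by (simp add: nn_integral_suminf[symmetric])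
    also have "\<dots> \<le> (\<integral>\<^sup>+x. \<integral>\<^sup>+y. ennreal (4 powr t) * ?k x y \<partial>\<nu> \<partial>\<nu>)"
    proof (intro nn_integral_mono)
      fix y z
      show "(\<Sum>i. ennreal (r i powr - t) * (indicator (D i) y * indicator (D i) z)) \<le> ennreal (4 powr t) * ?k y z"
      proof (cases "\<exists>i. y \<in> D i \<and> z \<in> D i")
        case True
        then obtain i where i: "y \<in> D i" "z \<in> D i" by auto
        then have "ennreal (r j powr - t) * (indicator (D j) y * indicator (D j) z) = 0" if "j \<noteq> i" for j
          using disj that by (auto simp: disjoint_family_on_def indicator_def)
        then have "(\<Sum>i. ennreal (r i powr - t) * (indicator (D i) y * indicator (D i) z)) = (\<Sum>j\<in>{i}. ennreal (r j powr - t) * (indicator (D j) y * indicator (D j) z))"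
          by (intro suminf_finite) auto
        also have "\<dots> = ennreal (r i powr - t)" using i by simp
        also have "\<dots> \<le> ennreal (4 powr t) * dyadic_kernel t (dist y z)"
        proof (rule dyadic_kernel_ge[OF r])
          show "dist y z \<le> 2 * r i"
          proof -
            have "dist (x i) y < r i" "dist (x i) z < r i" using Dsub(1)[of i] i by auto
            then show ?thesis using dist_triangle3[of y z "x i"] by linarith
          qed
        qed (rule \<open>0 \<le> t\<close>)
        also have "\<dots> = ennreal (4 powr t) * ?k y z"
          using Dsub(2)[of i] i by (auto simp: S_def dist_commute)
        finally show ?thesis .
      next
        case False
        then have "ennreal (r i powr - t) * (indicator (D i) y * indicator (D i) z) = 0" for i
          by (auto simp: indicator_def)
        then have "(\<Sum>i. ennreal (r i powr - t) * (indicator (D i) y * indicator (D i) z)) = 0"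
          by (simp only: suminf_zero)
        then show ?thesis by (simp only: zero_le)
      qed
    qed
    also have "\<dots> = ennreal (4 powr t) * (\<integral>\<^sup>+x. \<integral>\<^sup>+y. ?k x y \<partial>\<nu> \<partial>\<nu>)"
      by (simp add: nn_integral_cmult)
    also have "(\<integral>\<^sup>+x. \<integral>\<^sup>+y. ?k x y \<partial>\<nu> \<partial>\<nu>) = ennreal (v * v) * slice_energy \<nu> t \<delta> p u"
    proof -
      have "ennreal (v * v) * ennreal (1 / (v * v)) = 1" using v by (simp add: ennreal_mult[symmetric])
      then show ?thesis by (simp add: slice_energy_def v_def mult.assoc[symmetric])
    qed
    finally show "(\<Sum>i. ennreal (r i powr - t * (a i * a i))) \<le> ennreal (4 powr t) * (ennreal (v * v) * slice_energy \<nu> t \<delta> p u)" .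
  qed auto
  also have "\<dots> = ennreal v * (ennreal (\<tau> * \<epsilon>) + ennreal (4 powr t / \<tau>) * slice_energy \<nu> t \<delta> p u)"
  proof -
    have 1: "ennreal (v * \<tau>) * ennreal \<epsilon> = ennreal v * ennreal (\<tau> * \<epsilon>)"
      using v \<open>0 < \<tau>\<close> \<open>0 \<le> \<epsilon>\<close> by (simp add: ennreal_mult mult.assoc)
    have 2: "ennreal (1 / (v * \<tau>)) * (ennreal (4 powr t) * (ennreal (v * v) * z))
        = ennreal v * ennreal (4 powr t / \<tau>) * z" for z
    proof -
      have "ennreal (1 / (v * \<tau>)) * (ennreal (4 powr t) * (ennreal (v * v) * z))
          = ennreal (1 / (v * \<tau>) * (4 powr t) * (v * v)) * z"
        using v \<open>0 < \<tau>\<close> by (simp add: ennreal_mult[symmetric] mult.assoc[symmetric])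
      also have "1 / (v * \<tau>) * (4 powr t) * (v * v) = v * (4 powr t / \<tau>)" using v by simp
      also have "ennreal (v * (4 powr t / \<tau>)) = ennreal v * ennreal (4 powr t / \<tau>)"
        using v \<open>0 < \<tau>\<close> by (intro ennreal_mult) auto
      finally show ?thesis .
    qed
    show ?thesis unfolding 1 2 by (simp add: distrib_left mult.assoc)
  qed
  finally show ?thesis by (simp add: S_def v_def)
qed

text \<open>Open balls that cover the fibre inside \<open>F\<close> cover all of \<open>F\<close>
  over a small ball around u, since the image of the compact remainder misses u. Thin tubes thus
  have no mass outside the cheap cover, and \<open>tube_mass_le_energy\<close> applies to
  them.\<close>

lemma fibre_hausdorff_measure_pos:
  fixes \<nu> :: "'a::euclidean_space measure" and p :: "'a \<Rightarrow> 'b::euclidean_space"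
  assumes sets[measurable_cong]: "sets \<nu> = sets borel" and fin: "finite_measure \<nu>"
    and F: "compact F" "emeasure \<nu> (- F) = 0"
    and p: "continuous_on UNIV p" and t: "0 < t"
    and \<delta>: "\<And>j. 0 < \<delta> j" "\<delta> \<longlonglongrightarrow> 0"
    and energy: "liminf (\<lambda>j. slice_energy \<nu> t (\<delta> j) p u) < \<infinity>"
    and L: "0 < L" "\<forall>\<^sub>F j in sequentially. ennreal (L * \<delta> j ^ DIM('b)) \<le> emeasure \<nu> (p -` cball u (\<delta> j))"
  shows "hausdorff_measure t (F \<inter> p -` {u}) \<noteq> 0"
proof
  assume null: "hausdorff_measure t (F \<inter> p -` {u}) = 0"
  have pm[measurable]: "p \<in> borel_measurable borel" using p by (rule borel_measurable_continuous_onI)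
  obtain M0 :: real where M0: "liminf (\<lambda>j. slice_energy \<nu> t (\<delta> j) p u) = ennreal M0" "0 \<le> M0"
    using energy by (cases "liminf (\<lambda>j. slice_energy \<nu> t (\<delta> j) p u)") auto
  define M where "M = M0 + 1"
  have M: "0 < M" "liminf (\<lambda>j. slice_energy \<nu> t (\<delta> j) p u) < ennreal M"
    using M0 by (auto simp: M_def ennreal_less_iff)
  \<comment> \<open>With this \<open>\<tau>\<close> and the \<open>\<epsilon>\<close> below, and up
    to the common power of \<open>\<delta> j\<close>, the cover term is L / 2 and the energy term at
    most L, against at least 2L from twice the tube mass.\<close>
  define \<tau> where "\<tau> = 4 powr t * M / L"
  have \<tau>: "0 < \<tau>" using M L by (simp add: \<tau>_def)
  define \<epsilon> where "\<epsilon> = L / (2 * \<tau>)"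
  have \<epsilon>: "0 < \<epsilon>" using \<tau> L by (simp add: \<epsilon>_def)
  obtain x r where xr: "F \<inter> p -` {u} \<subseteq> (\<Union>i. ball (x i) (r i))" "\<And>i::nat. 0 < r i" "\<And>i. r i \<le> 1 / 2"
    "(\<Sum>i. ennreal (r i powr t)) \<le> ennreal \<epsilon>"
    using hausdorff_null_ball_cover[OF null t \<epsilon>] by blast
  let ?W = "\<Union>i. ball (x i) (r i)"
  have "compact (p ` (F - ?W))"
    using F(1) by (intro compact_continuous_image continuous_on_subset[OF p] compact_diff) auto
  then have "open (- (p ` (F - ?W)))" by (intro open_Compl compact_imp_closed)
  moreover have "u \<in> - (p ` (F - ?W))" using xr(1) by auto
  ultimately obtain d where d: "0 < d" "cball u d \<subseteq> - (p ` (F - ?W))"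
    using open_contains_cball by blast
  have "\<forall>\<^sub>F j in sequentially. \<delta> j < d" using \<delta>(2) d(1) by (rule order_tendstoD(2))
  \<comment> \<open>A finite \<open>liminf\<close> bounds the energy for infinitely many j only; the
    other two conditions hold eventually, so some j meets all three.\<close>
  moreover have "\<exists>\<^sub>F j in sequentially. slice_energy \<nu> t (\<delta> j) p u < ennreal M"
  proof (rule ccontr)
    assume "\<not> ?thesis"
    then have "\<forall>\<^sub>F j in sequentially. ennreal M \<le> slice_energy \<nu> t (\<delta> j) p u"
      by (simp add: not_frequently not_less)
    then have "ennreal M \<le> liminf (\<lambda>j. slice_energy \<nu> t (\<delta> j) p u)" by (rule Liminf_bounded)
    with M(2) show False by simp
  qed
  ultimately have "\<exists>\<^sub>F j in sequentially. slice_energy \<nu> t (\<delta> j) p u < ennreal M \<and>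
      (\<delta> j < d \<and> ennreal (L * \<delta> j ^ DIM('b)) \<le> emeasure \<nu> (p -` cball u (\<delta> j)))"
    using L(2) by (intro frequently_eventually_frequently eventually_conj)
  then obtain j where j: "\<delta> j < d" "slice_energy \<nu> t (\<delta> j) p u < ennreal M"
     "ennreal (L * \<delta> j ^ DIM('b)) \<le> emeasure \<nu> (p -` cball u (\<delta> j))"
    using frequently_ex by blast
  have Fb: "F \<in> sets borel" using F(1) by (rule borel_compact)
  have "p -` cball u (\<delta> j) - ?W \<subseteq> - F"
  proof
    fix y assume y: "y \<in> p -` cball u (\<delta> j) - ?W"
    then have "p y \<in> cball u d" using j(1) by simp
    then have "p y \<notin> p ` (F - ?W)" using d(2) by blast
    then show "y \<in> - F" using y by blast
  qed
  then have "emeasure \<nu> (p -` cball u (\<delta> j) - ?W) \<le> emeasure \<nu> (- F)"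
    using Fb by (intro emeasure_mono) (auto simp: sets)
  then have cover: "emeasure \<nu> (p -` cball u (\<delta> j) - ?W) = 0" using F(2) by simp
  define w where "w = \<delta> j ^ DIM('b)"
  have w: "0 < w" using \<delta>(1) by (simp add: w_def)
  have "ennreal (2 * (L * w)) = 2 * ennreal (L * w)" using L w by (simp add: ennreal_mult)
  also have "\<dots> \<le> 2 * emeasure \<nu> (p -` cball u (\<delta> j))"
    using j(3) by (intro mult_left_mono) (auto simp: w_def)
  also have "\<dots> \<le> ennreal w * (ennreal (\<tau> * \<epsilon>) + ennreal (4 powr t / \<tau>) * slice_energy \<nu> t (\<delta> j) p u)"
    unfolding w_def using t \<delta>(1) \<tau> \<epsilon>
    by (intro tube_mass_le_energy[OF sets fin pm xr(2-4) cover]) auto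
  also have "\<dots> \<le> ennreal w * (ennreal (\<tau> * \<epsilon>) + ennreal (4 powr t / \<tau>) * ennreal M)"
    using j(2) by (intro mult_left_mono add_left_mono) auto
  also have "\<dots> = ennreal (w * (\<tau> * \<epsilon> + 4 powr t / \<tau> * M))"
    using w \<tau> \<epsilon> M by (simp add: ennreal_mult[symmetric] ennreal_plus[symmetric] del: ennreal_plus)
  also have "w * (\<tau> * \<epsilon> + 4 powr t / \<tau> * M) = w * (L / 2 + L)"
    using \<tau> L M by (simp add: \<epsilon>_def) (simp add: \<tau>_def)
  finally have "2 * (L * w) \<le> w * (L / 2 + L)" using w L by (subst (asm) ennreal_le_iff) auto
  then show False using w L by (simp add: field_simps)
qed


section \<open>Energies and positivity for almost every slice\<close>

lemma liminf_le_const: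
  fixes f :: "nat \<Rightarrow> ennreal"
  assumes "\<And>j. f j \<le> c"
  shows "liminf f \<le> c"
proof -
  have "liminf f \<le> liminf (\<lambda>_. c)" by (rule Liminf_mono) (simp add: assms)
  then show ?thesis by (simp add: Liminf_const)
qed

context square_integrable_projections
begin

lemma measurable_slice_energy [measurable (raw)]:
  fixes \<nu> :: "(real ^ 'n) measure"
  assumes sets[measurable_cong]: "sets \<nu> = sets borel" and fin: "finite_measure \<nu>"
    and f[measurable]: "f \<in> measurable M \<omega>" and g[measurable]: "g \<in> borel_measurable M"
  shows "(\<lambda>z. slice_energy \<nu> t \<delta> (P (f z)) (g z)) \<in> borel_measurable M"
proof -
  interpret \<nu>: finite_measure \<nu> by (rule fin)
  show ?thesis unfolding slice_energy_def by measurable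
qed

text \<open>When u is integrated first, a pair contributes at most the volume of a
  \<open>\<delta>\<close>-ball, and only if its images are within \<open>2 * \<delta>\<close>. The
  pair bound supplies a second m-th power of \<open>\<delta>\<close>; together they cancel the
  normalisation of \<open>slice_energy\<close>, so the bound is free of
  \<open>\<delta>\<close>.\<close>

lemma energy_integral_bound:
  fixes \<nu> :: "(real ^ 'n) measure"
  assumes sets[measurable_cong]: "sets \<nu> = sets borel" and fin: "finite_measure \<nu>"
    and c: "0 < c" and growth: "\<And>x r. 0 < r \<Longrightarrow> emeasure \<nu> (cball x r) \<le> ennreal (c * r powr s)"
    and t: "0 < t" "t < s - real CARD('m)"
  obtains B :: ennreal where "B < \<infinity>"
    "\<And>\<delta>. 0 < \<delta> \<Longrightarrow> (\<integral>\<^sup>+l. \<integral>\<^sup>+u. slice_energy \<nu> t \<delta> (P l) u \<partial>lborel \<partial>\<omega>) \<le> B"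
proof -
  interpret \<nu>: finite_measure \<nu> by (rule fin)
  interpret u\<nu>: pair_sigma_finite "lborel :: (real ^ 'm) measure" \<nu>
    by (intro pair_sigma_finite.intro lborel.sigma_finite_measure_axioms \<nu>.sigma_finite_measure_axioms)
  have sp[simp]: "space \<nu> = UNIV" using sets_eq_imp_space_eq[OF sets] by simp
  define b where "b = unit_ball_vol (real CARD('m))"
  have b: "0 < b" by (simp add: b_def)
  define G where "G = corr_const * c * 2 powr (s - CARD('m)) * 2 ^ CARD('n)"
  have G: "0 \<le> G" using corr_const_nonneg c by (simp add: G_def)
  \<comment> \<open>The ratio of consecutive dyadic contributions: \<open>2 powr t\<close> from the
    kernel against \<open>2 powr - (s - CARD('m))\<close> from the pair bound. It is below 1 exactly
    when t < s - m.\<close>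
  define \<kappa> :: real where "\<kappa> = 2 powr - (s - CARD('m) - t)"
  have \<kappa>: "0 < \<kappa>" "\<kappa> < 1"
    using t powr_less_mono[of "- (s - CARD('m) - t)" 0 2] by (simp_all add: \<kappa>_def)
  define B where "B = ennreal (b * G * 2 ^ CARD('m)) * (\<Sum>k. ennreal (\<kappa> ^ k)) * emeasure \<nu> UNIV"
  show thesis
  proof
    have "(\<Sum>k. ennreal (\<kappa> ^ k)) \<noteq> top"
      using \<kappa> by (intro ennreal_suminf_neq_top summable_geometric) auto
    moreover have "emeasure \<nu> UNIV \<noteq> top" by simp
    ultimately have "(\<Sum>k. ennreal (\<kappa> ^ k)) < top" "emeasure \<nu> UNIV < top"
      by (simp_all only: less_top)
    then show "B < \<infinity>"
      by (simp add: B_def ennreal_mult_less_top)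
    fix \<delta> :: real assume \<delta>: "0 < \<delta>"
    define w where "w = \<delta> ^ CARD('m)"
    have w: "0 < w" using \<delta> by (simp add: w_def)
    define q where "q k l = (\<integral>\<^sup>+x. \<integral>\<^sup>+y. of_bool (dist x y \<le> 2 powr - real k \<and> dist (P l x) (P l y) \<le> 2 * \<delta>) \<partial>\<nu> \<partial>\<nu>)" for k l
    have q[measurable]: "q k \<in> borel_measurable \<omega>" for k
      unfolding q_def[abs_def] by measurable
    have inner: "(\<integral>\<^sup>+u. slice_energy \<nu> t \<delta> (P l) u \<partial>lborel) \<le> ennreal (b / w) * (\<Sum>k. ennreal (2 powr (real k * t)) * q k l)"
      if l[simp]: "l \<in> space \<omega>" for l
    proof -
      have [measurable]: "P l \<in> borel_measurable borel" using l by (rule measurable_P_slice)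
      let ?o = "\<lambda>u x y. of_bool (dist (P l x) u \<le> \<delta> \<and> dist (P l y) u \<le> \<delta>) :: ennreal"
      let ?q = "\<lambda>k x y. of_bool (dist x y \<le> 2 powr - real k \<and> dist (P l x) (P l y) \<le> 2 * \<delta>) :: ennreal"
      have o: "(\<integral>\<^sup>+u. ?o u x y \<partial>lborel) \<le> ennreal (b * w) * of_bool (dist (P l x) (P l y) \<le> 2 * \<delta>)" for x y
      proof (cases "dist (P l x) (P l y) \<le> 2 * \<delta>")
        case True
        have "(\<integral>\<^sup>+u. ?o u x y \<partial>lborel) \<le> (\<integral>\<^sup>+u. indicator (cball (P l x) \<delta>) u \<partial>lborel)"
          by (intro nn_integral_mono) (auto simp: indicator_def)
        then show ?thesis using True \<delta> by (simp add: emeasure_cball b_def w_def)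
      next
        case False
        have "?o u x y = 0" for u
          using False dist_triangle2[of "P l x" "P l y" u] by auto
        then show ?thesis by (simp only: nn_integral_const mult_zero_left zero_le)
      qed
      have "(\<integral>\<^sup>+u. slice_energy \<nu> t \<delta> (P l) u \<partial>lborel) =
         ennreal (1 / (w * w)) * (\<integral>\<^sup>+u. \<integral>\<^sup>+x. \<integral>\<^sup>+y. dyadic_kernel t (dist x y) * ?o u x y \<partial>\<nu> \<partial>\<nu> \<partial>lborel)"
        unfolding slice_energy_def by (simp add: nn_integral_cmult w_def)
      also have "(\<integral>\<^sup>+u. \<integral>\<^sup>+x. \<integral>\<^sup>+y. dyadic_kernel t (dist x y) * ?o u x y \<partial>\<nu> \<partial>\<nu> \<partial>lborel)
         = (\<integral>\<^sup>+x. \<integral>\<^sup>+u. \<integral>\<^sup>+y. dyadic_kernel t (dist x y) * ?o u x y \<partial>\<nu> \<partial>lborel \<partial>\<nu>)"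
        by (rule u\<nu>.Fubini'[symmetric]) measurable
      also have "\<dots> = (\<integral>\<^sup>+x. \<integral>\<^sup>+y. \<integral>\<^sup>+u. dyadic_kernel t (dist x y) * ?o u x y \<partial>lborel \<partial>\<nu> \<partial>\<nu>)"
        by (intro nn_integral_cong u\<nu>.Fubini'[symmetric]) measurable
      also have "\<dots> = (\<integral>\<^sup>+x. \<integral>\<^sup>+y. dyadic_kernel t (dist x y) * (\<integral>\<^sup>+u. ?o u x y \<partial>lborel) \<partial>\<nu> \<partial>\<nu>)"
        by (intro nn_integral_cong nn_integral_cmult) measurable
      also have "\<dots> \<le> (\<integral>\<^sup>+x. \<integral>\<^sup>+y. ennreal (b * w) * (\<Sum>k. ennreal (2 powr (real k * t)) * ?q k x y) \<partial>\<nu> \<partial>\<nu>)"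
      proof (intro nn_integral_mono)
        fix x y
        have "dyadic_kernel t (dist x y) * (\<integral>\<^sup>+u. ?o u x y \<partial>lborel)
            \<le> dyadic_kernel t (dist x y) * (ennreal (b * w) * of_bool (dist (P l x) (P l y) \<le> 2 * \<delta>))"
          by (intro mult_left_mono o) auto
        also have "\<dots> = ennreal (b * w) * (\<Sum>k. ennreal (2 powr (real k * t)) * ?q k x y)"
        proof (cases "dist (P l x) (P l y) \<le> 2 * \<delta>")
          case True
          then show ?thesis by (simp add: dyadic_kernel_def mult.commute[of "ennreal (b * w)"])
        qed simp
        finally show "dyadic_kernel t (dist x y) * (\<integral>\<^sup>+u. ?o u x y \<partial>lborel) \<le> \<dots>" .
      qed
      also have "\<dots> = ennreal (b * w) * (\<Sum>k. ennreal (2 powr (real k * t)) * q k l)"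
        unfolding q_def by (simp add: nn_integral_cmult nn_integral_suminf)
      finally have "(\<integral>\<^sup>+u. slice_energy \<nu> t \<delta> (P l) u \<partial>lborel)
          \<le> ennreal (1 / (w * w)) * (ennreal (b * w) * (\<Sum>k. ennreal (2 powr (real k * t)) * q k l))"
        by (simp add: mult_left_mono)
      also have "ennreal (1 / (w * w)) * (ennreal (b * w) * z) = ennreal (b / w) * z" for z
        using b w by (simp add: ennreal_mult[symmetric] mult.assoc[symmetric])
      finally show ?thesis .
    qed
    have "(\<integral>\<^sup>+l. \<integral>\<^sup>+u. slice_energy \<nu> t \<delta> (P l) u \<partial>lborel \<partial>\<omega>)
        \<le> (\<integral>\<^sup>+l. ennreal (b / w) * (\<Sum>k. ennreal (2 powr (real k * t)) * q k l) \<partial>\<omega>)"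
      by (intro nn_integral_mono inner)
    also have "\<dots> = ennreal (b / w) * (\<Sum>k. ennreal (2 powr (real k * t)) * (\<integral>\<^sup>+l. q k l \<partial>\<omega>))"
      by (simp add: nn_integral_cmult nn_integral_suminf)
    also have "\<dots> \<le> ennreal (b / w) * (\<Sum>k. ennreal (G * 2 ^ CARD('m) * w) * ennreal (\<kappa> ^ k) * emeasure \<nu> UNIV)"
    proof (intro mult_left_mono suminf_le allI)
      fix k
      have "ennreal (2 powr (real k * t)) * (\<integral>\<^sup>+l. q k l \<partial>\<omega>)
          \<le> ennreal (2 powr (real k * t)) * (ennreal (G * (2 powr - real k) powr (s - CARD('m)) * (2 * \<delta>) ^ CARD('m)) * emeasure \<nu> UNIV)"
        unfolding q_def G_def using \<delta>
        by (intro mult_left_mono near_pairs_correlation[OF sets fin c growth]) auto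
      also have "\<dots> = ennreal (2 powr (real k * t) * (G * (2 powr - real k) powr (s - CARD('m)) * (2 * \<delta>) ^ CARD('m))) * emeasure \<nu> UNIV"
        using G \<delta> by (simp add: ennreal_mult mult.assoc)
      also have "2 powr (real k * t) * (G * (2 powr - real k) powr (s - CARD('m)) * (2 * \<delta>) ^ CARD('m)) = G * 2 ^ CARD('m) * w * \<kappa> ^ k"
      proof -
        have "2 powr (real k * t) * (2 powr - real k) powr (s - CARD('m)) = \<kappa> powr real k"
          by (simp add: \<kappa>_def powr_powr powr_add[symmetric] algebra_simps)
        then show ?thesis using \<kappa> by (simp add: w_def power_mult_distrib powr_realpow mult_ac)
      qed
      also have "ennreal (G * 2 ^ CARD('m) * w * \<kappa> ^ k) = ennreal (G * 2 ^ CARD('m) * w) * ennreal (\<kappa> ^ k)"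
        using G w \<kappa> by (intro ennreal_mult) auto
      finally show "ennreal (2 powr (real k * t)) * (\<integral>\<^sup>+l. q k l \<partial>\<omega>) \<le> \<dots> * emeasure \<nu> UNIV" .
    qed auto
    also have "\<dots> = ennreal (b / w) * (ennreal (G * 2 ^ CARD('m) * w) * (\<Sum>k. ennreal (\<kappa> ^ k)) * emeasure \<nu> UNIV)"
      by (simp only: ennreal_suminf_cmult ennreal_suminf_multc)
    also have "\<dots> = (ennreal (b / w) * ennreal (G * 2 ^ CARD('m) * w)) * (\<Sum>k. ennreal (\<kappa> ^ k)) * emeasure \<nu> UNIV"
      by (simp only: mult.assoc)
    also have "ennreal (b / w) * ennreal (G * 2 ^ CARD('m) * w) = ennreal (b * G * 2 ^ CARD('m))"
      using b w G by (simp add: ennreal_mult[symmetric])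
    finally show "(\<integral>\<^sup>+l. \<integral>\<^sup>+u. slice_energy \<nu> t \<delta> (P l) u \<partial>lborel \<partial>\<omega>) \<le> B"
      by (simp add: B_def)
  qed
qed

text \<open>The available bound is uniform in \<open>\<delta>\<close> but concerns the integral at
  one radius at a time; hence Fatou, once in u and once in l, and a lower limit instead of a
  supremum.\<close>

lemma AE_liminf_slice_energy:
  fixes \<nu> :: "(real ^ 'n) measure"
  assumes sets[measurable_cong]: "sets \<nu> = sets borel" and fin: "finite_measure \<nu>"
    and c: "0 < c" and growth: "\<And>x r. 0 < r \<Longrightarrow> emeasure \<nu> (cball x r) \<le> ennreal (c * r powr s)"
    and t: "0 < t" "t < s - real CARD('m)" and \<delta>: "\<And>j. 0 < \<delta> j"
  shows "AE l in \<omega>. AE u in lborel. liminf (\<lambda>j. slice_energy \<nu> t (\<delta> j) (P l) u) < \<infinity>"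
proof -
  interpret \<nu>: finite_measure \<nu> by (rule fin)
  note [measurable (raw)] = measurable_slice_energy[OF sets fin]
  obtain B where B: "B < \<infinity>"
    "\<And>j. (\<integral>\<^sup>+l. \<integral>\<^sup>+u. slice_energy \<nu> t (\<delta> j) (P l) u \<partial>lborel \<partial>\<omega>) \<le> B"
    using energy_integral_bound[OF sets fin c growth t] \<delta> by metis
  let ?E = "\<lambda>j l u. slice_energy \<nu> t (\<delta> j) (P l) u"
  have "(\<integral>\<^sup>+l. \<integral>\<^sup>+u. liminf (\<lambda>j. ?E j l u) \<partial>lborel \<partial>\<omega>) \<le> (\<integral>\<^sup>+l. liminf (\<lambda>j. \<integral>\<^sup>+u. ?E j l u \<partial>lborel) \<partial>\<omega>)"
  proof (rule nn_integral_mono)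
    fix l assume [simp]: "l \<in> space \<omega>"
    show "(\<integral>\<^sup>+u. liminf (\<lambda>j. ?E j l u) \<partial>lborel) \<le> liminf (\<lambda>j. \<integral>\<^sup>+u. ?E j l u \<partial>lborel)"
      by (rule nn_integral_liminf) simp
  qed
  also have "\<dots> \<le> liminf (\<lambda>j. \<integral>\<^sup>+l. \<integral>\<^sup>+u. ?E j l u \<partial>lborel \<partial>\<omega>)"
    by (rule nn_integral_liminf) measurable
  also have "\<dots> \<le> B"
    by (rule liminf_le_const[OF B(2)])
  finally have "(\<integral>\<^sup>+l. \<integral>\<^sup>+u. liminf (\<lambda>j. ?E j l u) \<partial>lborel \<partial>\<omega>) \<noteq> \<infinity>" using B(1) by auto
  then have "AE l in \<omega>. (\<integral>\<^sup>+u. liminf (\<lambda>j. ?E j l u) \<partial>lborel) \<noteq> \<infinity>"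
    by (intro nn_integral_PInf_AE) measurable
  then show ?thesis
    using AE_space
  proof eventually_elim
    case (elim l)
    note [simp] = elim(2)
    have "AE u in lborel. liminf (\<lambda>j. ?E j l u) \<noteq> \<infinity>"
      using elim(1) by (intro nn_integral_PInf_AE) measurable
    then show ?case by eventually_elim (simp add: less_top)
  qed
qed

text \<open>The condition on u is expressed through the density of the projected measure, which does
  not involve t, so that countably many t can later be combined on one common set.\<close>

lemma AE_fibres_positive:
  fixes \<nu> :: "(real ^ 'n) measure"
  assumes sets[measurable_cong]: "sets \<nu> = sets borel" and fin: "finite_measure \<nu>"
    and c: "0 < c" and growth: "\<And>x r. 0 < r \<Longrightarrow> emeasure \<nu> (cball x r) \<le> ennreal (c * r powr s)"
    and F: "compact F" "emeasure \<nu> (- F) = 0"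
    and t: "0 < t" "t < s - real CARD('m)"
  shows "AE l in \<omega>. absolutely_continuous lborel (distr \<nu> borel (P l)) \<and>
    (AE u in lborel. RN_deriv lborel (distr \<nu> borel (P l)) u \<noteq> 0 \<longrightarrow> hausdorff_measure t (F \<inter> P l -` {u}) \<noteq> 0)"
proof -
  interpret \<nu>: finite_measure \<nu> by (rule fin)
  have sp[simp]: "space \<nu> = UNIV" using sets_eq_imp_space_eq[OF sets] by simp
  obtain R where R: "0 < R" "F \<subseteq> cball 0 R"
    using compact_imp_bounded[OF F(1)] unfolding bounded_pos by (auto simp: subset_iff)
  have "emeasure \<nu> (- cball 0 R) \<le> emeasure \<nu> (- F)"
    using R(2) borel_compact[OF F(1)] by (intro emeasure_mono) (auto simp: sets)
  then have outside: "emeasure \<nu> (- cball 0 R) = 0" using F(2) by simp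
  define \<delta> :: "nat \<Rightarrow> real" where "\<delta> j = 1 / real (Suc j)" for j
  have \<delta>: "\<And>j. 0 < \<delta> j" "\<delta> \<longlonglongrightarrow> 0"
    unfolding \<delta>_def[abs_def] using LIMSEQ_inverse_real_of_nat by (simp_all add: inverse_eq_divide)
  have \<delta>r: "filterlim \<delta> (at_right 0) sequentially"
    using \<delta> less_imp_neq[OF \<delta>(1), symmetric] by (auto simp: filterlim_at intro!: always_eventually)
  have "AE l in \<omega>. absolutely_continuous lborel (distr \<nu> borel (P l))"
    by (rule projections_absolutely_continuous[OF sets fin c growth R(1) outside])
  moreover have "AE l in \<omega>. AE u in lborel. liminf (\<lambda>j. slice_energy \<nu> t (\<delta> j) (P l) u) < \<infinity>"
    by (rule AE_liminf_slice_energy[OF sets fin c growth t \<delta>(1)])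
  ultimately show ?thesis
    using AE_space
  proof eventually_elim
    case (elim l)
    have Pl[measurable]: "P l \<in> borel_measurable borel" using elim(3) by (rule measurable_P_slice)
    define \<tau> where "\<tau> = distr \<nu> borel (P l)"
    define f where "f = RN_deriv lborel \<tau>"
    have f[measurable]: "f \<in> borel_measurable borel" by (simp add: f_def)
    have \<tau>: "density lborel f = \<tau>"
      unfolding f_def using elim(1)
      by (intro sigma_finite_measure.density_RN_deriv lborel.sigma_finite_measure_axioms) (auto simp: \<tau>_def)
    have "(\<integral>\<^sup>+u. f u \<partial>lborel) = emeasure \<tau> UNIV"
      by (simp add: \<tau>[symmetric] emeasure_density)
    also have "\<dots> \<noteq> \<infinity>" by (simp add: \<tau>_def emeasure_distr)
    finally have finf: "(\<integral>\<^sup>+u. f u \<partial>lborel) \<noteq> \<infinity>" .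
    have "AE u in lborel. f u \<noteq> 0 \<longrightarrow> hausdorff_measure t (F \<inter> P l -` {u}) \<noteq> 0"
      using lebesgue_differentiation[OF f finf] elim(2)
    proof eventually_elim
      case (elim u)
      show ?case
      proof
        assume "f u \<noteq> 0"
        then have "0 < f u" by (simp add: zero_less_iff_neq_zero)
        \<comment> \<open>The density may be infinite at u, so a finite positive number strictly
          below it is used.\<close>
        then obtain z where z: "0 < z" "z < f u" using dense by blast
        then obtain L where L: "z = ennreal L" "0 < L"
          by (cases z) (auto simp: less_top[symmetric] dest: less_trans)
        define b where "b = unit_ball_vol (real CARD('m))"
        have "0 < b" by (simp add: b_def)
        have "\<forall>\<^sub>F r in at_right 0. z < emeasure \<tau> (cball u r) / emeasure lborel (cball u r)"
          using order_tendstoD(1)[OF elim(1) z(2)] by (simp add: \<tau>)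
        then have ev: "\<forall>\<^sub>F j in sequentially. z < emeasure \<tau> (cball u (\<delta> j)) / emeasure lborel (cball u (\<delta> j))"
          by (rule eventually_compose_filterlim[OF _ \<delta>r])
        show "hausdorff_measure t (F \<inter> P l -` {u}) \<noteq> 0"
        proof (rule fibre_hausdorff_measure_pos[OF sets fin F _ t(1) \<delta> elim(2), of "L * b"])
          show "continuous_on UNIV (P l)"
            using linear_P[OF \<open>l \<in> space \<omega>\<close>] by (intro linear_continuous_on linear_conv_bounded_linear[THEN iffD1])
          show "0 < L * b" using L \<open>0 < b\<close> by simp
          show "\<forall>\<^sub>F j in sequentially. ennreal (L * b * \<delta> j ^ DIM(real ^ 'm)) \<le> emeasure \<nu> (P l -` cball u (\<delta> j))"
            using ev
          proof eventually_elim
            case (elim j)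
            let ?v = "emeasure lborel (cball u (\<delta> j))"
            have v: "?v = ennreal (b * \<delta> j ^ CARD('m))" using \<delta>(1)[of j] by (simp add: emeasure_cball b_def)
            have "?v \<noteq> 0" "?v \<noteq> top"
              using emeasure_lborel_cball_pos[OF \<delta>(1)[of j], of u] emeasure_lborel_cball_finite[of u "\<delta> j"] by auto
            have "ennreal (L * b * \<delta> j ^ DIM(real ^ 'm)) = z * ?v"
              using L \<open>0 < b\<close> \<delta>(1)[of j] by (simp add: v ennreal_mult[symmetric] mult.assoc)
            also have "\<dots> \<le> emeasure \<tau> (cball u (\<delta> j)) / ?v * ?v"
              using elim by (intro mult_right_mono) auto
            also have "\<dots> = emeasure \<tau> (cball u (\<delta> j))"
              using \<open>?v \<noteq> 0\<close> \<open>?v \<noteq> top\<close> by (simp add: ennreal_divide_times ennreal_times_divide mult_divide_eq_ennreal)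
            also have "\<dots> = emeasure \<nu> (P l -` cball u (\<delta> j))"
              by (simp add: \<tau>_def emeasure_distr)
            finally show ?case .
          qed
        qed
      qed
    qed
    then show ?case using elim(1) by (simp add: f_def \<tau>_def)
  qed
qed

end

text \<open>Integrating the Hausdorff pre-measures of the fibres with respect to u costs at most a constant
  times the s-dimensional sum of the cover.\<close>

lemma AE_fibres_hausdorff_finite:
  fixes p :: "'a::euclidean_space \<Rightarrow> 'b::euclidean_space"
  assumes p: "linear p" and A: "hausdorff_measure s A < \<infinity>" and s: "real DIM('b) < s"
  shows "AE u in lborel. hausdorff_measure (s - DIM('b)) (p -` {u} \<inter> A) < \<infinity>"
proof -
  let ?m = "DIM('b)"
  obtain L where L: "0 < L" "\<And>x. norm (p x) \<le> L * norm x"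
    using linear_bounded_pos[OF p] by blast
  define b where "b = unit_ball_vol (real ?m)"
  have b: "0 < b" by (simp add: b_def)
  let ?d = "\<lambda>j::nat. 1 / (real j + 1)"
  have "\<exists>U::nat \<Rightarrow> 'a set. A \<subseteq> (\<Union>i. U i) \<and> (\<forall>i. bounded (U i)) \<and> (\<forall>i. diameter (U i) \<le> ?d j) \<and>
    (\<Sum>i. diam_powr s (U i)) < hausdorff_measure s A + 1" for j
  proof -
    have "hausdorff_pre_measure s (?d j) A \<le> hausdorff_measure s A"
      by (rule hausdorff_pre_measure_le_measure) simp
    also have "\<dots> < hausdorff_measure s A + 1" using A by (auto simp: less_top)
    finally show ?thesis by (rule hausdorff_pre_measure_lessE) blast
  qed
  then obtain U :: "nat \<Rightarrow> nat \<Rightarrow> 'a set" where U: "\<And>j. A \<subseteq> (\<Union>i. U j i)" "\<And>j i. bounded (U j i)"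
    "\<And>j i. diameter (U j i) \<le> ?d j" "\<And>j. (\<Sum>i. diam_powr s (U j i)) < hausdorff_measure s A + 1"
    by metis
  \<comment> \<open>The cost, in exponent s - m, of the cover sets whose closed image contains u.
    The cover sets are arbitrary, and closing their images makes the indicators measurable.\<close>
  define g where "g j u = (\<Sum>i. ennreal (diameter (U j i) powr (s - ?m)) * indicator (closure (p ` U j i)) u)" for j u
  have g[measurable]: "g j \<in> borel_measurable borel" for j
    unfolding g_def[abs_def] by measurable
  have "(\<integral>\<^sup>+u. g j u \<partial>lborel) \<le> ennreal (b * L ^ ?m) * (hausdorff_measure s A + 1)" for j
  proof -
    have "(\<integral>\<^sup>+u. g j u \<partial>lborel) = (\<Sum>i. ennreal (diameter (U j i) powr (s - ?m)) * emeasure lborel (closure (p ` U j i)))"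
      unfolding g_def by (subst nn_integral_suminf) (auto simp: nn_integral_cmult_indicator)
    also have "\<dots> \<le> (\<Sum>i. ennreal (b * L ^ ?m) * diam_powr s (U j i))"
    proof (intro suminf_le allI)
      fix i
      define d where "d = diameter (U j i)"
      have d: "0 \<le> d" unfolding d_def by (rule diameter_ge_0[OF U(2)])
      show "ennreal (diameter (U j i) powr (s - ?m)) * emeasure lborel (closure (p ` U j i)) \<le> ennreal (b * L ^ ?m) * diam_powr s (U j i)"
      proof (cases "U j i = {}")
        case False
        then obtain x where x: "x \<in> U j i" by auto
        \<comment> \<open>The image has volume of order the m-th power of the diameter, which raises
          the exponent s - m back to s.\<close>
        have "closure (p ` U j i) \<subseteq> cball (p x) (L * d)"
        proof (rule closure_minimal)
          show "p ` U j i \<subseteq> cball (p x) (L * d)"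
          proof
            fix v assume "v \<in> p ` U j i"
            then obtain y where y: "y \<in> U j i" "v = p y" by auto
            have "norm (p (x - y)) \<le> L * norm (x - y)" by (rule L(2))
            also have "norm (x - y) \<le> d"
              using diameter_bounded_bound[OF U(2) x y(1)] by (simp add: d_def dist_norm)
            finally show "v \<in> cball (p x) (L * d)"
              using L(1) y(2) by (simp add: dist_norm linear_diff[OF p] mult_left_mono)
          qed
        qed simp
        then have "emeasure lborel (closure (p ` U j i)) \<le> emeasure lborel (cball (p x) (L * d))"
          by (intro emeasure_mono) auto
        also have "\<dots> = ennreal (b * (L * d) ^ ?m)"
          using L(1) d by (simp add: emeasure_cball b_def)
        finally have "ennreal (d powr (s - ?m)) * emeasure lborel (closure (p ` U j i)) \<le> ennreal (d powr (s - ?m)) * ennreal (b * (L * d) ^ ?m)"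
          by (rule mult_left_mono) simp
        also have "\<dots> = ennreal (b * L ^ ?m * (d powr (s - ?m) * d ^ ?m))"
          using b L(1) d by (simp add: ennreal_mult[symmetric] power_mult_distrib mult_ac)
        also have "d powr (s - ?m) * d ^ ?m = d powr s"
          using d by (cases "d = 0") (auto simp: powr_realpow[symmetric] powr_add[symmetric])
        also have "ennreal (b * L ^ ?m * d powr s) = ennreal (b * L ^ ?m) * diam_powr s (U j i)"
          using b L(1) False s by (simp add: diam_powr_def d_def ennreal_mult[symmetric])
        finally show ?thesis by (simp add: d_def)
      qed simp
    qed auto
    also have "\<dots> = ennreal (b * L ^ ?m) * (\<Sum>i. diam_powr s (U j i))" by (rule ennreal_suminf_cmult)
    also have "\<dots> \<le> ennreal (b * L ^ ?m) * (hausdorff_measure s A + 1)"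
      using U(4)[of j] by (intro mult_left_mono) auto
    finally show ?thesis .
  qed
  then have "liminf (\<lambda>j. \<integral>\<^sup>+u. g j u \<partial>lborel) \<le> ennreal (b * L ^ ?m) * (hausdorff_measure s A + 1)"
    by (rule liminf_le_const)
  also have "\<dots> < \<infinity>" using A by (simp add: ennreal_mult_less_top less_top)
  finally have "liminf (\<lambda>j. \<integral>\<^sup>+u. g j u \<partial>lborel) < \<infinity>" .
  moreover have "(\<integral>\<^sup>+u. liminf (\<lambda>j. g j u) \<partial>lborel) \<le> liminf (\<lambda>j. \<integral>\<^sup>+u. g j u \<partial>lborel)"
    by (rule nn_integral_liminf) measurable
  ultimately have "(\<integral>\<^sup>+u. liminf (\<lambda>j. g j u) \<partial>lborel) \<noteq> \<infinity>" by auto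
  then have "AE u in lborel. liminf (\<lambda>j. g j u) \<noteq> \<infinity>"
    by (intro nn_integral_PInf_AE) measurable
  then show ?thesis
  proof eventually_elim
    case (elim u)
    have "hausdorff_measure (s - ?m) (p -` {u} \<inter> A) \<le> liminf (\<lambda>j. g j u)"
    proof (rule hausdorff_measure_leI)
      fix \<delta> :: real assume "0 < \<delta>"
      then obtain N where "inverse (real (Suc N)) < \<delta>" using reals_Archimedean by blast
      then have N: "?d N < \<delta>" by (simp add: inverse_eq_divide add.commute)
      show "hausdorff_pre_measure (s - ?m) \<delta> (p -` {u} \<inter> A) \<le> liminf (\<lambda>j. g j u)"
      proof (rule Liminf_bounded, rule eventually_sequentiallyI[of N])
        fix j assume "N \<le> j"
        then have "?d j \<le> ?d N" by (intro divide_left_mono) auto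
        then have dj: "?d j \<le> \<delta>" using N by linarith
        \<comment> \<open>Cover sets that miss the fibre of \<open>p\<close> are replaced by the
          empty set, whose gauge is 0.\<close>
        let ?V = "\<lambda>i. if u \<in> p ` U j i then U j i else {}"
        have "hausdorff_pre_measure (s - ?m) \<delta> (p -` {u} \<inter> A) \<le> (\<Sum>i. diam_powr (s - ?m) (?V i))"
        proof (rule hausdorff_pre_measure_le)
          show "p -` {u} \<inter> A \<subseteq> (\<Union>i. ?V i)"
          proof
            fix x assume x: "x \<in> p -` {u} \<inter> A"
            then obtain i where "x \<in> U j i" using U(1)[of j] by auto
            moreover from this x have "u \<in> p ` U j i" by auto
            ultimately show "x \<in> (\<Union>i. ?V i)" by (intro UN_I[of i]) auto
          qed
          show "bounded (?V i)" for i using U(2) by simp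
          show "diameter (?V i) \<le> \<delta>" for i
            using order_trans[OF U(3) dj] \<open>0 < \<delta>\<close> by simp
        qed
        also have "\<dots> \<le> g j u"
          unfolding g_def
        proof (intro suminf_le allI)
          fix i
          show "diam_powr (s - ?m) (?V i) \<le> ennreal (diameter (U j i) powr (s - ?m)) * indicator (closure (p ` U j i)) u"
            using closure_subset[of "p ` U j i"] s by (auto simp: diam_powr_def)
        qed auto
        finally show "hausdorff_pre_measure (s - ?m) \<delta> (p -` {u} \<inter> A) \<le> g j u" .
      qed
    qed
    then show ?case using elim by (auto simp: less_top[symmetric] top_unique)
  qed
qed


section \<open>Measurability of the family, and the dimension of the fibres\<close>

lemma measurable_linear_family:
  fixes P :: "'l::metric_space \<Rightarrow> real ^ 'n \<Rightarrow> real ^ 'm"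
  assumes sets: "sets \<omega> = sets (restrict_space borel \<Lambda>)"
    and lin: "\<And>l. l \<in> \<Lambda> \<Longrightarrow> linear (P l)" and cont: "\<And>x. continuous_on \<Lambda> (\<lambda>l. P l x)"
  shows "(\<lambda>z. P (fst z) (snd z)) \<in> borel_measurable (\<omega> \<Otimes>\<^sub>M borel)"
proof -
  have sp: "space \<omega> = \<Lambda>"
    using sets_eq_imp_space_eq[OF sets] by (simp add: space_restrict_space)
  have [measurable]: "(\<lambda>l. P l b) \<in> borel_measurable \<omega>" for b
    using borel_measurable_continuous_on_restrict[OF cont[of b]] measurable_cong_sets[OF sets refl] by blast
  \<comment> \<open>Expanding x in the basis reduces joint measurability to that of the finitely
    many maps \<open>\<lambda>l. P l b\<close>, which are continuous on
    \<open>\<Lambda>\<close>.\<close>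
  have "(\<lambda>z. \<Sum>b\<in>Basis. (snd z \<bullet> b) *\<^sub>R P (fst z) b) \<in> borel_measurable (\<omega> \<Otimes>\<^sub>M borel)"
    by measurable
  moreover have "P (fst z) (snd z) = (\<Sum>b\<in>Basis. (snd z \<bullet> b) *\<^sub>R P (fst z) b)"
    if "z \<in> space (\<omega> \<Otimes>\<^sub>M borel)" for z
  proof -
    have "linear (P (fst z))" using that sp by (auto simp: space_pair_measure intro: lin)
    then have "P (fst z) (\<Sum>b\<in>Basis. (snd z \<bullet> b) *\<^sub>R b) = (\<Sum>b\<in>Basis. (snd z \<bullet> b) *\<^sub>R P (fst z) b)"
      by (simp add: linear_sum linear_cmul)
    then show ?thesis by (simp add: euclidean_representation)
  qed
  ultimately show ?thesis by (simp cong: measurable_cong)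
qed

text \<open>Up to a null set, \<open>D\<close> contains the Borel set where \<open>f\<close> is
  nonzero, and so does every measurable superset of \<open>D\<close>; this bounds the outer measure
  from below although \<open>D\<close> itself may be non-measurable.\<close>

lemma outer_measure_of_pos:
  fixes f :: "'a::euclidean_space \<Rightarrow> ennreal"
  assumes [measurable]: "f \<in> borel_measurable borel" and "(\<integral>\<^sup>+u. f u \<partial>lborel) \<noteq> 0"
    and D: "AE u in lborel. f u \<noteq> 0 \<longrightarrow> u \<in> D"
  shows "0 < outer_measure_of lebesgue D"
proof -
  let ?G = "{u. f u \<noteq> 0}"
  have G: "?G \<in> sets borel" by measurable
  have "emeasure lborel ?G \<noteq> 0"
  proof
    assume "emeasure lborel ?G = 0"
    then have "AE u in lborel. f u = 0"
      using G by (intro AE_I[of _ _ ?G]) auto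
    then have "(\<integral>\<^sup>+u. f u \<partial>lborel) = 0" by (subst nn_integral_0_iff_AE) auto
    with assms(2) show False by simp
  qed
  then have "0 < emeasure lborel ?G" by (simp add: zero_less_iff_neq_zero)
  also have "emeasure lborel ?G \<le> outer_measure_of lebesgue D"
    unfolding outer_measure_of_def
  proof (rule INF_greatest)
    fix B assume B: "B \<in> {B \<in> sets lebesgue. D \<subseteq> B}"
    have "AE u in lebesgue. u \<in> ?G \<longrightarrow> u \<in> B"
      by (rule AE_completion) (use D B in \<open>auto elim!: eventually_mono\<close>)
    then have "emeasure lebesgue ?G \<le> emeasure lebesgue B"
      using B by (intro emeasure_mono_AE) auto
    then show "emeasure lborel ?G \<le> emeasure lebesgue B" using G by simp
  qed
  finally show ?thesis .
qed

theorem theorem6p2: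
  fixes \<Lambda> :: "'l::metric_space set"
    and P :: "'l \<Rightarrow> real ^ 'n \<Rightarrow> real ^ 'm"
    and \<omega> :: "'l measure"
    and s :: real
    and A :: "(real ^ 'n) set"
  assumes "compact \<Lambda>"
    and "\<And>l. l \<in> \<Lambda> \<Longrightarrow> orthogonal_projection (P l)"
    and "\<And>x. continuous_on \<Lambda> (\<lambda>l. P l x)"
    and "sets \<omega> = sets (restrict_space borel \<Lambda>)"
    and "emeasure \<omega> \<Lambda> \<noteq> 0" and "emeasure \<omega> \<Lambda> < \<infinity>"
    and "s > real CARD('m)"
    and "\<exists>C::real. C > 0 \<and>
      (\<forall>\<mu> \<in> compactly_supported_measures (cball (0 :: real ^ 'n) 1).
        (\<forall>x. \<forall>r>0. emeasure \<mu> (cball x r) \<le> ennreal (r powr s)) \<longrightarrow>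
          (AE l in \<omega>. absolutely_continuous lborel (distr \<mu> borel (P l))) \<and>
          (\<integral>\<^sup>+ l. (\<integral>\<^sup>+ u. (lebesgue_density (distr \<mu> borel (P l)) u)\<^sup>2 \<partial>lborel) \<partial>\<omega>)
            < ennreal C * emeasure \<mu> (cball 0 1))"
    and "hausdorff_measurable s A"
    and "0 < hausdorff_measure s A" and "hausdorff_measure s A < \<infinity>"
  shows "AE l in \<omega>.
    outer_measure_of lebesgue {u. hausdorff_dim (P l -` {u} \<inter> A) = ereal (s - real CARD('m))} > 0"
proof -
  obtain C where C: "C > 0" "\<And>\<mu>. \<mu> \<in> compactly_supported_measures (cball (0 :: real ^ 'n) 1) \<Longrightarrow>
        (\<forall>x. \<forall>r>0. emeasure \<mu> (cball x r) \<le> ennreal (r powr s)) \<Longrightarrow>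
          (AE l in \<omega>. absolutely_continuous lborel (distr \<mu> borel (P l))) \<and>
          (\<integral>\<^sup>+ l. (\<integral>\<^sup>+ u. (lebesgue_density (distr \<mu> borel (P l)) u)\<^sup>2 \<partial>lborel) \<partial>\<omega>)
            < ennreal C * emeasure \<mu> (cball 0 1)"
    using assms(8) by blast
  have space_\<omega>: "space \<omega> = \<Lambda>"
    using sets_eq_imp_space_eq[OF assms(4)] by (simp add: space_restrict_space)
  have lin: "linear (P l)" if "l \<in> \<Lambda>" for l
    using assms(2)[OF that] by (simp add: orthogonal_projection_def)
  interpret square_integrable_projections \<omega> P s C
  proof (intro square_integrable_projections.intro projection_family.intro square_integrable_projections_axioms.intro)
    show "finite_measure \<omega>" using assms(6) by (intro finite_measureI) (simp add: space_\<omega>)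
    show "(\<lambda>z. P (fst z) (snd z)) \<in> borel_measurable (\<omega> \<Otimes>\<^sub>M borel)"
      using lin assms(3) by (intro measurable_linear_family[OF assms(4)])
  qed (use lin space_\<omega> assms(7) C in auto)
  have s0: "0 < s" using assms(7) of_nat_0_le_iff[of "CARD('m)"] by (rule le_less_trans[rotated])
  let ?H = "hausdorff_measure s :: (real ^ 'n) set \<Rightarrow> ennreal"
  obtain K where K: "compact K" "K \<subseteq> A" "0 < ?H K"
    using hausdorff_measurable_compact_subset[OF less_imp_le[OF s0] assms(9-11)] .
  have "?H K < \<infinity>" using hausdorff_measure_mono[OF K(2), of s] assms(11) by (rule le_less_trans)
  then obtain F c where F: "compact F" "F \<subseteq> K" "0 < ?H F" and c: "0 < c"
    and growth: "\<And>x r. 0 < r \<Longrightarrow> ?H (F \<inter> cball x r) \<le> ennreal (c * r powr s)"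
    using hausdorff_compact_upper_density[OF s0 K(1,3)] by blast
  have FA: "F \<subseteq> A" using F(2) K(2) by auto
  have Fb: "F \<in> sets borel" using F(1) by (rule borel_compact)
  define \<nu> where "\<nu> = density (hausdorff_borel s) (indicator F)"
  have sets_\<nu>: "sets \<nu> = sets borel" by (simp add: \<nu>_def)
  have \<nu>: "emeasure \<nu> X = ?H (F \<inter> X)" if "X \<in> sets borel" for X
    unfolding \<nu>_def using that Fb s0
    by (subst emeasure_restricted) (auto simp: emeasure_hausdorff_borel)
  have "?H F < \<infinity>" using hausdorff_measure_mono[OF FA, of s] assms(11) by (rule le_less_trans)
  then have fin: "finite_measure \<nu>"
    using \<nu>[of UNIV] sets_eq_imp_space_eq[OF sets_\<nu>] by (intro finite_measureI) auto
  interpret \<nu>: finite_measure \<nu> by (rule fin)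
  have growth': "emeasure \<nu> (cball x r) \<le> ennreal (c * r powr s)" if "0 < r" for x r
    using growth[OF that] \<nu>[of "cball x r"] by simp
  have outside: "emeasure \<nu> (- F) = 0" using Fb by (simp add: \<nu>)
  define d where "d = s - real CARD('m)"
  have d: "0 < d" using assms(7) by (simp add: d_def)
  \<comment> \<open>The shift by 2 keeps \<open>t 0\<close> positive; \<open>t i\<close> increases
    to d.\<close>
  define t where "t i = d - d / (real i + 2)" for i :: nat
  have t: "0 < t i" "t i < s - real CARD('m)" for i
    using d divide_strict_left_mono[of 1 "real i + 2" d] by (simp_all add: t_def d_def[symmetric])
  \<comment> \<open>One exceptional null set of l serves all exponents \<open>t i\<close>.\<close>
  have "AE l in \<omega>. \<forall>i. absolutely_continuous lborel (distr \<nu> borel (P l)) \<and>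
    (AE u in lborel. RN_deriv lborel (distr \<nu> borel (P l)) u \<noteq> 0 \<longrightarrow> hausdorff_measure (t i) (F \<inter> P l -` {u}) \<noteq> 0)"
    unfolding AE_all_countable
    by (intro allI AE_fibres_positive[OF sets_\<nu> fin c growth' F(1) outside t])
  then show ?thesis
    using AE_space
  proof eventually_elim
    case (elim l)
    have [measurable]: "P l \<in> borel_measurable borel" using elim(2) by (rule measurable_P_slice)
    let ?\<tau> = "distr \<nu> borel (P l)"
    let ?f = "RN_deriv lborel ?\<tau>"
    have "density lborel ?f = ?\<tau>"
      using elim(1) by (intro sigma_finite_measure.density_RN_deriv lborel.sigma_finite_measure_axioms) auto
    moreover have "emeasure (density lborel ?f) UNIV = (\<integral>\<^sup>+u. ?f u \<partial>lborel)"
      by (simp add: emeasure_density)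
    ultimately have "(\<integral>\<^sup>+u. ?f u \<partial>lborel) = emeasure ?\<tau> UNIV" by simp
    \<comment> \<open>The projected measure keeps the full mass of \<open>F\<close>, so its density
      cannot vanish almost everywhere.\<close>
    also have "\<dots> = ?H F"
      using \<nu>[of UNIV] sets_eq_imp_space_eq[OF sets_\<nu>]
      by (subst emeasure_distr) (auto simp: measurable_cong_sets[OF sets_\<nu> refl])
    finally have f0: "(\<integral>\<^sup>+u. ?f u \<partial>lborel) \<noteq> 0" using F(3) by simp
    have "AE u in lborel. \<forall>i. ?f u \<noteq> 0 \<longrightarrow> hausdorff_measure (t i) (F \<inter> P l -` {u}) \<noteq> 0"
      unfolding AE_all_countable using elim(1) by blast
    \<comment> \<open>The upper bound on the dimension concerns the whole fibre in \<open>A\<close>;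
      for the lower bound the part inside \<open>F\<close> is enough, by monotonicity.\<close>
    moreover have "AE u in lborel. hausdorff_measure d (P l -` {u} \<inter> A) < \<infinity>"
      using AE_fibres_hausdorff_finite[OF linear_P[OF elim(2)] assms(11)] assms(7) by (simp add: d_def)
    ultimately have "AE u in lborel. ?f u \<noteq> 0 \<longrightarrow>
       u \<in> {u. hausdorff_dim (P l -` {u} \<inter> A) = ereal (s - real CARD('m))}"
    proof eventually_elim
      case (elim u)
      show ?case
      proof
        assume "?f u \<noteq> 0"
        then have pos: "hausdorff_measure (t i) (F \<inter> P l -` {u}) \<noteq> 0" for i using elim(1) by blast
        have "hausdorff_dim (P l -` {u} \<inter> A) = ereal d"
        proof (rule hausdorff_dim_eqI[OF d elim(2)])
          fix e :: real assume "0 < e"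
          then obtain i where "inverse (real (Suc i)) < e / d"
            using reals_Archimedean[of "e / d"] d by auto
          moreover have "1 / (real i + 2) \<le> inverse (real (Suc i))"
            by (simp add: inverse_eq_divide frac_le)
          ultimately have "1 / (real i + 2) < e / d" by linarith
          then have "d / (real i + 2) < e" using d by (simp add: field_simps)
          then have "d - e \<le> t i" by (simp add: t_def)
          moreover have "hausdorff_measure (t i) (P l -` {u} \<inter> A) \<noteq> 0"
          proof
            assume "hausdorff_measure (t i) (P l -` {u} \<inter> A) = 0"
            moreover have "F \<inter> P l -` {u} \<subseteq> P l -` {u} \<inter> A" using FA by blast
            ultimately show False
              using pos[of i] hausdorff_measure_mono by (metis le_zero_eq)
          qed
          ultimately show "\<exists>t. 0 \<le> t \<and> d - e \<le> t \<and> t < d \<and> hausdorff_measure t (P l -` {u} \<inter> A) \<noteq> 0"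
            using t[of i] by (intro exI[of _ "t i"]) (simp add: d_def)
        qed
        then show "u \<in> {u. hausdorff_dim (P l -` {u} \<inter> A) = ereal (s - real CARD('m))}" by (simp add: d_def)
      qed
    qed
    then show ?case
      using f0 by (intro outer_measure_of_pos) auto
  qed
qed

end
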